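(* Let $q$ be a prime power, $r\ge 1$, and let $a,b\in\mathbb{F}_{q^{2r}}$, not both in $\mathbb{F}_{q^2}$, satisfy $a^{q+1}+b^q+b\neq 0$. Let $\bar{\mathbb{F}}_{q^{2r}}$ be an algebraic closure of $\mathbb{F}_{q^{2r}}$, let $K=\bar{\mathbb{F}}_{q^{2r}}(m)$ be the rational function field in $m$, and let $L=K(u)$ where $$u^{q+1}+u^qm^q+um-((ma-b)^q+ma-b)=0.$$ Then the geometric monodromy group of $L|K$ is isomorphic to $\mathrm{PGL}(2,q)$, and the Galois closure $M$ of $L|K$ is $M=\bar{\mathbb{F}}_{q^{2r}}(m,u,v,w)$ where $$\begin{cases}u^{q+1}+u^qm^q+um-((ma-b)^q+ma-b)=0,\\ v^q+(u+m^q)v^{q-1}+u^q+m=0,\\ v+u+m^q-(u+m^q)w^{q-1}=0.\end{cases}$$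
   Context: The geometric monodromy group of the finite separable extension $L|K$ is the Galois group $\mathrm{Gal}(M|K)$ of its Galois closure $M|K$. *)

theory Defs
  imports
    "HOL-Analysis.Analysis"
    "HOL-Algebra.Algebra"
    "HOL-Algebra.Algebraic_Closure_Type"
    "HOL-Number_Theory.Prime_Powers"
begin

section \<open>Galois theory over a field type\<close>

text \<open>
  The base field is a type \<open>'k\<close>, and all extensions are subfields of its algebraic closure
  \<open>'k alg_closure\<close>, given as sets. Inside \<open>'k alg_closure\<close> the base field is \<open>range to_ac\<close>.
\<close>

abbreviation type_subfield :: "'a::field set \<Rightarrow> bool" where
  "type_subfield S \<equiv> subfield S (ring_of_type_algebra :: 'a ring)"

abbreviation field_gen :: "'a::field set \<Rightarrow> 'a set" where
  "field_gen S \<equiv> generate_field (ring_of_type_algebra :: 'a ring) S"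

definition root_in_closure :: "'k::field poly \<Rightarrow> 'k alg_closure \<Rightarrow> bool" where
  "root_in_closure p x \<longleftrightarrow> poly (map_poly to_ac p) x = 0"

definition normal_extension :: "'k::field alg_closure set \<Rightarrow> bool" where
  "normal_extension M \<longleftrightarrow>
     (\<forall>p :: 'k poly. Factorial_Ring.irreducible p \<and> (\<exists>x\<in>M. root_in_closure p x) \<longrightarrow> (\<forall>x. root_in_closure p x \<longrightarrow> x \<in> M))"

text \<open>\<open>rsquarefree\<close> over an algebraically closed field says that all roots are simple.\<close>

definition separable_extension :: "'k::field alg_closure set \<Rightarrow> bool" where
  "separable_extension M \<longleftrightarrow>
     (\<forall>x\<in>M. \<exists>p :: 'k poly. Factorial_Ring.irreducible p \<and> root_in_closure p x \<and> rsquarefree (map_poly to_ac p))"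

definition galois_extension :: "'k::field alg_closure set \<Rightarrow> bool" where
  "galois_extension M \<longleftrightarrow>
     type_subfield M \<and> range to_ac \<subseteq> M \<and> normal_extension M \<and> separable_extension M"

definition is_galois_closure :: "'k::field alg_closure set \<Rightarrow> 'k alg_closure set \<Rightarrow> bool" where
  "is_galois_closure L M \<longleftrightarrow>
     galois_extension M \<and> L \<subseteq> M \<and> (\<forall>N. galois_extension N \<and> L \<subseteq> N \<longrightarrow> M \<subseteq> N)"

lemma is_galois_closure_unique:
  "is_galois_closure L M \<Longrightarrow> is_galois_closure L M' \<Longrightarrow> M = M'"
  by (simp add: is_galois_closure_def subset_antisym)

definition galois_group :: "'k::field alg_closure set \<Rightarrow> ('k alg_closure \<Rightarrow> 'k alg_closure) monoid" where
  "galois_group M = BijGroup M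
     \<lparr>carrier := {\<sigma> \<in> Bij M. (\<forall>x\<in>M. \<forall>y\<in>M. \<sigma> (x + y) = \<sigma> x + \<sigma> y \<and> \<sigma> (x * y) = \<sigma> x * \<sigma> y)
                           \<and> (\<forall>x\<in>range to_ac. \<sigma> x = x)}\<rparr>"

text \<open>Meaningful if \<open>L\<close> is separable over the base field; then the Galois closure exists.\<close>

definition geometric_monodromy_group ::
    "'k::field alg_closure set \<Rightarrow> ('k alg_closure \<Rightarrow> 'k alg_closure) monoid" where
  "geometric_monodromy_group L = galois_group (THE M. is_galois_closure L M)"


section \<open>Projective linear groups over a subfield\<close>

definition GL :: "'a::field set \<Rightarrow> ('a^'n^'n) monoid" where
  "GL F = \<lparr>carrier = {A. (\<forall>i j. A $ i $ j \<in> F) \<and> det A \<noteq> 0}, monoid.mult = (**), one = mat 1\<rparr>"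

definition PGL :: "'a::field set \<Rightarrow> ('a^'n^'n) set monoid" where
  "PGL F = GL F Mod {mat c |c. c \<in> F \<and> c \<noteq> 0}"

abbreviation PGL2 :: "'a::field set \<Rightarrow> ('a^2^2) set monoid" where
  "PGL2 F \<equiv> PGL F"


section \<open>The rational function field over the algebraic closure\<close>

type_synonym 'f geom_ratfun = "'f alg_closure poly fract"

definition const :: "'f::field alg_closure \<Rightarrow> 'f geom_ratfun alg_closure" where
  "const c = to_ac (Fraction_Field.Fract [:c:] 1)"

definition indet :: "'f::field geom_ratfun alg_closure" where
  "indet = to_ac (Fraction_Field.Fract [:0, 1:] 1)"

end

theory Submission
  imports Defs
begin

text \<open>
  Put \<open>Y = u + m\<^sup>q\<close>, \<open>E = m - m\<^bsup>q*q\<^esup>\<close> and \<open>D = m\<^bsup>q+1\<^esup> + (m a - b)\<^sup>q + m a - b\<close>. The first equation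
  reads \<open>Y (Y\<^sup>q + E) = D\<close>, that is, \<open>u\<^sup>q\<close> is the image of \<open>u\<close> under a projectivity over the base field.
  Hence the solutions form a torsor under the projective linear group of the field with \<open>q\<close> elements.
  Its coordinate is \<open>w\<close>: it generates \<open>M\<close>, it is a root of an explicit polynomial \<open>Phi\<close> of degree
  \<open>q\<^sup>3 - q\<close>, and all roots of \<open>Phi\<close> are Moebius transforms of \<open>w\<close> with coefficients in that field.
  The theorem thus amounts to the irreducibility of \<open>Phi\<close>.

  As \<open>a\<close> and \<open>b\<close> do not both lie in the field with \<open>q\<^sup>2\<close> elements, \<open>D\<close> has a simple zero \<open>m0\<close> outside that
  field. Extend the valuation at \<open>m0\<close> to the algebraic closure. Exactly one root \<open>u\<close> has \<open>Y\<close> of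
  positive valuation. If \<open>\<mu>\<^sup>q = m0\<close>, then for every other root \<open>x\<close> the valuation of \<open>x + \<mu>\<close> is
  \<open>1 / q\<close>, while \<open>w\<close> has valuation \<open>- 1 / (q - 1)\<close>.
  Norms have integral valuation, so the orbit of the special root has \<open>1\<close> or \<open>q + 1\<close> elements, and its
  stabilizer has order divisible by \<open>q\<close> and by \<open>q - 1\<close>. Comparing degrees excludes a root \<open>u\<close> in the
  base field, and the Galois group has order at least \<open>(q + 1) q (q - 1)\<close>.
\<close>

section \<open>Galois theory of simple extensions\<close>

text \<open>No ramification theory is used. A valuation is represented by a valuation ring of the
  algebraic closure, found by Zorn's lemma, and a valuation \<open>1 / e\<close> is expressed by
  \<open>z ^ e = t * x\<close> with a unit \<open>x\<close>. Such a ring need not be stable under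
  the Galois group, so only norms are evaluated: a norm lies in the base field, hence is an integral
  power of \<open>t\<close> up to a unit, and \<open>e\<close> divides the number of its factors of
  valuation \<open>1 / e\<close>. A norm over the whole group thus measures a coset of a stabilizer,
  without decomposition groups.

  The obstacle is to find elements all of whose other conjugates are units. This is why
  \<open>m0\<close> has to avoid the field with \<open>q^2\<close> elements: then \<open>E\<close>
  is a unit, which isolates the special root, and the residues \<open>0\<close>, \<open>1\<close>,
  \<open>m0\<close>, and likewise \<open>\<mu>\<close> and \<open>m0^q\<close>, are distinct, which
  leaves room to correct \<open>w\<close> and \<open>u + v\<close> into elements with known
  behaviour at every conjugate.\<close>

lemma type_subfield_iff:
  "type_subfield (S :: 'a::field set) \<longleftrightarrow>
     1 \<in> S \<and> (\<forall>x\<in>S. \<forall>y\<in>S. x + y \<in> S \<and> x * y \<in> S) \<and> (\<forall>x\<in>S. - x \<in> S \<and> inverse x \<in> S)"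
proof -
  interpret F: field "ring_of_type_algebra :: 'a ring" by (rule field_from_type_algebra)
  have car: "carrier (ring_of_type_algebra :: 'a ring) = UNIV"
    and ops: "x \<oplus>\<^bsub>ring_of_type_algebra\<^esub> y = x + y" "x \<otimes>\<^bsub>ring_of_type_algebra\<^esub> y = x * y"
      "\<one>\<^bsub>ring_of_type_algebra\<^esub> = (1::'a)" "\<zero>\<^bsub>ring_of_type_algebra\<^esub> = (0::'a)" for x y :: 'a
    by (simp_all add: ring_of_type_algebra_def)
  have neg: "\<ominus>\<^bsub>ring_of_type_algebra\<^esub> x = - x" for x :: 'a
    by (metis F.add.inv_equality F.add.m_comm UNIV_I add.right_inverse car ops(1,4))
  have inv: "inv\<^bsub>ring_of_type_algebra\<^esub> x = inverse x" if "x \<noteq> 0" for x :: 'a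
    by (rule F.inv_char) (use that in \<open>simp_all add: car ops\<close>)
  show ?thesis
  proof
    assume S: "type_subfield S"
    note sr = subringE[OF subfieldE(1)[OF S]]
    have "inverse x \<in> S" if "x \<in> S" for x
    proof (cases "x = 0")
      case False
      then show ?thesis using F.subfield_m_inv(1)[OF S, of x] that inv[OF False] by (simp add: ops)
    qed (use that in simp)
    then show "1 \<in> S \<and> (\<forall>x\<in>S. \<forall>y\<in>S. x + y \<in> S \<and> x * y \<in> S) \<and> (\<forall>x\<in>S. - x \<in> S \<and> inverse x \<in> S)"
      using sr by (simp add: ops neg)
  next
    assume *: "1 \<in> S \<and> (\<forall>x\<in>S. \<forall>y\<in>S. x + y \<in> S \<and> x * y \<in> S) \<and> (\<forall>x\<in>S. - x \<in> S \<and> inverse x \<in> S)"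
    have "subring S (ring_of_type_algebra :: 'a ring)"
      by (rule F.subringI) (use * in \<open>auto simp: ops car neg\<close>)
    then show "type_subfield S"
      using * by (intro F.subfieldI') (auto simp: ops inv)
  qed
qed

lemma type_subfieldD:
  fixes S :: "'a::field set"
  assumes "type_subfield S"
  shows "0 \<in> S" "1 \<in> S"
    and "x \<in> S \<Longrightarrow> y \<in> S \<Longrightarrow> x + y \<in> S" "x \<in> S \<Longrightarrow> y \<in> S \<Longrightarrow> x - y \<in> S"
    and "x \<in> S \<Longrightarrow> y \<in> S \<Longrightarrow> x * y \<in> S" "x \<in> S \<Longrightarrow> y \<in> S \<Longrightarrow> x / y \<in> S"
    and "x \<in> S \<Longrightarrow> - x \<in> S" "x \<in> S \<Longrightarrow> inverse x \<in> S" "x \<in> S \<Longrightarrow> x ^ n \<in> S"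
proof -
  note * = assms[unfolded type_subfield_iff]
  show "1 \<in> S" using * by blast
  then show "0 \<in> S" using * by (metis add.right_inverse)
  show "x \<in> S \<Longrightarrow> y \<in> S \<Longrightarrow> x + y \<in> S" using * by blast
  show "x \<in> S \<Longrightarrow> y \<in> S \<Longrightarrow> x * y \<in> S" using * by blast
  show "x \<in> S \<Longrightarrow> - x \<in> S" using * by blast
  show "x \<in> S \<Longrightarrow> inverse x \<in> S" using * by blast
  show "x \<in> S \<Longrightarrow> y \<in> S \<Longrightarrow> x - y \<in> S" using * by (metis diff_conv_add_uminus)
  show "x \<in> S \<Longrightarrow> y \<in> S \<Longrightarrow> x / y \<in> S" using * by (metis divide_inverse)
  show "x \<in> S \<Longrightarrow> x ^ n \<in> S" using * by (induction n) auto
qed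

lemma field_gen_props:
  fixes S :: "'a::field set"
  shows "type_subfield (field_gen S)" "S \<subseteq> field_gen S"
    and "type_subfield F \<Longrightarrow> S \<subseteq> F \<Longrightarrow> field_gen S \<subseteq> F"
proof -
  interpret F: field "ring_of_type_algebra :: 'a ring" by (rule field_from_type_algebra)
  have car: "S \<subseteq> carrier (ring_of_type_algebra :: 'a ring)" by (simp add: ring_of_type_algebra_def)
  show "type_subfield (field_gen S)" "S \<subseteq> field_gen S"
    "type_subfield F \<Longrightarrow> S \<subseteq> F \<Longrightarrow> field_gen S \<subseteq> F"
    using F.generate_fieldE[OF car refl] by auto
qed

section \<open>Evaluation in the algebraic closure and minimal polynomials\<close>

definition ev :: "'k::field poly \<Rightarrow> 'k alg_closure \<Rightarrow> 'k alg_closure" where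
  "ev p x = poly (map_poly to_ac p) x"

lemma map_poly_to_ac [simp]:
  fixes p r :: "'k::field poly"
  shows "map_poly to_ac (p + r) = map_poly to_ac p + map_poly to_ac r"
    and "map_poly to_ac (p - r) = map_poly to_ac p - map_poly to_ac r"
    and "map_poly to_ac (- p) = - map_poly to_ac p"
    and "map_poly to_ac (p * r) = map_poly to_ac p * map_poly to_ac r"
    and "map_poly to_ac (pCons c p) = pCons (to_ac c) (map_poly to_ac p)"
    and "map_poly to_ac (Polynomial.smult c p) = Polynomial.smult (to_ac c) (map_poly to_ac p)"
  by (auto intro!: poly_eqI simp: coeff_map_poly coeff_mult to_ac_sum coeff_pCons split: nat.split)

lemma map_poly_to_ac_1 [simp]: "map_poly to_ac (1 :: 'k::field poly) = 1"
  by (simp add: one_pCons)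

lemma map_poly_to_ac_eq_iff [simp]:
  "map_poly to_ac p = map_poly to_ac (r :: 'k::field poly) \<longleftrightarrow> p = r"
  by (metis (no_types, lifting) coeff_map_poly poly_eqI to_ac_0 to_ac_eq_iff)

lemma map_poly_to_ac_eq_0_iff [simp]: "map_poly to_ac (p :: 'k::field poly) = 0 \<longleftrightarrow> p = 0"
  using map_poly_to_ac_eq_iff[of p 0] by simp

lemma degree_map_poly_to_ac [simp]:
  "Polynomial.degree (map_poly to_ac (p :: 'k::field poly)) = Polynomial.degree p"
  by (rule degree_map_poly) simp

lemma ev_simps [simp]:
  fixes p r :: "'k::field poly"
  shows "ev 0 x = 0" "ev 1 x = 1" "ev (p + r) x = ev p x + ev r x" "ev (p - r) x = ev p x - ev r x"
    and "ev (- p) x = - ev p x" "ev (p * r) x = ev p x * ev r x"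
    and "ev (pCons c p) x = to_ac c + x * ev p x" "ev (Polynomial.smult c p) x = to_ac c * ev p x"
  by (simp_all add: ev_def)

lemma ev_power [simp]: "ev ((p :: 'k::field poly) ^ n) x = ev p x ^ n"
  by (induction n) auto

lemma ev_pcompose: "ev (pcompose p (r :: 'k::field poly)) x = ev p (ev r x)"
  by (induction p) (auto simp: pcompose_pCons)

lemma minimal_polynomial:
  fixes x :: "'k::field alg_closure"
  obtains p :: "'k poly" where "Factorial_Ring.irreducible p" "ev p x = 0"
    "\<And>r. ev r x = 0 \<longleftrightarrow> p dvd r"
proof -
  define A where "A = (\<lambda>n. \<exists>p :: 'k poly. p \<noteq> 0 \<and> ev p x = 0 \<and> Polynomial.degree p = n)"
  have "\<exists>n. A n" using alg_closure_algebraic[of x] unfolding A_def ev_def by metis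
  then have "A (LEAST n. A n)" by (rule LeastI_ex)
  then obtain p where p: "p \<noteq> 0" "ev p x = 0" "Polynomial.degree p = (LEAST n. A n)"
    unfolding A_def by blast
  have least: "Polynomial.degree p \<le> Polynomial.degree r" if "r \<noteq> 0" "ev r x = 0" for r
    unfolding p(3) by (rule Least_le) (use that in \<open>auto simp: A_def\<close>)
  have dvd: "ev r x = 0 \<longleftrightarrow> p dvd r" for r
  proof
    assume r: "ev r x = 0"
    have "ev (r mod p) x = ev (r - p * (r div p)) x"
      by (simp add: minus_mult_div_eq_mod)
    then have "ev (r mod p) x = 0" using r p by simp
    then have "r mod p = 0"
      using least[of "r mod p"] degree_mod_less[of p r] p(1) by linarith
    then show "p dvd r" by (simp add: dvd_eq_mod_eq_0)
  qed (use p in \<open>auto elim: dvdE\<close>)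
  have deg: "Polynomial.degree p > 0"
  proof (rule ccontr)
    assume "\<not> Polynomial.degree p > 0"
    then obtain c where "p = [:c:]" by (metis degree_eq_zeroE neq0_conv)
    then show False using p by simp
  qed
  have "Factorial_Ring.irreducible p"
  proof (rule Factorial_Ring.irreducibleI)
    show "\<not> p dvd 1" using deg by (metis is_unit_iff_degree degree_0 less_irrefl)
    fix r s assume rs: "p = r * s"
    then have "p dvd r \<or> p dvd s" using p dvd by (metis ev_simps(6) mult_eq_0_iff)
    moreover have "r \<noteq> 0" "s \<noteq> 0" using rs p(1) by auto
    ultimately have "Polynomial.degree s = 0 \<or> Polynomial.degree r = 0"
      using rs dvd_imp_degree_le[of p r] dvd_imp_degree_le[of p s] by (auto simp: degree_mult_eq)
    then show "r dvd 1 \<or> s dvd 1"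
      using \<open>r \<noteq> 0\<close> \<open>s \<noteq> 0\<close> by (auto simp: is_unit_iff_degree)
  qed (fact p)
  then show thesis using that p dvd by blast
qed

lemma irreducible_dvd_iff_ev:
  fixes p :: "'k::field poly"
  assumes "Factorial_Ring.irreducible p" "ev p x = 0"
  shows "ev r x = 0 \<longleftrightarrow> p dvd r"
proof -
  obtain p' where p': "Factorial_Ring.irreducible p'" "\<And>r. ev r x = 0 \<longleftrightarrow> p' dvd r"
    by (metis minimal_polynomial)
  then obtain s where "p = p' * s" using assms by (metis dvdE)
  moreover have "\<not> p' dvd 1" using p'(1) by (auto dest: Factorial_Ring.irreducible_not_unit)
  ultimately have "s dvd 1" using assms(1) by (metis Factorial_Ring.irreducibleD)
  then have "p dvd r \<longleftrightarrow> p' dvd r" using \<open>p = p' * s\<close> by (simp add: mult_unit_dvd_iff)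
  then show ?thesis using p' by simp
qed

section \<open>Squarefree polynomials and simple roots\<close>

lemma rsquarefree_dvd:
  fixes p r :: "'a::idom poly"
  assumes "p dvd r" "rsquarefree r"
  shows "rsquarefree p"
proof -
  have "r \<noteq> 0" using assms by (simp add: rsquarefree_def)
  then have "p \<noteq> 0" using assms(1) by auto
  moreover have "Polynomial.order a p \<le> Polynomial.order a r" for a
    using assms(1) \<open>r \<noteq> 0\<close> by (simp add: dvd_imp_order_le)
  moreover have "Polynomial.order a r \<le> 1" for a
    using assms(2) unfolding rsquarefree_def by (metis le_numeral_extra(4) zero_le)
  ultimately show ?thesis unfolding rsquarefree_def
    by (metis le_antisym le_trans less_one not_le)
qed

lemma card_roots_rsquarefree:
  fixes p :: "'a::alg_closed_field poly"
  assumes "rsquarefree p"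
  shows "card {x. poly p x = 0} = Polynomial.degree p"
  using assms
proof (induction "Polynomial.degree p" arbitrary: p)
  case 0
  then obtain c where "p = [:c:]" by (metis degree_eq_zeroE)
  moreover have "c \<noteq> 0" using 0 calculation by (auto simp: rsquarefree_def)
  ultimately show ?case by simp
next
  case (Suc n)
  then have p0: "p \<noteq> 0" by (simp add: rsquarefree_def)
  obtain x where x: "poly p x = 0" using Suc by (metis alg_closed_imp_poly_has_root zero_less_Suc)
  then obtain r where r: "p = [:-x, 1:] * r" by (metis dvdE poly_eq_0_iff_dvd)
  then have r0: "r \<noteq> 0" using p0 by auto
  have sq: "rsquarefree r" using Suc.prems r by (metis rsquarefree_dvd dvd_triv_right)
  have "Polynomial.order x p = 1 + Polynomial.order x r"
  proof -
    have "Polynomial.order x [:-x, 1:] = 1" using order_power_n_n[of x 1] by simp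
    then show ?thesis using r p0 by (metis order_mult)
  qed
  then have "Polynomial.order x r = 0"
    using Suc.prems unfolding rsquarefree_def by (metis One_nat_def Suc_inject nat.distinct(1) plus_1_eq_Suc)
  then have "poly r x \<noteq> 0" using r0 by (simp add: order_root)
  moreover have "{y. poly p y = 0} = insert x {y. poly r y = 0}" using r by auto
  moreover have "Polynomial.degree p = Suc (Polynomial.degree r)"
    unfolding r by (subst degree_mult_eq) (use r0 in auto)
  ultimately show ?case using Suc sq r0 by (simp add: poly_roots_finite)
qed

lemma rsquarefreeI:
  fixes p :: "'a::field poly"
  assumes "p \<noteq> 0" "\<And>a. poly p a = 0 \<Longrightarrow> poly (pderiv p) a \<noteq> 0"
  shows "rsquarefree p"
  unfolding rsquarefree_def
proof (intro conjI allI)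
  fix a
  show "Polynomial.order a p = 0 \<or> Polynomial.order a p = 1"
  proof (rule ccontr)
    assume "\<not> ?thesis"
    then have "2 \<le> Polynomial.order a p" by linarith
    then have "[:-a, 1:]^2 dvd p" using order_1 power_le_dvd by blast
    then obtain s where s: "p = [:-a, 1:]^2 * s" by (elim dvdE)
    have "poly p a = 0" "poly (pderiv p) a = 0"
      unfolding s power2_eq_square by (simp_all only: pderiv_mult poly_mult poly_add) simp_all
    then show False using assms by blast
  qed
qed (fact assms)


lemma rsquarefree_prod_linear:
  assumes "finite A"
  shows "rsquarefree (\<Prod>y\<in>A. [:- y, 1 :: 'a::field:])"
proof (rule rsquarefreeI)
  show "(\<Prod>y\<in>A. [:- y, 1 :: 'a:]) \<noteq> 0" using assms by auto
  fix a assume "poly (\<Prod>y\<in>A. [:- y, 1 :: 'a:]) a = 0"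
  then have a: "a \<in> A" using assms by (auto simp: poly_prod)
  then have *: "(\<Prod>y\<in>A. [:- y, 1 :: 'a:]) = [:- a, 1:] * (\<Prod>y\<in>A - {a}. [:- y, 1 :: 'a:])"
    using assms by (simp add: prod.remove)
  show "poly (pderiv (\<Prod>y\<in>A. [:- y, 1 :: 'a:])) a \<noteq> 0"
    unfolding * pderiv_mult using assms by (auto simp: poly_prod pderiv_pCons)
qed

section \<open>Automorphism groups of intermediate fields\<close>

lemma galois_group_simps:
  "carrier (galois_group M) = {\<sigma> \<in> Bij M. (\<forall>x\<in>M. \<forall>y\<in>M. \<sigma> (x + y) = \<sigma> x + \<sigma> y \<and> \<sigma> (x * y) = \<sigma> x * \<sigma> y)
                           \<and> (\<forall>x\<in>range to_ac. \<sigma> x = x)}"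
  "monoid.mult (galois_group M) = (\<lambda>g \<in> Bij M. \<lambda>f \<in> Bij M. compose M g f)"
  "\<one>\<^bsub>galois_group M\<^esub> = (\<lambda>x \<in> M. x)"
  by (simp_all add: galois_group_def BijGroup_def)

lemma galois_mult:
  assumes "\<sigma> \<in> carrier (galois_group M)" "\<tau> \<in> carrier (galois_group M)"
  shows "\<sigma> \<otimes>\<^bsub>galois_group M\<^esub> \<tau> = compose M \<sigma> \<tau>"
  using assms by (simp add: galois_group_simps)

lemma group_galois_group:
  assumes "type_subfield (M :: 'k::field alg_closure set)" "range to_ac \<subseteq> M"
  shows "group (galois_group M)"
proof -
  note M = type_subfieldD[OF assms(1)]
  let ?C = "carrier (galois_group M)"
  interpret B: group "BijGroup M" by (rule group_BijGroup)
  have "subgroup ?C (BijGroup M)"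
  proof (rule B.subgroupI)
    show "?C \<subseteq> carrier (BijGroup M)" by (auto simp: galois_group_simps BijGroup_def)
    have "(\<lambda>x\<in>M. x) \<in> ?C"
      using assms M by (auto simp: galois_group_simps id_Bij)
    then show "?C \<noteq> {}" by blast
    fix \<sigma> assume s: "\<sigma> \<in> ?C"
    then have sB: "\<sigma> \<in> Bij M" by (auto simp: galois_group_simps)
    have fs: "\<sigma> x \<in> M" if "x \<in> M" for x using Bij_imp_funcset[OF sB] that by auto
    have inj: "inj_on \<sigma> M" using sB by (auto simp: Bij_def bij_betw_def)
    have "inv\<^bsub>BijGroup M\<^esub> \<sigma> = (\<lambda>x\<in>M. inv_into M \<sigma> x)" by (rule inv_BijGroup[OF sB])
    moreover have "(\<lambda>x\<in>M. inv_into M \<sigma> x) \<in> ?C"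
    proof -
      have 1: "inv_into M \<sigma> (x + y) = inv_into M \<sigma> x + inv_into M \<sigma> y"
        "inv_into M \<sigma> (x * y) = inv_into M \<sigma> x * inv_into M \<sigma> y" if "x \<in> M" "y \<in> M" for x y
        using s that M by (auto intro!: Bij_inv_into_lemma[OF _ sB] simp: galois_group_simps)
      have 2: "inv_into M \<sigma> x = x" if "x \<in> range to_ac" for x
        using s that assms(2) inj by (auto simp: galois_group_simps intro!: inv_into_f_eq)
      have 3: "to_ac c \<in> M" for c using assms(2) by blast
      show ?thesis using 1 2 3 M sB
        by (auto simp: galois_group_simps restrict_inv_into_Bij)
    qed
    ultimately show "inv\<^bsub>BijGroup M\<^esub> \<sigma> \<in> ?C" by simp
    fix \<tau> assume t: "\<tau> \<in> ?C"
    then have tB: "\<tau> \<in> Bij M" by (auto simp: galois_group_simps)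
    have ft: "\<tau> x \<in> M" if "x \<in> M" for x using Bij_imp_funcset[OF tB] that by auto
    have "compose M \<sigma> \<tau> \<in> ?C"
    proof -
      have "to_ac c \<in> M" for c using assms(2) by blast
      then show ?thesis
        using s t sB tB ft M by (auto simp: galois_group_simps compose_Bij compose_eq)
    qed
    then show "\<sigma> \<otimes>\<^bsub>BijGroup M\<^esub> \<tau> \<in> ?C" using sB tB by (simp add: BijGroup_def)
  qed
  then have "group (BijGroup M\<lparr>carrier := ?C\<rparr>)" by (rule B.subgroup_imp_group)
  moreover have "BijGroup M\<lparr>carrier := ?C\<rparr> = galois_group M"
    by (simp add: galois_group_def)
  ultimately show ?thesis by simp
qed

locale galois_field =
  fixes M :: "'k::field alg_closure set"
  assumes subf: "type_subfield M" and base: "range to_ac \<subseteq> M"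
begin

abbreviation "G \<equiv> carrier (galois_group M)"

lemmas M_closed = type_subfieldD[OF subf]

lemma galoisD:
  assumes "\<sigma> \<in> G"
  shows "x \<in> M \<Longrightarrow> \<sigma> x \<in> M" "x \<in> M \<Longrightarrow> y \<in> M \<Longrightarrow> \<sigma> (x + y) = \<sigma> x + \<sigma> y"
    "x \<in> M \<Longrightarrow> y \<in> M \<Longrightarrow> \<sigma> (x * y) = \<sigma> x * \<sigma> y" "\<sigma> (to_ac c) = to_ac c"
    "inj_on \<sigma> M" "\<sigma> ` M = M" "\<sigma> 0 = 0" "\<sigma> 1 = 1"
    "x \<in> M \<Longrightarrow> \<sigma> x = 0 \<longleftrightarrow> x = 0"
proof -
  have B: "\<sigma> \<in> Bij M" using assms by (simp add: galois_group_simps)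
  show 1: "x \<in> M \<Longrightarrow> \<sigma> x \<in> M" using Bij_imp_funcset[OF B] by auto
  show "x \<in> M \<Longrightarrow> y \<in> M \<Longrightarrow> \<sigma> (x + y) = \<sigma> x + \<sigma> y"
    "x \<in> M \<Longrightarrow> y \<in> M \<Longrightarrow> \<sigma> (x * y) = \<sigma> x * \<sigma> y"
    and fixc: "\<sigma> (to_ac c) = to_ac c" for c
    using assms by (simp_all add: galois_group_simps)
  show inj: "inj_on \<sigma> M" "\<sigma> ` M = M" using B by (auto simp: Bij_def bij_betw_def)
  show z: "\<sigma> 0 = 0" "\<sigma> 1 = 1" using fixc[of 0] fixc[of 1] by simp_all
  show "x \<in> M \<Longrightarrow> \<sigma> x = 0 \<longleftrightarrow> x = 0" using inj_on_eq_iff[OF inj(1) _ M_closed(1)] z(1) by simp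
qed

lemma galois_diff:
  assumes "\<sigma> \<in> G" "x \<in> M" "y \<in> M"
  shows "\<sigma> (x - y) = \<sigma> x - \<sigma> y"
  using galoisD(2)[OF assms(1), of "x - y" y] assms M_closed(4) by (simp add: algebra_simps)

lemma galois_minus: "\<sigma> \<in> G \<Longrightarrow> x \<in> M \<Longrightarrow> \<sigma> (- x) = - \<sigma> x"
  using galois_diff[of \<sigma> 0 x] M_closed(1) galoisD(7) by simp

lemma galois_power: "\<sigma> \<in> G \<Longrightarrow> x \<in> M \<Longrightarrow> \<sigma> (x ^ n) = \<sigma> x ^ n"
  by (induction n) (auto simp: galoisD M_closed)

lemma galois_divide:
  assumes "\<sigma> \<in> G" "x \<in> M" "y \<in> M"
  shows "\<sigma> (x / y) = \<sigma> x / \<sigma> y"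
proof (cases "y = 0")
  case False
  then have "\<sigma> x = \<sigma> (x / y) * \<sigma> y"
    using galoisD(3)[OF assms(1), of "x / y" y] assms M_closed(6) by simp
  then show ?thesis using False galoisD(9)[OF assms(1,3)] by (simp add: field_simps)
qed (use galoisD(7)[OF assms(1)] in simp)

lemma galois_prod:
  assumes "\<sigma> \<in> G" "\<And>i. i \<in> I \<Longrightarrow> f i \<in> M"
  shows "\<sigma> (prod f I) = (\<Prod>i\<in>I. \<sigma> (f i)) \<and> prod f I \<in> M"
  using assms(2) by (induction I rule: infinite_finite_induct) (auto simp: galoisD[OF assms(1)] M_closed)

lemma ev_in_M: "x \<in> M \<Longrightarrow> ev p x \<in> M"
proof (induction p)
  case (pCons c p)
  then show ?case using base by (simp add: M_closed range_subsetD)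
qed (simp add: M_closed)

lemma galois_ev: "\<sigma> \<in> G \<Longrightarrow> x \<in> M \<Longrightarrow> \<sigma> (ev p x) = ev p (\<sigma> x)"
proof (induction p)
  case (pCons c p)
  then show ?case using base by (simp add: galoisD ev_in_M M_closed range_subsetD)
qed (simp add: galoisD)

lemma group_G: "group (galois_group M)"
  by (rule group_galois_group[OF subf base])

lemma galois_compose:
  assumes "\<sigma> \<in> G" "\<tau> \<in> G"
  shows "compose M \<sigma> \<tau> \<in> G"
proof -
  interpret G: group "galois_group M" by (rule group_G)
  show ?thesis using G.m_closed[OF assms] galois_mult[OF assms] by simp
qed

lemma bij_compose:
  assumes "\<sigma> \<in> G"
  shows "bij_betw (compose M \<sigma>) G G"
proof -
  interpret G: group "galois_group M" by (rule group_G)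
  have "bij_betw (\<lambda>\<tau>. \<sigma> \<otimes>\<^bsub>galois_group M\<^esub> \<tau>) G G"
    unfolding bij_betw_def using G.inj_on_cmult[OF assms] G.surj_const_mult[OF assms] by blast
  then show ?thesis using galois_mult[OF assms] by (subst bij_betw_cong[of _ _ "\<lambda>\<tau>. \<sigma> \<otimes>\<^bsub>galois_group M\<^esub> \<tau>"]) auto
qed

text \<open>Left composition with \<open>\<sigma>\<close> permutes the group, so a norm is
  invariant.\<close>

lemma galois_prod_orbit:
  assumes "\<sigma> \<in> G" "x \<in> M"
  shows "\<sigma> (\<Prod>\<tau>\<in>G. \<tau> x) = (\<Prod>\<tau>\<in>G. \<tau> x)"
proof -
  have "\<sigma> (\<Prod>\<tau>\<in>G. \<tau> x) = (\<Prod>\<tau>\<in>G. \<sigma> (\<tau> x))"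
    using galois_prod[OF assms(1), of G "\<lambda>\<tau>. \<tau> x"] galoisD(1)[OF _ assms(2)] by simp
  also have "\<dots> = (\<Prod>\<tau>\<in>G. compose M \<sigma> \<tau> x)"
    using assms by (simp add: compose_eq)
  also have "\<dots> = (\<Prod>\<tau>\<in>G. \<tau> x)"
    using prod.reindex_bij_betw[OF bij_compose[OF assms(1)], of "\<lambda>\<tau>. \<tau> x"] by simp
  finally show ?thesis .
qed

end

section \<open>Simple extensions and their Galois groups\<close>

lemma simple_extension_subfield:
  fixes \<theta> :: "'k::field alg_closure"
  shows "type_subfield (range (\<lambda>p. ev p \<theta>))"
proof -
  define M where "M = range (\<lambda>p. ev p \<theta>)"
  have M_I: "ev p \<theta> \<in> M" for p by (simp add: M_def)
  have to_ac_in: "to_ac c \<in> M" for c using M_I[of "[:c:]"] by simp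
  have ops: "x + y \<in> M" "x * y \<in> M" "- x \<in> M" if xy: "x \<in> M" "y \<in> M" for x y
  proof -
    obtain p r where pr: "x = ev p \<theta>" "y = ev r \<theta>" using xy unfolding M_def by blast
    show "x + y \<in> M" "x * y \<in> M" "- x \<in> M"
      using M_I[of "p + r"] M_I[of "p * r"] M_I[of "- p"] by (simp_all add: pr)
  qed
  have inv: "inverse x \<in> M" if x: "x \<in> M" for x
  proof (cases "x = 0")
    case False
    obtain p where p: "Factorial_Ring.irreducible p" "ev p x = 0" "\<And>r. ev r x = 0 \<longleftrightarrow> p dvd r"
      by (metis minimal_polynomial)
    obtain c s where ps: "p = pCons c s" by (cases p)
    \<comment> \<open>The constant coefficient \<open>c\<close> of the minimal polynomial is
      nonzero, so \<open>x * (- ev s x) = to_ac c\<close> exhibits the inverse as a polynomial in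
      \<open>x\<close>.\<close>
    have "c \<noteq> 0"
    proof
      assume "c = 0"
      then have "ev s x = 0" using p(2) ps False by simp
      then have "p dvd s" using p(3) by simp
      moreover have "s \<noteq> 0" using ps \<open>c = 0\<close> p(1) by auto
      ultimately have "Polynomial.degree p \<le> Polynomial.degree s" by (rule dvd_imp_degree_le)
      then show False using ps \<open>s \<noteq> 0\<close> by simp
    qed
    have evM: "ev s x \<in> M" for s
      by (induction s) (use to_ac_in[of 0] to_ac_in x ops in auto)
    have *: "x * (- ev s x) = to_ac c" using p(2) ps by (simp add: eq_neg_iff_add_eq_0 neg_eq_iff_add_eq_0 add.commute)
    have "x * (- ev s x * to_ac (inverse c)) = (x * (- ev s x)) * to_ac (inverse c)" by simp
    also have "\<dots> = 1" unfolding * using \<open>c \<noteq> 0\<close> by simp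
    finally have "x * (- ev s x * to_ac (inverse c)) = 1" .
    then have "inverse x = - ev s x * to_ac (inverse c)" by (rule inverse_unique)
    then show ?thesis using ops(2)[OF ops(3)[OF evM[of s] x] to_ac_in] by metis
  qed (use to_ac_in[of 0] in simp)
  show ?thesis unfolding M_def[symmetric] type_subfield_iff using ops inv to_ac_in[of 1] by auto
qed

text \<open>\<open>roots_in\<close> is normality and \<open>sqfree\<close> separability, both asked
  only of the generator. An automorphism is then named by the root to which it sends
  \<open>\<theta>\<close>, and the order of the group is the degree of \<open>P\<close>.\<close>

locale primitive_element =
  fixes \<theta> :: "'k::field alg_closure" and P :: "'k poly"
  assumes irr: "Factorial_Ring.irreducible P" and root: "ev P \<theta> = 0"
    and roots_in: "\<And>r. ev P r = 0 \<Longrightarrow> r \<in> range (\<lambda>p. ev p \<theta>)"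
    and sqfree: "rsquarefree (map_poly to_ac P)"
begin

definition "M = range (\<lambda>p. ev p \<theta>)"

lemma M_I [simp, intro]: "ev p \<theta> \<in> M" by (simp add: M_def)

lemma theta_in: "\<theta> \<in> M"
  using M_I[of "[:0, 1:]"] by simp

lemma to_ac_in: "to_ac c \<in> M"
  using M_I[of "[:c:]"] by simp

lemma M_subfield: "type_subfield M"
  unfolding M_def by (rule simple_extension_subfield)

sublocale galois_field M
  by (rule galois_field.intro) (use M_subfield to_ac_in in auto)

definition "Z = {r. ev P r = 0}"

lemma P_nz: "P \<noteq> 0" using irr by auto

lemma finite_Z: "finite Z"
  unfolding Z_def ev_def by (rule poly_roots_finite) (simp add: P_nz)

lemma card_Z: "card Z = Polynomial.degree P"
  using card_roots_rsquarefree[OF sqfree] by (simp add: Z_def ev_def)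

lemma ev_eq_at_root: "r \<in> Z \<Longrightarrow> ev p r = ev p' r \<longleftrightarrow> ev p \<theta> = ev p' \<theta>"
  using irreducible_dvd_iff_ev[OF irr, of r "p - p'"] irreducible_dvd_iff_ev[OF irr root, of "p - p'"]
  by (simp add: Z_def)

text \<open>The automorphism that sends \<open>\<theta>\<close> to \<open>r\<close>. All polynomials
  representing \<open>x\<close> give the same value by \<open>ev_eq_at_root\<close>; the restriction
  to \<open>M\<close> is what membership in \<open>Bij M\<close> requires.\<close>

definition "lift r = (\<lambda>x\<in>M. ev (SOME p. ev p \<theta> = x) r)"

lemma lift_ev: "r \<in> Z \<Longrightarrow> lift r (ev p \<theta>) = ev p r"
proof -
  assume r: "r \<in> Z"
  have "ev (SOME p'. ev p' \<theta> = ev p \<theta>) \<theta> = ev p \<theta>" by (rule someI[of _ p]) simp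
  then show ?thesis unfolding lift_def using ev_eq_at_root[OF r] by simp
qed

lemma lift_theta: "r \<in> Z \<Longrightarrow> lift r \<theta> = r"
  using lift_ev[of r "[:0, 1:]"] by simp

lemma lift_in_G:
  assumes r: "r \<in> Z"
  shows "lift r \<in> G"
proof -
  have Zsub: "Z \<subseteq> M" using roots_in by (auto simp: Z_def M_def)
  have into: "lift r x \<in> M" if xM: "x \<in> M" for x
  proof -
    obtain p where p: "x = ev p \<theta>" using xM unfolding M_def by blast
    obtain s where s: "r = ev s \<theta>" using r Zsub unfolding M_def by blast
    have "lift r x = ev (pcompose p s) \<theta>" using p s lift_ev[OF r] by (simp add: ev_pcompose)
    then show ?thesis by simp
  qed
  have inj: "inj_on (lift r) M"
    by (rule inj_onI) (auto simp: M_def lift_ev[OF r] ev_eq_at_root[OF r])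
  \<comment> \<open>Surjectivity comes from finiteness: an injective map of \<open>Z\<close> into
    itself is onto, so \<open>\<theta>\<close> is a value of \<open>lift r\<close>, and with it
    every polynomial in \<open>\<theta>\<close>.\<close>
  have "lift r ` Z \<subseteq> Z"
  proof
    fix y assume "y \<in> lift r ` Z"
    then obtain z where z: "z \<in> Z" "y = lift r z" by blast
    then obtain s where s: "z = ev s \<theta>" using Zsub by (auto simp: M_def)
    have "ev (pcompose P s) \<theta> = 0" using z s by (simp add: ev_pcompose Z_def)
    then have "ev (pcompose P s) r = 0" using ev_eq_at_root[OF r, of _ 0] by simp
    then show "y \<in> Z" using z s lift_ev[OF r] by (simp add: ev_pcompose Z_def)
  qed
  then have "lift r ` Z = Z"
    using finite_Z inj_on_subset[OF inj Zsub] by (simp add: endo_inj_surj)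
  moreover have "\<theta> \<in> Z" using root by (simp add: Z_def)
  ultimately obtain z where z: "z \<in> Z" "\<theta> = lift r z" by (metis imageE)
  obtain s where s: "z = ev s \<theta>" using z Zsub by (auto simp: M_def)
  have "M \<subseteq> lift r ` M"
  proof
    fix y assume "y \<in> M"
    then obtain p where p: "y = ev p \<theta>" by (auto simp: M_def)
    have "ev s r = \<theta>" using z(2) s lift_ev[OF r] by simp
    then have "lift r (ev (pcompose p s) \<theta>) = y" unfolding lift_ev[OF r] by (simp add: ev_pcompose p)
    then show "y \<in> lift r ` M" using imageI[OF M_I, of "lift r" "pcompose p s"] by simp
  qed
  then have "bij_betw (lift r) M M" using inj into by (auto simp: bij_betw_def)
  then have B: "lift r \<in> Bij M" by (simp add: Bij_def lift_def)
  have "lift r (x + y) = lift r x + lift r y \<and> lift r (x * y) = lift r x * lift r y" if "x \<in> M" "y \<in> M" for x y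
  proof -
    obtain p p' where "x = ev p \<theta>" "y = ev p' \<theta>" using \<open>x \<in> M\<close> \<open>y \<in> M\<close> by (auto simp: M_def)
    then show ?thesis using lift_ev[OF r, of "p + p'"] lift_ev[OF r, of "p * p'"] lift_ev[OF r] by simp
  qed
  moreover have "lift r (to_ac c) = to_ac c" for c using lift_ev[OF r, of "[:c:]"] by simp
  ultimately show ?thesis using B by (auto simp: galois_group_simps)
qed

lemma galois_theta:
  assumes "\<sigma> \<in> G"
  shows "\<sigma> \<theta> \<in> Z"
  using galois_ev[OF assms theta_in, of P] root galoisD(7)[OF assms] by (simp add: Z_def)

lemma galois_eqI:
  assumes "\<sigma> \<in> G" "\<tau> \<in> G" "\<sigma> \<theta> = \<tau> \<theta>"
  shows "\<sigma> = \<tau>"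
proof (rule extensionalityI)
  show "\<sigma> \<in> extensional M" "\<tau> \<in> extensional M" using assms by (auto simp: galois_group_simps Bij_def)
  show "\<sigma> x = \<tau> x" if "x \<in> M" for x
    using that galois_ev[OF assms(1) theta_in] galois_ev[OF assms(2) theta_in] assms(3) by (auto simp: M_def)
qed

lemma bij_G_Z: "bij_betw (\<lambda>\<sigma>. \<sigma> \<theta>) G Z"
  unfolding bij_betw_def
proof
  show "inj_on (\<lambda>\<sigma>. \<sigma> \<theta>) G" by (rule inj_onI) (rule galois_eqI)
  show "(\<lambda>\<sigma>. \<sigma> \<theta>) ` G = Z"
  proof
    show "(\<lambda>\<sigma>. \<sigma> \<theta>) ` G \<subseteq> Z" using galois_theta by blast
    show "Z \<subseteq> (\<lambda>\<sigma>. \<sigma> \<theta>) ` G"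
    proof
      fix r assume "r \<in> Z"
      then show "r \<in> (\<lambda>\<sigma>. \<sigma> \<theta>) ` G"
        using imageI[OF lift_in_G, of r "\<lambda>\<sigma>. \<sigma> \<theta>"] by (simp add: lift_theta)
    qed
  qed
qed

lemma finite_G: "finite G"
  using bij_betw_finite[OF bij_G_Z] finite_Z by simp

lemma card_G: "card G = Polynomial.degree P"
  using bij_betw_same_card[OF bij_G_Z] card_Z by simp

text \<open>If \<open>x = ev p \<theta>\<close> is fixed, the remainder \<open>p mod P\<close> takes
  the value \<open>x\<close> at all \<open>degree P\<close> roots in \<open>Z\<close>. Its degree is
  smaller, so it is constant.\<close>

lemma fixed_in_base:
  assumes x: "x \<in> M" and fixed: "\<And>\<sigma>. \<sigma> \<in> G \<Longrightarrow> \<sigma> x = x"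
  shows "x \<in> range to_ac"
proof -
  obtain p where p: "x = ev p \<theta>" using x by (auto simp: M_def)
  define s where "s = map_poly to_ac (p mod P) - [:x:]"
  have deg: "Polynomial.degree P > 0"
    using irr P_nz by (metis Factorial_Ring.irreducible_not_unit is_unit_iff_degree neq0_conv)
  have "ev (p mod P) r = x" if r: "r \<in> Z" for r
  proof -
    have "x = lift r x" using fixed[OF lift_in_G[OF r]] by simp
    also have "\<dots> = ev p r" using lift_ev[OF r] p by simp
    also have "\<dots> = ev (p mod P + p div P * P) r" by simp
    also have "\<dots> = ev (p mod P) r" using r by (simp only: ev_simps) (simp add: Z_def)
    finally show ?thesis by simp
  qed
  then have "Z \<subseteq> {r. poly s r = 0}" by (auto simp: s_def ev_def)
  moreover have "Polynomial.degree s < Polynomial.degree P"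
    unfolding s_def using deg degree_mod_less[OF P_nz, of p]
    by (intro degree_diff_less) auto
  ultimately have "s = 0"
    using card_Z card_poly_roots_bound[of s] card_mono[of "{r. poly s r = 0}" Z] poly_roots_finite[of s]
    by fastforce
  then have "Polynomial.coeff (map_poly to_ac (p mod P)) 0 = x" by (simp add: s_def)
  then have "x = to_ac (Polynomial.coeff (p mod P) 0)" by (simp add: coeff_map_poly)
  then show ?thesis by simp
qed

section \<open>Orbits and the Galois property\<close>

definition "conjs x = (\<lambda>\<sigma>. \<sigma> x) ` G"

lemma finite_conjs: "finite (conjs x)"
  by (simp add: conjs_def finite_G)

lemma self_in_conjs:
  assumes "x \<in> M"
  shows "x \<in> conjs x"
proof -
  interpret G: group "galois_group M" by (rule group_G)
  have "(\<lambda>x\<in>M. x) \<in> G" using G.one_closed by (simp add: galois_group_simps(3))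
  from imageI[OF this, of "\<lambda>\<sigma>. \<sigma> x"] show ?thesis using assms by (simp add: conjs_def)
qed

lemma conjs_subset: "x \<in> M \<Longrightarrow> conjs x \<subseteq> M"
  by (auto simp: conjs_def galoisD)

lemma galois_conjs:
  assumes s: "\<sigma> \<in> G" and x: "x \<in> M"
  shows "bij_betw \<sigma> (conjs x) (conjs x)"
proof -
  have "\<sigma> ` conjs x \<subseteq> conjs x"
  proof
    fix y assume "y \<in> \<sigma> ` conjs x"
    then obtain \<tau> where "\<tau> \<in> G" "y = \<sigma> (\<tau> x)" by (auto simp: conjs_def)
    then have "y = compose M \<sigma> \<tau> x" "compose M \<sigma> \<tau> \<in> G"
      using x galois_compose[OF s] by (auto simp: compose_eq)
    then show "y \<in> conjs x" by (auto simp: conjs_def)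
  qed
  moreover have "inj_on \<sigma> (conjs x)"
    using galoisD(5)[OF s] conjs_subset[OF x] by (rule inj_on_subset)
  ultimately show ?thesis unfolding bij_betw_def using finite_conjs endo_inj_surj by blast
qed

lemma galois_coeff_prod:
  assumes s: "\<sigma> \<in> G" and "finite A" "A \<subseteq> M"
  shows "Polynomial.coeff (\<Prod>y\<in>A. [:- y, 1:]) i \<in> M \<and>
    \<sigma> (Polynomial.coeff (\<Prod>y\<in>A. [:- y, 1:]) i) = Polynomial.coeff (\<Prod>y\<in>A. [:- \<sigma> y, 1:]) i"
  using assms(2,3)
proof (induction A arbitrary: i rule: finite_induct)
  case empty
  then show ?case by (cases i) (auto simp: galoisD[OF s] M_closed)
next
  case (insert y A)
  then have IH: "Polynomial.coeff (\<Prod>y\<in>A. [:- y, 1:]) j \<in> M"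
    "\<sigma> (Polynomial.coeff (\<Prod>y\<in>A. [:- y, 1:]) j) = Polynomial.coeff (\<Prod>y\<in>A. [:- \<sigma> y, 1:]) j" for j
    by auto
  have y: "y \<in> M" using insert by simp
  show ?case using insert.hyps y
    by (cases i) (simp_all add: IH M_closed galoisD[OF s] galois_minus[OF s] galois_diff[OF s])
qed

text \<open>The Galois group permutes the orbit, hence fixes the coefficients of this
  product.\<close>

lemma conjs_poly:
  assumes x: "x \<in> M"
  obtains p where "map_poly to_ac p = (\<Prod>y\<in>conjs x. [:- y, 1:])"
proof -
  let ?R = "\<Prod>y\<in>conjs x. [:- y, 1:]"
  have "Polynomial.coeff ?R i \<in> range to_ac" for i
  proof (rule fixed_in_base)
    have one: "(\<lambda>x\<in>M. x) \<in> G"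
      using monoid.one_closed[OF group.is_monoid[OF group_G]] by (simp add: galois_group_simps(3))
    show "Polynomial.coeff ?R i \<in> M"
      using galois_coeff_prod[OF one finite_conjs conjs_subset[OF x]] by blast
    fix \<sigma> assume s: "\<sigma> \<in> G"
    have "(\<Prod>y\<in>conjs x. [:- \<sigma> y, 1:]) = ?R"
      using prod.reindex_bij_betw[OF galois_conjs[OF s x], of "\<lambda>y. [:- y, 1:]"] by simp
    then show "\<sigma> (Polynomial.coeff ?R i) = Polynomial.coeff ?R i"
      using galois_coeff_prod[OF s finite_conjs conjs_subset[OF x], of i] by simp
  qed
  then have "map_poly to_ac (map_poly of_ac ?R) = ?R"
    by (intro poly_eqI) (simp add: coeff_map_poly to_ac_of_ac)
  then show thesis by (rule that)
qed

text \<open>The minimal polynomial of an element of \<open>M\<close> divides the orbit polynomial of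
  that element, which splits over \<open>M\<close> into distinct linear factors; normality and
  separability follow together.\<close>

theorem galois_extension_M: "galois_extension M"
  unfolding galois_extension_def normal_extension_def separable_extension_def
proof (intro conjI allI impI ballI)
  show "type_subfield M" "range to_ac \<subseteq> M" by (rule subf, rule base)
next
  fix p :: "'k poly" and x
  assume "Factorial_Ring.irreducible p \<and> (\<exists>x\<in>M. root_in_closure p x)" and rx: "root_in_closure p x"
  then obtain y where y: "Factorial_Ring.irreducible p" "y \<in> M" "ev p y = 0"
    by (auto simp: root_in_closure_def ev_def)
  obtain p0 where p0: "map_poly to_ac p0 = (\<Prod>z\<in>conjs y. [:- z, 1:])" using conjs_poly[OF y(2)] .
  have ev0: "ev p0 z = (\<Prod>w\<in>conjs y. z - w)" for z
    using p0 by (simp add: ev_def poly_prod)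
  then have "ev p0 y = 0" using self_in_conjs[OF y(2)] finite_conjs by auto
  then have "p dvd p0" using irreducible_dvd_iff_ev[OF y(1,3)] by simp
  then have "ev p0 x = 0" using rx by (auto simp: root_in_closure_def ev_def elim!: dvdE)
  then show "x \<in> M" using ev0 finite_conjs conjs_subset[OF y(2)] by auto
next
  fix y assume y: "y \<in> M"
  obtain p where p: "Factorial_Ring.irreducible p" "ev p y = 0" "\<And>r. ev r y = 0 \<longleftrightarrow> p dvd r"
    by (metis minimal_polynomial)
  obtain p0 where p0: "map_poly to_ac p0 = (\<Prod>z\<in>conjs y. [:- z, 1:])" using conjs_poly[OF y] .
  have "ev p0 y = 0"
    using p0 self_in_conjs[OF y] finite_conjs by (auto simp: ev_def poly_prod)
  then have "p dvd p0" using p(3) by simp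
  then have "map_poly to_ac p dvd map_poly to_ac p0" by (auto elim!: dvdE)
  then have "rsquarefree (map_poly to_ac p)"
    unfolding p0 by (rule rsquarefree_dvd) (rule rsquarefree_prod_linear[OF finite_conjs])
  then show "\<exists>p :: 'k poly. Factorial_Ring.irreducible p \<and> root_in_closure p y \<and> rsquarefree (map_poly to_ac p)"
    using p by (auto simp: root_in_closure_def ev_def)
qed

end

section \<open>The three equations\<close>

text \<open>Beyond \<open>q_ge\<close> only additivity of the \<open>q\<close>-power map is assumed,
  so the same rules serve the closure of the function field and the field of constants.\<close>

locale projected_hermitian =
  fixes q :: nat and m a b :: "'a::field"
  assumes q_ge: "q \<ge> 2"
    and frob_add: "\<And>x y :: 'a. (x + y) ^ q = x ^ q + y ^ q"
begin

lemma frob_diff: "(x - y :: 'a) ^ q = x ^ q - y ^ q"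
  using frob_add[of "x - y" y] by (simp add: algebra_simps)

lemma frob_minus: "(- x :: 'a) ^ q = - (x ^ q)"
  using frob_diff[of 0 x] q_ge by simp

lemma pow_q: "x ^ q = x * (x :: 'a) ^ (q - 1)"
  using q_ge by (metis Suc_diff_1 less_le_trans pos2 power_Suc)

definition "E = m - m ^ (q * q)"
definition "D = m ^ (q + 1) + (m * a - b) ^ q + m * a - b"
definition "R w = w ^ q - (w :: 'a)"
definition "N w = R w ^ (q - 1) + 1"
definition "is_root u \<longleftrightarrow> u ^ (q + 1) + u ^ q * m ^ q + u * m - ((m * a - b) ^ q + m * a - b) = 0"
definition "triple u v w \<longleftrightarrow> is_root u \<and> v ^ q + (u + m ^ q) * v ^ (q - 1) + u ^ q + m = 0 \<and>
     v + u + m ^ q - (u + m ^ q) * w ^ (q - 1) = 0"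
text \<open>Where the denominators do not vanish, this says
  \<open>N w^(q+1) / R w^(q*q-q) = - E^(q+1) / D^q\<close>. The left-hand side equals
  \<open>(w^(q*q) - w)^(q+1) / (w^q - w)^(q*q+1)\<close>, the classical rational function invariant
  under the projective linear group over the field with \<open>q\<close> elements.\<close>

definition "Phi w \<longleftrightarrow> D ^ q * N w ^ (q + 1) + E ^ (q + 1) * R w ^ (q * q - q) = 0"
text \<open>Eliminating \<open>v\<close> and \<open>u\<close>, a solution is determined by \<open>w\<close>: it is a root of \<open>Phi\<close>, and
  \<open>u + m\<^sup>q\<close>, \<open>u\<close> and \<open>v\<close> are \<open>Yw w\<close>, \<open>uw w\<close> and \<open>vw w\<close>.\<close>

definition "Yw w = D * N w / (E * R w ^ (q - 1))"
definition "uw w = Yw w - m ^ q"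
definition "vw w = Yw w * (w ^ (q - 1) - 1)"

text \<open>So \<open>R\<close> vanishes at the elements of the field with \<open>q\<close> elements
  and \<open>N\<close> at the remaining elements of the field with \<open>q^2\<close>
  elements.\<close>

lemma N_mult_R: "N w * R w = w ^ (q * q) - w"
proof -
  have "N w * R w = R w ^ q + R w" by (simp add: N_def pow_q algebra_simps)
  also have "R w ^ q = w ^ (q * q) - w ^ q" by (simp add: R_def frob_diff power_mult)
  finally show ?thesis by (simp add: R_def)
qed

text \<open>\<open>D\<close> vanishes exactly at the slopes \<open>m\<close> of tangents from \<open>(a, b)\<close>, \<open>E\<close> at the slopes
  in the field with \<open>q\<^sup>2\<close> elements.\<close>

lemma is_root_iff: "is_root u \<longleftrightarrow> (u + m ^ q) * ((u + m ^ q) ^ q + E) = D"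
proof -
  have "(u + m ^ q) * ((u + m ^ q) ^ q + E) - D
     = u ^ (q + 1) + u ^ q * m ^ q + u * m - ((m * a - b) ^ q + m * a - b)"
    by (simp add: frob_add E_def D_def power_mult algebra_simps)
  then show ?thesis by (auto simp: is_root_def)
qed

lemma is_root_iff': "is_root u \<longleftrightarrow> (u + m ^ q) * (u ^ q + m) = D"
  unfolding is_root_iff by (simp add: frob_add E_def power_mult)

end

section \<open>Elimination of \<open>u\<close> and \<open>v\<close> when \<open>D\<close> and
  \<open>E\<close> are nonzero\<close>

locale smooth_projected_hermitian = projected_hermitian +
  assumes D_nz: "D \<noteq> 0" and E_nz: "E \<noteq> 0"
begin

lemma root_facts:
  assumes "is_root u"
  shows "u + m ^ q \<noteq> 0" "u ^ q + m \<noteq> 0" "(u + m ^ q) ^ q = D / (u + m ^ q) - E"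
proof -
  show 1: "u + m ^ q \<noteq> 0" "u ^ q + m \<noteq> 0"
    using assms D_nz unfolding is_root_iff' by auto
  then show "(u + m ^ q) ^ q = D / (u + m ^ q) - E"
    using assms unfolding is_root_iff by (simp add: field_simps)
qed

lemma triple_facts:
  assumes "triple u v w"
  shows "v = (u + m ^ q) * (w ^ (q - 1) - 1)" "(u + m ^ q) ^ q * N w = - E"
    "R w \<noteq> 0" "N w \<noteq> 0" "w \<noteq> 0" "v \<noteq> 0" "u + m ^ q = Yw w" "Phi w" "u = uw w" "v = vw w"
proof -
  define Y where "Y = u + m ^ q"
  have u: "is_root u" and e2: "v ^ q + Y * v ^ (q - 1) + u ^ q + m = 0"
    and e3: "v + Y - Y * w ^ (q - 1) = 0"
    using assms by (auto simp: triple_def Y_def algebra_simps)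
  have Y0: "Y \<noteq> 0" using root_facts[OF u] by (simp add: Y_def)
  show v: "v = (u + m ^ q) * (w ^ (q - 1) - 1)"
    using e3 by (simp add: Y_def algebra_simps add_eq_0_iff)
  have uq: "u ^ q + m = Y ^ q + E"
    by (simp add: Y_def frob_add E_def power_mult)
  have v': "v + Y = Y * w ^ (q - 1)" using e3 by (simp add: algebra_simps)
  have vne: "v \<noteq> 0"
  proof
    assume "v = 0"
    then have "u ^ q + m = 0" using e2 q_ge by (simp add: power_0_left split: if_splits)
    then show False using root_facts[OF u] by simp
  qed
  then show "v \<noteq> 0" .
  have wne: "w \<noteq> 0"
  proof
    assume "w = 0"
    then have "v + Y = 0" using v' q_ge by (simp add: power_0_left split: if_splits)
    then have "v ^ q + Y * v ^ (q - 1) = 0" by (metis distrib_right mult_zero_left pow_q)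
    then show False using e2 root_facts[OF u] by (simp add: add.assoc)
  qed
  then show "w \<noteq> 0" .
  have vY: "v = Y * (w ^ (q - 1) - 1)" using v by (simp only: Y_def)
  have vwR: "v * w = Y * R w"
    unfolding vY R_def by (simp add: pow_q[of w] algebra_simps)
  then show R0: "R w \<noteq> 0" using vne wne Y0 by auto
  have "v ^ (q - 1) * (v + Y) = v ^ q + Y * v ^ (q - 1)" by (simp add: pow_q[of v] algebra_simps)
  also have "\<dots> = - (u ^ q + m)" by (rule eq_neg_iff_add_eq_0[THEN iffD2]) (use e2 in \<open>simp add: add.assoc\<close>)
  finally have "v ^ (q - 1) * (v + Y) = - (Y ^ q + E)" unfolding uq .
  \<comment> \<open>Replacing \<open>v + Y\<close> by \<open>Y w^(q-1)\<close> completes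
    \<open>v^(q-1)\<close> to a power of \<open>v * w\<close>, which is \<open>Y * R w\<close>: the
    second equation then involves \<open>v\<close> and \<open>w\<close> through \<open>R w\<close>
    alone.\<close>
  then have "(v * w) ^ (q - 1) * Y = - (Y ^ q + E)"
    unfolding v' by (simp add: power_mult_distrib mult_ac)
  then have "Y ^ q * R w ^ (q - 1) = - (Y ^ q + E)"
    unfolding vwR by (simp add: power_mult_distrib pow_q[of Y] mult_ac)
  note YR = this
  have "Y ^ q * N w = Y ^ q * R w ^ (q - 1) + Y ^ q" by (simp add: N_def distrib_left)
  also have "\<dots> = - E" unfolding YR by simp
  finally show YN: "(u + m ^ q) ^ q * N w = - E" by (simp only: Y_def)
  then show N0: "N w \<noteq> 0" using E_nz by auto
  have YE: "Y ^ q + E = - (Y ^ q * R w ^ (q - 1))"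
    using \<open>Y ^ q * R w ^ (q - 1) = - (Y ^ q + E)\<close> by simp
  have YD: "Y * (Y ^ q + E) = D" using u by (simp add: is_root_iff Y_def)
  have "Y * (E * R w ^ (q - 1)) = Y * (- (Y ^ q * N w) * R w ^ (q - 1))"
    using YN by (simp add: Y_def)
  also have "\<dots> = (Y * (- (Y ^ q * R w ^ (q - 1)))) * N w" by (simp add: algebra_simps)
  also have "\<dots> = D * N w" unfolding YE[symmetric] YD ..
  finally have "Y = D * N w / (E * R w ^ (q - 1))"
    using E_nz R0 by (simp add: field_simps)
  then show YY: "u + m ^ q = Yw w" by (simp add: Y_def Yw_def)
  then show "u = uw w" by (simp add: uw_def eq_diff_eq)
  show "v = vw w" using v by (simp add: vw_def YY)
  have "(D * N w) ^ q = (Y * (E * R w ^ (q - 1))) ^ q"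
    using \<open>Y = D * N w / (E * R w ^ (q - 1))\<close> E_nz R0 by simp
  then have "(D * N w) ^ q * N w = (Y ^ q * N w) * E ^ q * R w ^ ((q - 1) * q)"
    by (simp add: power_mult_distrib power_mult)
  also have "Y ^ q * N w = - E" using YN by (simp add: Y_def)
  also have "(q - 1) * q = q * q - q" by (simp add: diff_mult_distrib)
  finally show "Phi w" by (simp add: Phi_def power_mult_distrib algebra_simps)
qed

lemma Phi_nz:
  assumes "Phi w"
  shows "R w \<noteq> 0" "N w \<noteq> 0"
proof -
  have qq: "q * q - q > 0" using q_ge by (simp add: diff_mult_distrib[symmetric] mult.commute)
  show 1: "R w \<noteq> 0"
  proof
    assume "R w = 0"
    then show False using assms D_nz q_ge qq by (simp add: Phi_def N_def power_0_left)
  qed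
  show "N w \<noteq> 0" using assms 1 E_nz by (auto simp: Phi_def)
qed

text \<open>Cleared of denominators, \<open>Phi w\<close> says \<open>Yw w ^ q * N w = - E\<close>;
  from there the computation in \<open>triple_facts\<close> runs backwards.\<close>

lemma Phi_triple:
  assumes P: "Phi w"
  shows "triple (uw w) (vw w) w" "Yw w \<noteq> 0"
proof -
  define Y where "Y = Yw w"
  note R0 = Phi_nz[OF P]
  show Y0: "Yw w \<noteq> 0" using R0 D_nz E_nz by (simp add: Yw_def)
  have Y: "Y * E * R w ^ (q - 1) = D * N w" using R0 E_nz by (simp add: Y_def Yw_def)
  have "Y ^ q * E ^ q * R w ^ (q * q - q) = D ^ q * N w ^ q"
    using arg_cong[OF Y, of "\<lambda>x. x ^ q"] by (simp add: power_mult_distrib power_mult[symmetric] diff_mult_distrib)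
  note YE = this
  have "(Y ^ q * N w + E) * (E ^ q * R w ^ (q * q - q))
    = (Y ^ q * E ^ q * R w ^ (q * q - q)) * N w + E ^ (q + 1) * R w ^ (q * q - q)"
    by (simp add: algebra_simps)
  also have "\<dots> = 0" using P unfolding YE by (simp add: Phi_def mult_ac)
  finally have "(Y ^ q * N w + E) * (E ^ q * R w ^ (q * q - q)) = 0" .
  then have YN: "Y ^ q * N w = - E" using R0 E_nz by (simp add: add_eq_0_iff)
  then have "Y ^ q + E = Y ^ q - Y ^ q * N w" by simp
  also have "\<dots> = - (Y ^ q * R w ^ (q - 1))" by (simp add: N_def algebra_simps)
  finally have YE: "Y ^ q + E = - (Y ^ q * R w ^ (q - 1))" .
  have "Y * (Y ^ q + E) = D"
  proof -
    have "Y * (Y ^ q + E) * N w = - (Y * (Y ^ q * N w) * R w ^ (q - 1))" unfolding YE by (simp add: mult_ac)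
    also have "\<dots> = D * N w" unfolding YN using Y by (simp add: mult_ac)
    finally show ?thesis using R0 by simp
  qed
  then have root: "is_root (uw w)" by (simp add: is_root_iff uw_def Y_def)
  have vw: "vw w * w = Y * R w" by (simp add: vw_def Y_def[symmetric] R_def pow_q algebra_simps)
  have "vw w ^ q + Y * vw w ^ (q - 1) = vw w ^ (q - 1) * (vw w + Y)"
    by (simp add: pow_q algebra_simps)
  also have "vw w + Y = Y * w ^ (q - 1)" by (simp add: vw_def Y_def algebra_simps)
  also have "vw w ^ (q - 1) * (Y * w ^ (q - 1)) = Y * (vw w * w) ^ (q - 1)"
    by (simp add: power_mult_distrib mult_ac)
  also have "\<dots> = - (Y ^ q + E)" unfolding vw YE by (simp add: power_mult_distrib pow_q mult_ac)
  also have "Y ^ q + E = uw w ^ q + m"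
    by (simp add: uw_def Y_def frob_diff E_def power_mult)
  finally have "vw w ^ q + Y * vw w ^ (q - 1) + uw w ^ q + m = 0" by (simp add: algebra_simps)
  then show "triple (uw w) (vw w) w"
    using root by (simp add: triple_def uw_def Y_def vw_def algebra_simps)
qed

lemma triple_iff: "triple u v w \<longleftrightarrow> Phi w \<and> u = uw w \<and> v = vw w"
  using triple_facts(8,9,10)[of u v w] Phi_triple(1)[of w] by blast

text \<open>The second and third equation describe the remaining roots \<open>u + v w / (w + l)\<close> with
  \<open>l\<^sup>q = l\<close>; the root for \<open>l = 0\<close> is \<open>u + v\<close>.\<close>

lemma other_root:
  assumes "triple u v w" "l ^ q = l"
  shows "is_root (u + v * w / (w + l))"
proof -
  define Y T where "Y = u + m ^ q" and "T = v * w / (w + l)"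
  note f = triple_facts[OF assms(1)]
  have u: "is_root u" using assms(1) by (simp add: triple_def)
  have wl: "w + l \<noteq> 0"
  proof
    assume "w + l = 0"
    then have "w = - l" by (simp add: eq_neg_iff_add_eq_0)
    then have "R w = 0" using assms(2) by (simp add: R_def frob_minus)
    then show False using f by simp
  qed
  have vY: "v = Y * (w ^ (q - 1) - 1)" using f(1) by (simp only: Y_def)
  have vw: "v * w = Y * R w" unfolding vY R_def by (simp add: pow_q[of w] algebra_simps)
  have T: "T * (w + l) = Y * R w" using wl vw by (simp add: T_def)
  have TY: "(T + Y) * (w + l) = Y * (w + l) ^ q"
    using T assms(2) by (simp add: R_def frob_add algebra_simps)
  have "T ^ (q - 1) * (T + Y) * (w + l) ^ q = (T * (w + l)) ^ (q - 1) * ((T + Y) * (w + l))"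
    by (simp add: power_mult_distrib pow_q mult_ac)
  also have "\<dots> = (Y * R w) ^ (q - 1) * (Y * (w + l) ^ q)" unfolding T TY ..
  also have "\<dots> = Y ^ q * R w ^ (q - 1) * (w + l) ^ q" by (simp add: power_mult_distrib pow_q mult_ac)
  finally have "T ^ (q - 1) * (T + Y) = Y ^ q * R w ^ (q - 1)" using wl by simp
  also have "\<dots> = Y ^ q * N w - Y ^ q" by (simp add: N_def algebra_simps)
  also have "Y ^ q * N w = - E" using f(2) by (simp add: Y_def)
  finally have *: "T ^ (q - 1) * (T + Y) = - E - Y ^ q" .
  have "(T + Y) * ((T + Y) ^ q + E) = (T + Y) * (T ^ q + (Y ^ q + E))" by (simp add: frob_add add.assoc)
  also have "\<dots> = T * (T ^ (q - 1) * (T + Y)) + (T + Y) * (Y ^ q + E)"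
    by (simp add: pow_q[of T] algebra_simps)
  also have "\<dots> = Y * (Y ^ q + E)" unfolding * by (simp add: algebra_simps)
  also have "\<dots> = D" using u by (simp add: is_root_iff Y_def)
  finally show ?thesis by (simp add: is_root_iff T_def Y_def algebra_simps)
qed

section \<open>Moebius transformations of the roots of \<open>Phi\<close>\<close>

definition "mob c11 c12 c21 c22 w = (c12 + w * c22) / (c11 + w * c21 :: 'a)"

lemma R_nz_not_linear:
  assumes "R w \<noteq> 0" "x ^ q = x" "y ^ q = y" "(x, y) \<noteq> (0, 0)"
  shows "x + w * y \<noteq> 0"
proof
  assume *: "x + w * y = 0"
  then have y: "y \<noteq> 0" using assms(4) by auto
  then have "w = - x / y" using * by (simp add: field_simps eq_neg_iff_add_eq_0)
  then have "w ^ q = w" using assms by (simp add: power_divide frob_minus)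
  then show False using assms(1) by (simp add: R_def)
qed

text \<open>Any two solutions differ by a projectivity over the fixed field of the \<open>q\<close>-power map:
  with \<open>B = ((u, (u+v) w), (1, w))\<close>, both \<open>B\<close> and \<open>B'\<close> satisfy \<open>A B = Y B\<^sup>(\<^sup>q\<^sup>)\<close> for one matrix
  \<open>A\<close>, so the entries of \<open>adj(B) B'\<close>, which are \<open>c11, ..., c22\<close> below, satisfy
  \<open>c\<^sup>q = \<rho> c\<close> with a common factor \<open>\<rho>\<close>.\<close>

lemma Phi_roots_conjugate:
  assumes "Phi w" "Phi w'"
  shows "\<exists>c11 c12 c21 c22. c11 ^ q = c11 \<and> c12 ^ q = c12 \<and> c21 ^ q = c21 \<and> c22 ^ q = c22 \<and>
     c11 * c22 - c12 * c21 \<noteq> 0 \<and> w' = mob c11 c12 c21 c22 w"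
proof -
  define Y Y' where "Y = Yw w" and "Y' = Yw w'"
  note Y0 = Phi_triple(2)[OF assms(1)] Phi_triple(2)[OF assms(2)]
  have nz: "Y \<noteq> 0" "Y' \<noteq> 0" using Y0 by (auto simp: Y_def Y'_def)
  \<comment> \<open>In vector form the \<open>q\<close>-th power of \<open>(Y, Y x^q)\<close> is
    \<open>D / Y (1, x) - E (1, x^q)\<close>: apart from the scalar \<open>Y\<close>, the same
    semilinear system holds at \<open>w\<close> and at \<open>w'\<close>.\<close>
  have Yq: "Yw x ^ q = D / Yw x - E" "(Yw x * x ^ q) ^ q = D * x / Yw x - E * x ^ q" if "Phi x" for x
  proof -
    have t: "triple (uw x) (vw x) x" using Phi_triple that by blast
    then have "is_root (uw x)" by (simp add: triple_def)
    from root_facts(3)[OF this] show 1: "Yw x ^ q = D / Yw x - E" by (simp add: uw_def)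
    have "Yw x ^ q * N x = - E" using triple_facts(2)[OF t] by (simp add: uw_def)
    then have "Yw x ^ q * (x ^ (q * q) - x) = - E * R x" unfolding N_mult_R[symmetric]
      by (simp add: mult.assoc[symmetric])
    then have "Yw x ^ q * x ^ (q * q) = (Yw x ^ q + E) * x - E * x ^ q"
      by (simp add: R_def algebra_simps)
    then show "(Yw x * x ^ q) ^ q = D * x / Yw x - E * x ^ q"
      by (simp add: power_mult_distrib power_mult[symmetric] 1)
  qed
  note Yq1 = Yq[OF assms(1), folded Y_def] and Yq2 = Yq[OF assms(2), folded Y'_def]
  define \<rho> where "\<rho> = - D / (Y * Y')"
  define c11 where "c11 = w * Y' - Y * w ^ q"
  define c12 where "c12 = w * (Y' * w' ^ q) - w' * (Y * w ^ q)"
  define c21 where "c21 = Y - Y'"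
  define c22 where "c22 = w' * Y - Y' * w' ^ q"
  have q: "c11 ^ q = \<rho> * c11" "c12 ^ q = \<rho> * c12" "c21 ^ q = \<rho> * c21" "c22 ^ q = \<rho> * c22"
    unfolding c11_def c12_def c21_def c22_def frob_diff power_mult_distrib[of w] power_mult_distrib[of w']
      Yq1 Yq2 \<rho>_def
    using nz by (simp_all add: field_simps)
  have det: "c11 * c22 - c12 * c21 = - (Y * R w) * (- (Y' * R w'))"
    unfolding c11_def c12_def c21_def c22_def R_def by (simp add: algebra_simps)
  have det0: "c11 * c22 - c12 * c21 \<noteq> 0"
    unfolding det using nz Phi_nz[OF assms(1)] Phi_nz[OF assms(2)] by simp
  \<comment> \<open>One of the four entries serves as \<open>c\<close>: they cannot all vanish, and
    dividing by it cancels the common factor \<open>\<rho>\<close>.\<close>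
  then have "\<exists>c. c \<noteq> 0 \<and> c ^ q = \<rho> * c" using q by (metis diff_self mult_zero_left mult_zero_right)
  then obtain c where c: "c \<noteq> 0" "c ^ q = \<rho> * c" by blast
  have \<rho>0: "\<rho> \<noteq> 0" using D_nz nz by (simp add: \<rho>_def)
  have fixd: "(x / c) ^ q = x / c" if "x ^ q = \<rho> * x" for x
    using that c \<rho>0 by (simp add: power_divide)
  have l1: "c11 + w * c21 = - (Y * R w)" unfolding c11_def c21_def R_def by (simp add: algebra_simps)
  have l2: "c12 + w * c22 = - (Y * R w) * w'" unfolding c12_def c22_def R_def by (simp add: algebra_simps)
  have "(c12 / c + w * (c22 / c)) / (c11 / c + w * (c21 / c)) = (c12 + w * c22) / (c11 + w * c21)"
    using c(1) by (simp add: add_divide_distrib[symmetric])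
  also have "\<dots> = w'" unfolding l1 l2 using nz Phi_nz[OF assms(1)] by simp
  finally have "w' = mob (c11 / c) (c12 / c) (c21 / c) (c22 / c) w" by (simp add: mob_def)
  moreover have "c11 / c * (c22 / c) - c12 / c * (c21 / c) = (c11 * c22 - c12 * c21) / (c * c)"
    by (simp add: diff_divide_distrib)
  ultimately show ?thesis using fixd q det0 c(1)
    by (intro exI[of _ "c11 / c"] exI[of _ "c12 / c"] exI[of _ "c21 / c"] exI[of _ "c22 / c"]) auto
qed

text \<open>Multiplying by \<open>R w^(q+1)\<close> leaves only differences of \<open>w\<close>,
  \<open>w^q\<close> and \<open>w^(q*q)\<close>, the quantities that a Moebius map rescales.\<close>

lemma Phi_iff_frob:
  assumes "R w \<noteq> 0"
  shows "Phi w \<longleftrightarrow> D ^ q * (w ^ (q * q) - w) ^ (q + 1) + E ^ (q + 1) * R w ^ (q * q + 1) = 0"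
proof -
  have e: "q * q - q + (q + 1) = q * q + 1" using q_ge by simp
  have "(D ^ q * N w ^ (q + 1) + E ^ (q + 1) * R w ^ (q * q - q)) * R w ^ (q + 1)
     = D ^ q * (N w * R w) ^ (q + 1) + E ^ (q + 1) * R w ^ (q * q - q + (q + 1))"
    unfolding power_mult_distrib[of "N w"] power_add[of "R w" "q * q - q" "q + 1"]
    by (simp only: distrib_right mult.assoc)
  then have "(D ^ q * N w ^ (q + 1) + E ^ (q + 1) * R w ^ (q * q - q)) * R w ^ (q + 1)
     = D ^ q * (w ^ (q * q) - w) ^ (q + 1) + E ^ (q + 1) * R w ^ (q * q + 1)"
    unfolding e N_mult_R .
  then show ?thesis using assms by (metis Phi_def mult_eq_0_iff power_not_zero)
qed

text \<open>With \<open>l\<close> the denominator, \<open>w^q - w\<close> and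
  \<open>w^(q*q) - w\<close> are multiplied by \<open>d / (l l^q)\<close> and
  \<open>d / (l l^(q*q))\<close>. The exponents \<open>q*q+1\<close> and \<open>q+1\<close> turn
  both factors into \<open>d^2 / L\<close>, because \<open>d^q = d\<close>.\<close>

lemma Phi_mob:
  assumes P: "Phi w" and c: "c11 ^ q = c11" "c12 ^ q = c12" "c21 ^ q = c21" "c22 ^ q = c22"
    and det: "c11 * c22 - c12 * c21 \<noteq> 0"
  shows "Phi (mob c11 c12 c21 c22 w)"
proof -
  define l n d where "l = c11 + w * c21" and "n = c12 + w * c22" and "d = c11 * c22 - c12 * c21"
  have l0: "l \<noteq> 0" unfolding l_def
    by (rule R_nz_not_linear[OF Phi_nz(1)[OF P] c(1,3)]) (use det in auto)
  have lq: "l ^ q = c11 + w ^ q * c21" "n ^ q = c12 + w ^ q * c22"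
    "l ^ (q * q) = c11 + w ^ (q * q) * c21" "n ^ (q * q) = c12 + w ^ (q * q) * c22"
    by (simp_all add: l_def n_def frob_add power_mult_distrib c power_mult)
  have dq: "d ^ q = d" by (simp add: d_def frob_diff power_mult_distrib c)
  define w' where "w' = mob c11 c12 c21 c22 w"
  have w': "w' = n / l" by (simp add: w'_def mob_def n_def l_def)
  have R': "R w' = d * R w / (l * l ^ q)"
  proof -
    have "R w' = n ^ q / l ^ q - n / l" by (simp add: R_def w' power_divide)
    also have "\<dots> = (n ^ q * l - n * l ^ q) / (l * l ^ q)" using l0 by (simp add: field_simps)
    also have "n ^ q * l - n * l ^ q = d * R w"
      by (simp add: lq l_def[symmetric], simp add: l_def n_def d_def R_def algebra_simps)
    finally show ?thesis .
  qed
  have Q': "w' ^ (q * q) - w' = d * (w ^ (q * q) - w) / (l * l ^ (q * q))"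
  proof -
    have "w' ^ (q * q) - w' = n ^ (q * q) / l ^ (q * q) - n / l" by (simp add: w' power_divide)
    also have "\<dots> = (n ^ (q * q) * l - n * l ^ (q * q)) / (l * l ^ (q * q))" using l0 by (simp add: field_simps)
    also have "n ^ (q * q) * l - n * l ^ (q * q) = d * (w ^ (q * q) - w)"
      unfolding lq by (simp add: l_def n_def d_def algebra_simps)
    finally show ?thesis .
  qed
  have R0: "R w' \<noteq> 0" unfolding R' using det l0 Phi_nz(1)[OF P] by (simp add: d_def)
  define L where "L = l ^ ((q + 1) * (q * q + 1))"
  have L: "(l * l ^ q) ^ (q * q + 1) = L" "(l * l ^ (q * q)) ^ (q + 1) = L"
    unfolding L_def power_mult[of l] by (simp_all add: power_mult[symmetric] mult_ac power_Suc[symmetric] del: power_Suc)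
  have dd: "d ^ (q + 1) = d * d" "d ^ (q * q + 1) = d * d"
    by (simp_all add: dq power_mult)
  have "D ^ q * (w' ^ (q * q) - w') ^ (q + 1) + E ^ (q + 1) * R w' ^ (q * q + 1)
    = d * d / L * (D ^ q * (w ^ (q * q) - w) ^ (q + 1) + E ^ (q + 1) * R w ^ (q * q + 1))"
    unfolding R' Q' power_divide L power_mult_distrib[of d] dd by (simp add: divide_inverse algebra_simps)
  also have "\<dots> = 0" using P Phi_iff_frob[OF Phi_nz(1)[OF P]] by simp
  finally show ?thesis using Phi_iff_frob[OF R0] by (simp add: w'_def)
qed

text \<open>\<open>mob\<close> is the row vector \<open>(1, w)\<close> times the matrix, read
  projectively. In this convention the inner matrix stands on the left of the product, which later
  turns matrices into automorphisms without an inverse or a transpose.\<close>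

lemma mob_mob:
  assumes "c11 + w * c21 \<noteq> 0"
  shows "mob h11 h12 h21 h22 (mob c11 c12 c21 c22 w)
    = mob (c11 * h11 + c12 * h21) (c11 * h12 + c12 * h22) (c21 * h11 + c22 * h21) (c21 * h12 + c22 * h22) w"
proof -
  define l n where "l = c11 + w * c21" and "n = c12 + w * c22"
  have "mob h11 h12 h21 h22 (n / l) = (h12 * l + n * h22) / (h11 * l + n * h21)"
    unfolding mob_def using assms by (simp add: l_def[symmetric] add_divide_eq_iff divide_add_eq_iff)
  then show ?thesis by (simp add: mob_def l_def n_def algebra_simps)
qed

text \<open>A fixed point is a root of a quadratic whose coefficients are fixed by the
  \<open>q\<close>-power map. Then \<open>w\<close>, \<open>w^q\<close> and \<open>w^(q*q)\<close>
  are three distinct roots, so the quadratic is zero.\<close>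

lemma mob_fixed:
  assumes P: "Phi w" and c: "c11 ^ q = c11" "c12 ^ q = c12" "c21 ^ q = c21" "c22 ^ q = c22"
    and det: "c11 * c22 - c12 * c21 \<noteq> 0" and fixd: "mob c11 c12 c21 c22 w = w"
  shows "c12 = 0 \<and> c21 = 0 \<and> c11 = c22"
proof -
  have l0: "c11 + w * c21 \<noteq> 0"
    by (rule R_nz_not_linear[OF Phi_nz(1)[OF P] c(1,3)]) (use det in auto)
  then have e: "c12 + w * c22 = w * (c11 + w * c21)" using fixd by (simp add: mob_def field_simps)
  have eq: "c12 + w ^ q * c22 = w ^ q * (c11 + w ^ q * c21)"
    using arg_cong[OF e, of "\<lambda>x. x ^ q"] by (simp add: frob_add power_mult_distrib c)
  have eqq: "c12 + w ^ (q * q) * c22 = w ^ (q * q) * (c11 + w ^ (q * q) * c21)"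
    using arg_cong[OF eq, of "\<lambda>x. x ^ q"] by (simp add: frob_add power_mult_distrib c power_mult)
  have *: "(z - w) * (c22 - c11 - (z + w) * c21) = 0" if "c12 + z * c22 = z * (c11 + z * c21)" for z
  proof -
    have "(z - w) * (c22 - c11 - (z + w) * c21)
      = (c12 + z * c22 - z * (c11 + z * c21)) - (c12 + w * c22 - w * (c11 + w * c21))"
      by (simp add: algebra_simps)
    then show ?thesis using that e by simp
  qed
  note 1 = *[OF eq] and 2 = *[OF eqq]
  have nz: "w ^ q - w \<noteq> 0" "w ^ (q * q) - w \<noteq> 0"
    using Phi_nz[OF P] N_mult_R[of w] by (auto simp: R_def)
  have 3: "c22 - c11 = (w ^ q + w) * c21" "c22 - c11 = (w ^ (q * q) + w) * c21" using 1 2 nz by auto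
  then have "(w ^ (q * q) - w ^ q) * c21 = 0" by (simp add: algebra_simps)
  moreover have "w ^ (q * q) - w ^ q = (w ^ q - w) ^ q" by (simp add: frob_diff power_mult)
  ultimately have "c21 = 0" using nz by simp
  then show ?thesis using 3 e by simp
qed

end

section \<open>Valuation rings\<close>

locale ring_in_field =
  fixes V :: "'a::field set"
  assumes one_V: "1 \<in> V" and add_V: "\<And>x y. x \<in> V \<Longrightarrow> y \<in> V \<Longrightarrow> x + y \<in> V"
    and mult_V: "\<And>x y. x \<in> V \<Longrightarrow> y \<in> V \<Longrightarrow> x * y \<in> V" and minus_V: "\<And>x. x \<in> V \<Longrightarrow> - x \<in> V"
begin

lemma zero_V: "0 \<in> V"
  using add_V[OF one_V minus_V[OF one_V]] by simp

lemma diff_V: "x \<in> V \<Longrightarrow> y \<in> V \<Longrightarrow> x - y \<in> V"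
  using add_V[OF _ minus_V, of x y] by simp

lemma power_V: "x \<in> V \<Longrightarrow> x ^ n \<in> V"
  by (induction n) (auto simp: one_V mult_V)

lemma sum_V: "(\<And>i. i \<in> I \<Longrightarrow> f i \<in> V) \<Longrightarrow> sum f I \<in> V"
  by (induction I rule: infinite_finite_induct) (auto simp: zero_V add_V)

definition "coeffs_in p \<longleftrightarrow> (\<forall>i. Polynomial.coeff p i \<in> V)"

lemma coeffs_in_simps:
  "coeffs_in p \<Longrightarrow> coeffs_in r \<Longrightarrow> coeffs_in (p + r)" "coeffs_in p \<Longrightarrow> coeffs_in r \<Longrightarrow> coeffs_in (p - r)" "coeffs_in p \<Longrightarrow> coeffs_in r \<Longrightarrow> coeffs_in (p * r)"
  "c \<in> V \<Longrightarrow> coeffs_in (Polynomial.monom c n)" "coeffs_in p \<Longrightarrow> c \<in> V \<Longrightarrow> coeffs_in (Polynomial.smult c p)"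
  by (auto simp: coeffs_in_def add_V diff_V mult_V zero_V coeff_mult intro!: sum_V)

lemma coeffs_in_sum: "(\<And>i. i \<in> I \<Longrightarrow> coeffs_in (f i)) \<Longrightarrow> coeffs_in (sum f I)"
  by (auto simp: coeffs_in_def coeff_sum intro!: sum_V)

lemma adjoin_ring: "ring_in_field {poly p x |p. coeffs_in p}" "V \<subseteq> {poly p x |p. coeffs_in p}" "x \<in> {poly p x |p. coeffs_in p}"
proof -
  have c: "coeffs_in [:c:]" if "c \<in> V" for c using coeffs_in_simps(4)[OF that, of 0] by (simp add: monom_0)
  have X: "coeffs_in [:0, 1:]" using coeffs_in_simps(4)[OF one_V, of 1] by (simp add: monom_altdef)
  have min: "coeffs_in (- p)" if "coeffs_in p" for p using that by (simp add: coeffs_in_def minus_V)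
  show "ring_in_field {poly p x |p. coeffs_in p}"
  proof
    show "1 \<in> {poly p x |p. coeffs_in p}"
    proof -
      have "1 = poly [:1:] x" by simp
      then show ?thesis using c[OF one_V] by blast
    qed
    show "y + z \<in> {poly p x |p. coeffs_in p}" "y * z \<in> {poly p x |p. coeffs_in p}"
      if yz: "y \<in> {poly p x |p. coeffs_in p}" "z \<in> {poly p x |p. coeffs_in p}" for y z
    proof -
      obtain p r where "y = poly p x" "z = poly r x" "coeffs_in p" "coeffs_in r" using yz by blast
      then have "y + z = poly (p + r) x" "y * z = poly (p * r) x" "coeffs_in (p + r)" "coeffs_in (p * r)"
        by (simp_all add: coeffs_in_simps)
      then show "y + z \<in> {poly p x |p. coeffs_in p}" "y * z \<in> {poly p x |p. coeffs_in p}"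
        by blast+
    qed
    show "- y \<in> {poly p x |p. coeffs_in p}" if y: "y \<in> {poly p x |p. coeffs_in p}" for y
    proof -
      obtain p where "y = poly p x" "coeffs_in p" using y by blast
      then have "- y = poly (- p) x" "coeffs_in (- p)" by (simp_all add: min)
      then show ?thesis by blast
    qed
  qed
  show "V \<subseteq> {poly p x |p. coeffs_in p}" proof
    fix y assume "y \<in> V"
    then have "y = poly [:y:] x" "coeffs_in [:y:]" using c by simp_all
    then show "y \<in> {poly p x |p. coeffs_in p}" by blast
  qed
  show "x \<in> {poly p x |p. coeffs_in p}" proof -
    have "x = poly [:0, 1:] x" by simp
    then show ?thesis using X by blast
  qed
qed

end

section \<open>Units and nonunits of a valuation ring\<close>

locale valuation_ring = ring_in_field +
  assumes total: "x \<in> V \<or> inverse x \<in> V"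
begin

text \<open>\<open>0\<close> is listed separately because \<open>inverse 0 = 0\<close> lies in
  \<open>V\<close>.\<close>

definition "nonunits = {x \<in> V. x = 0 \<or> inverse x \<notin> V}"
definition "units = {x \<in> V. x \<noteq> 0 \<and> inverse x \<in> V}"

lemma units_V: "x \<in> units \<Longrightarrow> x \<in> V" "x \<in> units \<Longrightarrow> x \<noteq> 0" "x \<in> nonunits \<Longrightarrow> x \<in> V"
  by (auto simp: units_def nonunits_def)

lemma not_unit_iff: "x \<in> V \<Longrightarrow> x \<notin> units \<longleftrightarrow> x \<in> nonunits"
  by (auto simp: units_def nonunits_def)

lemma units_nonunits: "x \<in> units \<Longrightarrow> x \<notin> nonunits"
  by (auto simp: units_def nonunits_def)

lemma one_unit: "1 \<in> units"
  by (simp add: units_def one_V)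

lemma units_mult: "x \<in> units \<Longrightarrow> y \<in> units \<Longrightarrow> x * y \<in> units"
  by (auto simp: units_def mult_V)

lemma units_inverse: "x \<in> units \<Longrightarrow> inverse x \<in> units"
  by (auto simp: units_def)

lemma units_divide: "x \<in> units \<Longrightarrow> y \<in> units \<Longrightarrow> x / y \<in> units"
  by (simp add: divide_inverse units_mult units_inverse)

lemma units_minus: "x \<in> units \<Longrightarrow> - x \<in> units"
  by (auto simp: units_def minus_V)

lemma units_power: "x \<in> units \<Longrightarrow> x ^ n \<in> units"
  by (induction n) (auto simp: one_unit units_mult)

lemma units_prod: "(\<And>i. i \<in> I \<Longrightarrow> f i \<in> units) \<Longrightarrow> prod f I \<in> units"
  by (induction I rule: infinite_finite_induct) (auto simp: one_unit units_mult)

lemma unit_multD: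
  assumes "x \<in> V" "y \<in> V" "x * y \<in> units"
  shows "x \<in> units"
proof -
  have nz: "x \<noteq> 0" "y \<noteq> 0" using assms by (auto simp: units_def)
  then have "inverse x = y * inverse (x * y)" by (simp add: field_simps)
  moreover have "inverse (x * y) \<in> V" using assms(3) unfolding units_def by blast
  ultimately have "inverse x \<in> V" using mult_V[OF assms(2)] by metis
  then show ?thesis using assms nz by (simp add: units_def)
qed

lemma nonunits_mult: "x \<in> nonunits \<Longrightarrow> y \<in> V \<Longrightarrow> x * y \<in> nonunits"
  by (metis mult_V not_unit_iff unit_multD units_V(3) units_nonunits)

lemma nonunits_mult': "x \<in> V \<Longrightarrow> y \<in> nonunits \<Longrightarrow> x * y \<in> nonunits"
  using nonunits_mult[of y x] by (simp add: mult.commute)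

lemma nonunits_minus: "x \<in> nonunits \<Longrightarrow> - x \<in> nonunits"
  using nonunits_mult[of x "- 1"] minus_V[OF one_V] by simp

lemma nonunits_power: "x \<in> nonunits \<Longrightarrow> n > 0 \<Longrightarrow> x ^ n \<in> nonunits"
  by (cases n) (auto intro: nonunits_mult power_V units_V)

lemma nonunits_powerD: "x \<in> V \<Longrightarrow> x ^ n \<in> nonunits \<Longrightarrow> x \<in> nonunits"
  by (metis not_unit_iff units_nonunits units_power)

lemma nonunits_multD: "x \<in> V \<Longrightarrow> y \<in> V \<Longrightarrow> x * y \<in> nonunits \<Longrightarrow> x \<in> nonunits \<or> y \<in> nonunits"
  by (metis not_unit_iff units_mult units_nonunits)

lemma nonunits_add:
  assumes "x \<in> nonunits" "y \<in> nonunits"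
  shows "x + y \<in> nonunits"
proof -
  have *: "x + y \<in> nonunits" if xy: "x \<in> nonunits" "y \<in> nonunits" "y \<noteq> 0" "x / y \<in> V" for x y
  proof -
    have "x + y = y * (x / y + 1)" using xy by (simp add: field_simps)
    then show ?thesis using nonunits_mult[OF xy(2) add_V[OF xy(4) one_V]] by simp
  qed
  consider "x = 0" | "y = 0" | "x \<noteq> 0" "y \<noteq> 0" "x / y \<in> V" | "x \<noteq> 0" "y \<noteq> 0" "y / x \<in> V"
    using total[of "x / y"] by fastforce
  then show ?thesis
  proof cases
    case 4
    then show ?thesis using *[OF assms(2,1)] by (simp add: add.commute)
  qed (use * assms in auto)
qed

lemma nonunits_diff: "x \<in> nonunits \<Longrightarrow> y \<in> nonunits \<Longrightarrow> x - y \<in> nonunits"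
  using nonunits_add[OF _ nonunits_minus, of x y] by simp

lemma unit_add_nonunit: "x \<in> units \<Longrightarrow> y \<in> nonunits \<Longrightarrow> x + y \<in> units"
proof (rule ccontr)
  assume xy: "x \<in> units" "y \<in> nonunits" and "x + y \<notin> units"
  then have "x + y \<in> nonunits" using add_V units_V not_unit_iff by blast
  then have "x \<in> nonunits" using nonunits_diff[of "x + y" y] xy by simp
  then show False using xy units_nonunits by blast
qed

lemma unit_diff_nonunit: "x \<in> units \<Longrightarrow> y \<in> nonunits \<Longrightarrow> x - y \<in> units"
  using unit_add_nonunit[OF _ nonunits_minus, of x y] by simp

lemma nonunit_add_unit: "x \<in> nonunits \<Longrightarrow> y \<in> units \<Longrightarrow> x + y \<in> units"
  using unit_add_nonunit[of y x] by (simp add: add.commute)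

lemma unit_cong: "x \<in> units \<Longrightarrow> y - x \<in> nonunits \<Longrightarrow> y \<in> units"
  using unit_add_nonunit[of x "y - x"] by simp

lemma not_in_V: "x \<notin> V \<Longrightarrow> inverse x \<in> nonunits"
  using total[of x] by (auto simp: nonunits_def)

lemma unit_powerD:
  assumes "x ^ n \<in> units" "n > 0"
  shows "x \<in> units"
proof (cases "x \<in> V")
  case True
  then show ?thesis using assms nonunits_power not_unit_iff units_nonunits by blast
next
  case False
  then have "inverse x ^ n \<in> nonunits" using not_in_V nonunits_power assms by blast
  moreover have "inverse x ^ n \<in> units" using units_inverse[OF assms(1)] by (simp add: power_inverse)
  ultimately show ?thesis using units_nonunits by blast
qed

text \<open>Stands in for the valuation of a power of \<open>t\<close>: the exponent is determined
  although the value group is unspecified. Unequal exponents would make a unit a multiple of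
  \<open>t\<close>.\<close>

lemma uniformizer_power_eq:
  assumes t: "t \<in> nonunits" "t \<noteq> 0" and u: "x \<in> units" "y \<in> units" and eq: "t ^ i * x = t ^ j * y"
  shows "i = j"
proof -
  have False if "i < j" "x \<in> units" "y \<in> units" "t ^ i * x = t ^ j * y" for i j x y
  proof -
    have "t ^ j = t ^ i * t ^ (j - i)" using that by (simp flip: power_add)
    then have "x = t ^ (j - i) * y" using that t by simp
    moreover have "t ^ (j - i) * y \<in> nonunits"
      using that t by (intro nonunits_mult nonunits_power units_V(1)) auto
    ultimately show False using that units_nonunits by blast
  qed
  then show ?thesis using u eq by (metis nat_neq_iff)
qed

text \<open>If \<open>t\<close> has valuation \<open>1\<close>, then \<open>z i\<close> has valuation \<open>1 / e\<close> for \<open>i \<in> S\<close> and \<open>0\<close> otherwise,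
  while the product has the integral valuation \<open>k - j\<close>.\<close>

lemma prod_valuation_dvd:
  assumes t: "t \<in> nonunits" "t \<noteq> 0" and I: "finite I" "S \<subseteq> I"
    and S: "\<And>i. i \<in> S \<Longrightarrow> \<exists>x\<in>units. z i ^ e = t * x"
    and U: "\<And>i. i \<in> I - S \<Longrightarrow> z i \<in> units"
    and p: "prod z I * t ^ j * x = t ^ k * y" "x \<in> units" "y \<in> units"
  shows "e dvd card S"
proof -
  obtain c where c: "\<And>i. i \<in> S \<Longrightarrow> c i \<in> units \<and> z i ^ e = t * c i" using S by metis
  have "prod z I = prod z S * prod z (I - S)"
    using I prod.subset_diff[of S I z] by (simp add: mult.commute)
  then have "prod z I ^ e = (\<Prod>i\<in>S. z i ^ e) * prod z (I - S) ^ e"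
    by (simp add: power_mult_distrib prod_power_distrib)
  also have "(\<Prod>i\<in>S. z i ^ e) = (\<Prod>i\<in>S. t * c i)" using c by (intro prod.cong) auto
  also have "\<dots> = t ^ card S * prod c S" by (simp add: prod.distrib)
  finally have pe: "prod z I ^ e = t ^ card S * (prod c S * prod z (I - S) ^ e)" by (simp add: mult.assoc)
  have un: "prod c S * prod z (I - S) ^ e \<in> units"
    using c U by (intro units_mult units_prod units_power) auto
  have "(prod z I * t ^ j * x) ^ e = (t ^ k * y) ^ e" using p by simp
  then have "t ^ (card S + j * e) * (prod c S * prod z (I - S) ^ e * x ^ e) = t ^ (k * e) * y ^ e"
    by (simp add: power_mult_distrib pe power_mult[symmetric] power_add mult_ac)
  then have "card S + j * e = k * e"
    by (rule uniformizer_power_eq[OF t, rotated 2]) (use un p units_mult units_power in auto)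
  then show ?thesis by (metis dvd_add_left_iff dvd_triv_right)
qed

end

text \<open>The descent in Chevalley's extension theorem. Multiplied by \<open>x^k\<close> and
  divided by the unit \<open>1 - t * b\<close>, the relation for \<open>inverse x\<close> writes
  \<open>x^k\<close> through lower powers of \<open>x\<close>; this removes the leading term of
  \<open>p\<close>.\<close>

lemma (in ring_in_field) adjoin_descent:
  assumes inv: "\<And>s. s \<in> V \<Longrightarrow> inverse (1 - t * s) \<in> V" and ne: "\<And>s. s \<in> V \<Longrightarrow> t * s \<noteq> 1"
    and t: "t \<in> V" and x: "x \<noteq> 0"
    and p: "coeffs_in p" "t * poly p x = 1" and r: "coeffs_in r" "t * poly r (inverse x) = 1"
    and le: "Polynomial.degree r \<le> Polynomial.degree p"
  shows "\<exists>p'. coeffs_in p' \<and> t * poly p' x = 1 \<and> Polynomial.degree p' < Polynomial.degree p"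
proof -
  define n k where "n = Polynomial.degree p" and "k = Polynomial.degree r"
  define b where "b = Polynomial.coeff r 0"
  define e where "e = inverse (1 - t * b)"
  have bV: "b \<in> V" using r(1) by (simp add: coeffs_in_def b_def)
  have e: "e \<in> V" "e * (1 - t * b) = 1" using inv[OF bV] ne[OF bV] by (auto simp: e_def)
  have "k \<noteq> 0"
  proof
    assume "k = 0"
    then have "r = [:b:]" unfolding b_def k_def by (metis degree_0_id)
    then show False using r(2) ne[OF bV] by simp
  qed
  then have k: "k > 0" "k \<le> n" using le by (auto simp: k_def n_def)
  define s where "s = Polynomial.smult (e * t) (\<Sum>i\<in>{1..k}. Polynomial.monom (Polynomial.coeff r i) (k - i))"
  have os: "coeffs_in s" unfolding s_def
    using r(1) e t by (intro coeffs_in_simps coeffs_in_sum mult_V) (auto simp: coeffs_in_def)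
  have ds: "Polynomial.degree s < k"
  proof -
    have "Polynomial.degree (Polynomial.monom (Polynomial.coeff r i) (k - i)) \<le> k - 1" if "i \<in> {1..k}" for i
      using that degree_monom_le[of "Polynomial.coeff r i" "k - i"] diff_le_mono2[of 1 i k] by simp
    then have "Polynomial.degree s \<le> k - 1" unfolding s_def
      by (intro order_trans[OF degree_smult_le] degree_sum_le) auto
    then show ?thesis using k by simp
  qed
  have ps: "poly s x = x ^ k"
  proof -
    have "poly r (inverse x) = (\<Sum>i\<le>k. Polynomial.coeff r i * inverse x ^ i)" by (simp add: poly_altdef k_def)
    also have "{..k} = insert 0 {1..k}" by auto
    finally have pr: "poly r (inverse x) = b + (\<Sum>i=1..k. Polynomial.coeff r i * inverse x ^ i)"
      by (simp add: b_def)
    have "poly s x = e * t * (\<Sum>i=1..k. Polynomial.coeff r i * x ^ (k - i))"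
      by (simp add: s_def poly_sum poly_monom)
    also have "(\<Sum>i=1..k. Polynomial.coeff r i * x ^ (k - i)) = (\<Sum>i=1..k. x ^ k * (Polynomial.coeff r i * inverse x ^ i))"
    proof (rule sum.cong)
      fix i assume "i \<in> {1..k}"
      then have "x ^ k = x ^ (k - i) * x ^ i" by (simp flip: power_add)
      then show "Polynomial.coeff r i * x ^ (k - i) = x ^ k * (Polynomial.coeff r i * inverse x ^ i)"
        using x by (simp add: power_inverse field_simps)
    qed simp
    also have "\<dots> = x ^ k * (poly r (inverse x) - b)" by (simp add: pr sum_distrib_left)
    also have "e * t * (x ^ k * (poly r (inverse x) - b)) = x ^ k * (e * (t * poly r (inverse x) - t * b))"
      by (simp add: algebra_simps)
    also have "\<dots> = x ^ k" using r(2) e by simp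
    finally show ?thesis .
  qed
  define c where "c = Polynomial.coeff p n"
  define p' where "p' = (p - Polynomial.monom c n) + Polynomial.smult c (Polynomial.monom 1 (n - k) * s)"
  have cV: "c \<in> V" using p(1) by (simp add: coeffs_in_def c_def)
  have "coeffs_in p'" unfolding p'_def using p(1) cV os by (intro coeffs_in_simps one_V)
  moreover have "poly p' x = poly p x"
  proof -
    have "x ^ n = x ^ (n - k) * x ^ k" using k by (simp flip: power_add)
    then show ?thesis by (simp add: p'_def poly_monom ps)
  qed
  moreover have "Polynomial.degree p' < n"
  proof (rule degree_lessI)
    show "p' \<noteq> 0 \<or> 0 < n" using k by simp
    show "\<forall>i\<ge>n. Polynomial.coeff p' i = 0"
    proof (intro allI impI)
      fix i assume i: "n \<le> i"
      have "Polynomial.degree (Polynomial.monom 1 (n - k) * s) < n"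
        using ds k degree_mult_le[of "Polynomial.monom 1 (n - k)" s] degree_monom_le[of "1::'a" "n - k"] by simp
      then have "Polynomial.coeff (Polynomial.monom 1 (n - k) * s) i = 0" using i by (intro coeff_eq_0) simp
      moreover have "Polynomial.coeff (p - Polynomial.monom c n) i = 0"
        using i by (cases "i = n") (auto simp: c_def n_def coeff_eq_0)
      ultimately show "Polynomial.coeff p' i = 0" by (simp add: p'_def)
    qed
  qed
  ultimately show ?thesis using p(2) unfolding n_def by auto
qed

text \<open>A subring maximal with respect to \<open>t\<close> not being invertible is a valuation ring.\<close>

theorem valuation_ring_exists:
  fixes A :: "'a::field set"
  assumes A: "ring_in_field A" and t: "t \<in> A" and ne: "\<And>s. s \<in> A \<Longrightarrow> t * s \<noteq> 1"
  shows "\<exists>V. valuation_ring V \<and> A \<subseteq> V \<and> (\<forall>s\<in>V. t * s \<noteq> 1)"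
proof -
  define F where "F = {B. ring_in_field B \<and> A \<subseteq> B \<and> (\<forall>s\<in>B. t * s \<noteq> 1)}"
  have "\<exists>V\<in>F. \<forall>B\<in>F. V \<subseteq> B \<longrightarrow> B = V"
  proof (rule subset_Zorn_nonempty)
    show "F \<noteq> {}" using A ne by (auto simp: F_def)
    fix C assume C: "C \<noteq> {}" "subset.chain F C"
    have CF: "B \<in> F" if "B \<in> C" for B using C that by (auto simp: subset.chain_def)
    have dir: "\<exists>B\<in>C. x \<in> B \<and> y \<in> B" if xy: "x \<in> \<Union>C" "y \<in> \<Union>C" for x y
    proof -
      obtain B B' where "B \<in> C" "B' \<in> C" "x \<in> B" "y \<in> B'" using xy by blast
      moreover have "B \<subseteq> B' \<or> B' \<subseteq> B" using C \<open>B \<in> C\<close> \<open>B' \<in> C\<close> by (auto simp: subset.chain_def)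
      ultimately show ?thesis by blast
    qed
    have "ring_in_field (\<Union>C)"
    proof
      obtain B where "B \<in> C" using C(1) by blast
      then have "1 \<in> B" using CF[of B] by (auto simp: F_def intro: ring_in_field.one_V)
      then show "1 \<in> \<Union>C" using \<open>B \<in> C\<close> by blast
      show "x + y \<in> \<Union>C" "x * y \<in> \<Union>C" if xy: "x \<in> \<Union>C" "y \<in> \<Union>C" for x y
      proof -
        obtain B where B: "B \<in> C" "x \<in> B" "y \<in> B" using dir[OF xy] by blast
        then have "ring_in_field B" using CF by (simp add: F_def)
        then have "x + y \<in> B" "x * y \<in> B"
          using B by (auto intro: ring_in_field.add_V ring_in_field.mult_V)
        then show "x + y \<in> \<Union>C" "x * y \<in> \<Union>C" using B(1) by auto
      qed
      show "- x \<in> \<Union>C" if "x \<in> \<Union>C" for x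
      proof -
        obtain B where B: "B \<in> C" "x \<in> B" using \<open>x \<in> \<Union>C\<close> by blast
        then have "- x \<in> B" using CF[OF B(1)] by (auto simp: F_def intro: ring_in_field.minus_V)
        then show ?thesis using B(1) by auto
      qed
    qed
    then show "\<Union>C \<in> F" using C(1) CF by (auto simp: F_def)
  qed
  then obtain V where VF: "V \<in> F" and max: "\<And>B. B \<in> F \<Longrightarrow> V \<subseteq> B \<Longrightarrow> B = V" by blast
  interpret V: ring_in_field V using VF by (simp add: F_def)
  have AV: "A \<subseteq> V" and neV: "\<And>s. s \<in> V \<Longrightarrow> t * s \<noteq> 1" using VF by (auto simp: F_def)
  have tV: "t \<in> V" using t AV by blast
  have nz: "1 - t * s \<noteq> 0" if "s \<in> V" for s using neV[OF that] by simp
  have inv: "inverse (1 - t * s) \<in> V" if s: "s \<in> V" for s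
  proof -
    \<comment> \<open>By maximality \<open>V\<close> is closed under division by
      \<open>1 - t s\<close>: in the ring \<open>W\<close> of such fractions a relation
      \<open>t x / (1 - t s) = 1\<close> becomes \<open>t (x + s) = 1\<close>, which is impossible
      in \<open>V\<close>.\<close>
    define W where "W = {x / (1 - t * s) |x s. x \<in> V \<and> s \<in> V}"
    have WI: "x / (1 - t * s) \<in> W" if "x \<in> V" "s \<in> V" for x s using that by (auto simp: W_def)
    have VW: "V \<subseteq> W" using WI[OF _ V.zero_V] by auto
    have den: "(1 - t * s) * (1 - t * s') = 1 - t * (s + s' - t * s * s')" for s s'
      by (simp add: algebra_simps)
    have denV: "s + s' - t * s * s' \<in> V" if "s \<in> V" "s' \<in> V" for s s'
      using that tV by (intro V.diff_V V.add_V V.mult_V)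
    have "ring_in_field W"
    proof
      show "1 \<in> W" using VW V.one_V by blast
      show "x + y \<in> W" "x * y \<in> W" if xy: "x \<in> W" "y \<in> W" for x y
      proof -
        obtain x' s y' s' where e: "x = x' / (1 - t * s)" "y = y' / (1 - t * s')" and v: "x' \<in> V" "s \<in> V" "y' \<in> V" "s' \<in> V"
          using xy unfolding W_def by blast
        have "x + y = (x' * (1 - t * s') + y' * (1 - t * s)) / (1 - t * (s + s' - t * s * s'))"
          unfolding den[symmetric] e using nz[OF v(2)] nz[OF v(4)] by (simp add: add_frac_eq)
        moreover have "x' * (1 - t * s') + y' * (1 - t * s) \<in> V"
          using v tV by (intro V.diff_V V.add_V V.mult_V V.one_V)
        ultimately show "x + y \<in> W" using WI denV v by simp
        have "x * y = (x' * y') / (1 - t * (s + s' - t * s * s'))"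
          unfolding den[symmetric] e by simp
        then show "x * y \<in> W" using WI denV v V.mult_V by simp
      qed
      show "- x \<in> W" if xW: "x \<in> W" for x
      proof -
        obtain x' s where e: "x = x' / (1 - t * s)" "x' \<in> V" "s \<in> V" using xW unfolding W_def by blast
        then have "- x = (- x') / (1 - t * s)" by simp
        then show ?thesis using WI[OF V.minus_V] e by metis
      qed
    qed
    moreover have "t * y \<noteq> 1" if y: "y \<in> W" for y
    proof
      obtain x s where e: "y = x / (1 - t * s)" "x \<in> V" "s \<in> V" using y unfolding W_def by blast
      assume "t * y = 1"
      then have "t * (x + s) = 1" using e nz[OF e(3)] by (simp add: field_simps)
      then show False using neV[OF V.add_V[OF e(2,3)]] by simp
    qed
    ultimately have "W = V" using max VW AV by (auto simp: F_def)
    then show ?thesis using WI[OF V.one_V s] by (simp add: divide_inverse)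
  qed
  have adj: "\<exists>p. V.coeffs_in p \<and> t * poly p x = 1" if x: "x \<notin> V" for x
  proof (rule ccontr)
    assume no: "\<not> (\<exists>p. V.coeffs_in p \<and> t * poly p x = 1)"
    let ?W = "{poly p x |p. V.coeffs_in p}"
    have "?W \<in> F" using V.adjoin_ring[of x] AV no by (auto simp: F_def)
    then have "?W = V" using max V.adjoin_ring(2) by blast
    then show False using x V.adjoin_ring(3)[of x] by blast
  qed
  have "x \<in> V \<or> inverse x \<in> V" for x
  proof (rule ccontr)
    assume "\<not> (x \<in> V \<or> inverse x \<in> V)"
    then have xV: "x \<notin> V" "inverse x \<notin> V" by auto
    then have x0: "x \<noteq> 0" using V.zero_V by auto
    \<comment> \<open>Both relations are taken of least degree; the descent shortens the one of
      larger degree.\<close>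
    define Q where "Q = (\<lambda>y n. \<exists>p. V.coeffs_in p \<and> t * poly p y = 1 \<and> Polynomial.degree p = n)"
    have ex: "\<exists>n. Q x n" "\<exists>n. Q (inverse x) n" using adj xV by (auto simp: Q_def)
    obtain p where p: "V.coeffs_in p" "t * poly p x = 1" "Polynomial.degree p = (LEAST n. Q x n)"
      using LeastI_ex[OF ex(1)] unfolding Q_def by blast
    obtain r where r: "V.coeffs_in r" "t * poly r (inverse x) = 1" "Polynomial.degree r = (LEAST n. Q (inverse x) n)"
      using LeastI_ex[OF ex(2)] unfolding Q_def by blast
    have least: "(LEAST n. Q y n) \<le> Polynomial.degree p'" if "V.coeffs_in p'" "t * poly p' y = 1" for y p'
      by (rule Least_le) (use that in \<open>auto simp: Q_def\<close>)
    show False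
    proof (cases "Polynomial.degree r \<le> Polynomial.degree p")
      case True
      from V.adjoin_descent[OF inv neV tV x0 p(1,2) r(1,2) True]
      show False using least p(3) by force
    next
      case False
      from V.adjoin_descent[OF inv neV tV _ r(1,2) _ _ ] x0 p(1,2) False
      obtain p' where "V.coeffs_in p'" "t * poly p' (inverse x) = 1" "Polynomial.degree p' < Polynomial.degree r"
        by (metis inverse_inverse_eq inverse_nonzero_iff_nonzero nat_le_linear)
      then show False using least r(3) by force
    qed
  qed
  then have "valuation_ring V"
    by (intro valuation_ring.intro valuation_ring_axioms.intro V.ring_in_field_axioms)
  then show ?thesis using AV neV by blast
qed

section \<open>The Hermitian curve over the line of slopes\<close>

lemma freshmans_dream_prime_power:
  fixes x y :: "'a::field"
  assumes "Factorial_Ring.prime p" "of_nat p = (0 :: 'a)"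
  shows "(x + y) ^ (p ^ n) = x ^ (p ^ n) + y ^ (p ^ n)"
proof -
  have "CHAR('a) dvd p" using assms(2) by (simp add: of_nat_eq_0_iff_char_dvd)
  moreover have "CHAR('a) \<noteq> 1" using CHAR_not_1'[where 'a = 'a] by simp
  ultimately have "CHAR('a) = p" using assms(1) by (metis prime_nat_iff)
  then show ?thesis using assms(1) by (intro freshmans_dream') auto
qed

section \<open>Polynomials and constants inside the closure of the function field\<close>

definition em :: "'c::field poly \<Rightarrow> 'c poly fract alg_closure" where
  "em p = to_ac (Fraction_Field.Fract p 1)"

abbreviation cst :: "'c::field \<Rightarrow> 'c poly fract alg_closure" where
  "cst c \<equiv> em [:c:]"

lemma em_simps [simp]:
  "em (p + r) = em p + em r" "em (p - r) = em p - em r" "em (- p) = - em p" "em (p * r) = em p * em r"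
  "em 0 = 0" "em 1 = 1"
  by (simp_all add: em_def flip: to_ac_add to_ac_diff to_ac_minus to_ac_mult)
     (simp_all add: Zero_fract_def One_fract_def flip: to_ac_0 to_ac_1)

lemma em_power [simp]: "em (p ^ k) = em p ^ k"
  by (induction k) auto

lemma em_eq_iff [simp]: "em p = em r \<longleftrightarrow> p = r"
  by (simp add: em_def eq_fract)

lemma em_eq_0_iff [simp]: "em p = 0 \<longleftrightarrow> p = 0"
  using em_eq_iff[of p 0] by simp

lemma em_pCons: "em (pCons c p) = cst c + em [:0, 1:] * em p"
proof -
  have "pCons c p = [:c:] + [:0, 1:] * p" by simp
  then show ?thesis by (metis em_simps(1,4))
qed

lemma cst_simps:
  "cst (x + y) = cst x + cst y" "cst (x - y) = cst x - cst y" "cst (- x) = - cst x"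
  "cst (x * y) = cst x * cst y" "cst (x ^ k) = cst x ^ k"
proof -
  have "[:x + y:] = [:x:] + [:y:]" "[:x - y:] = [:x:] - [:y:]" "[:- x:] = - [:x:]"
    "[:x * y:] = [:x:] * [:y:]" "[:x ^ k:] = [:x:] ^ k"
    by (simp_all add: poly_const_pow)
  then show "cst (x + y) = cst x + cst y" "cst (x - y) = cst x - cst y" "cst (- x) = - cst x"
    "cst (x * y) = cst x * cst y" "cst (x ^ k) = cst x ^ k"
    by (simp_all only: em_simps em_power)
qed

lemma base_cases:
  assumes "x \<in> range to_ac"
  obtains A B where "B \<noteq> 0" "x = em A / em B"
proof -
  obtain y where y: "x = to_ac y" using assms by blast
  obtain A B where AB: "y = Fraction_Field.Fract A B" "B \<noteq> 0" by (cases y)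
  then have "y = Fraction_Field.Fract A 1 / Fraction_Field.Fract B 1" by simp
  then have "x = em A / em B" unfolding y em_def by (simp only: to_ac_divide)
  then show thesis using that AB by blast
qed

lemma ring_em: "ring_in_field (range (em :: 'c::field poly \<Rightarrow> _))"
proof
  show "1 \<in> range (em :: 'c poly \<Rightarrow> _)" using rangeI[of em "1 :: 'c poly"] by simp
  fix x y assume "x \<in> range (em :: 'c poly \<Rightarrow> _)" "y \<in> range (em :: 'c poly \<Rightarrow> _)"
  then obtain p r :: "'c poly" where e: "x = em p" "y = em r" by blast
  show "x + y \<in> range em" "x * y \<in> range em"
    using rangeI[of em "p + r"] rangeI[of em "p * r"] by (simp_all add: e)
next
  fix x assume "x \<in> range (em :: 'c poly \<Rightarrow> _)"
  then obtain p :: "'c poly" where e: "x = em p" by blast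
  show "- x \<in> range em" using rangeI[of em "- p"] by (simp add: e)
qed

text \<open>The fields with \<open>q\<close> and \<open>q^2\<close> elements appear as the fixed
  points of power maps, so \<open>a\<close> and \<open>b\<close> may be taken in any algebraically
  closed field of characteristic \<open>p\<close>.\<close>

locale hermitian_projection =
  fixes p n q :: nat and a b :: "'c::alg_closed_field"
  assumes prime_p: "Factorial_Ring.prime p" and n_pos: "n > 0" and q_def: "q = p ^ n"
    and char_p: "of_nat p = (0 :: 'c)"
    and off_curve: "a ^ (q + 1) + b ^ q + b \<noteq> 0"
    and not_rational: "\<not> (a ^ (q * q) = a \<and> b ^ (q * q) = b)"
begin

lemma q_ge_2: "q \<ge> 2"
proof -
  have "p \<ge> 2" using prime_p by (rule prime_ge_2_nat)
  then show ?thesis unfolding q_def using n_pos self_le_power[of p n] by simp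
qed

lemma of_nat_p_poly: "of_nat p = (0 :: 'c poly)"
  by (simp add: char_p of_nat_poly)

lemma of_nat_p_base: "of_nat p = (0 :: 'c poly fract)"
  unfolding of_nat_fract using of_nat_p_poly by (simp add: Zero_fract_def)

lemma of_nat_p_closure: "of_nat p = (0 :: 'c poly fract alg_closure)"
  using of_nat_p_base by (metis to_ac_0 to_ac_of_nat)

lemma of_nat_q: "of_nat q = (0 :: 'c)" "of_nat q = (0 :: 'c poly fract)"
  "of_nat q = (0 :: 'c poly fract alg_closure)"
  unfolding q_def using char_p of_nat_p_base of_nat_p_closure n_pos by simp_all

lemma frob_c: "(x + y :: 'c) ^ q = x ^ q + y ^ q"
  unfolding q_def by (rule freshmans_dream_prime_power[OF prime_p char_p])

abbreviation "m \<equiv> em [:0, 1 :: 'c:]"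

text \<open>Brings the rules for the \<open>q\<close>-power map to the constants; the slope and the
  point carry the dummy value \<open>0\<close>.\<close>

sublocale C: projected_hermitian q 0 0 "0 :: 'c"
  by unfold_locales (auto simp: q_ge_2 frob_c)

sublocale projected_hermitian q m "cst a" "cst b"
proof unfold_locales
  fix x y :: "'c poly fract alg_closure"
  show "(x + y) ^ q = x ^ q + y ^ q"
    unfolding q_def by (rule freshmans_dream_prime_power[OF prime_p of_nat_p_closure])
qed (rule q_ge_2)

text \<open>This factored form isolates \<open>a^(q+1) + b^q + b\<close>: by
  \<open>off_curve\<close> neither factor vanishes at a root, and as the first factor has derivative
  zero, every root is simple.\<close>

definition "Dp = ([:0, 1:] ^ q + [:a:]) * ([:0, 1:] + [:a ^ q:]) - [:a ^ (q + 1) + b ^ q + b:]"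
definition "Ep = [:0, 1 :: 'c:] - [:0, 1:] ^ (q * q)"

lemma D_eq: "D = em Dp"
proof -
  have "em Dp = (m ^ q + cst a) * (m + cst a ^ q) - (cst a ^ (q + 1) + cst b ^ q + cst b)"
    by (simp only: Dp_def em_simps em_power cst_simps)
  then show ?thesis
    by (simp add: D_def frob_diff power_mult_distrib algebra_simps)
qed

lemma E_eq: "E = em Ep"
  by (simp add: E_def Ep_def)

lemma poly_Dp: "poly Dp x = (x ^ q + a) * (x + a ^ q) - (a ^ (q + 1) + b ^ q + b)"
  by (simp add: Dp_def algebra_simps)

lemma poly_Dp': "poly Dp x = x ^ (q + 1) + (x * a - b) ^ q + (x * a - b)"
  by (simp add: poly_Dp C.frob_diff power_mult_distrib algebra_simps)

lemma Dp_rootD: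
  assumes "poly Dp x = 0"
  shows "x ^ q + a \<noteq> 0" "x + a ^ q \<noteq> 0"
  using assms off_curve by (auto simp: poly_Dp)

lemma Dp_factor:
  assumes "Dp = [:- x, 1:] * D'"
  shows "poly D' x = x ^ q + a"
proof -
  have "pderiv ([:0, 1 :: 'c:] ^ q + [:a:]) = 0"
    by (simp add: pderiv_add pderiv_power pderiv_pCons of_nat_q)
  then have "pderiv Dp = [:0, 1:] ^ q + [:a:]"
    unfolding Dp_def pderiv_diff pderiv_mult by (simp add: pderiv_pCons pderiv_add)
  then have "poly (pderiv Dp) x = x ^ q + a" by simp
  moreover have "poly (pderiv Dp) x = poly D' x"
    unfolding assms pderiv_mult by (simp add: pderiv_pCons)
  ultimately show ?thesis by simp
qed

text \<open>A tangent at a point over the field with \<open>q\<^sup>2\<close> elements is defined over that field; two such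
  tangents through \<open>(a, b)\<close> would make \<open>(a, b)\<close> rational.\<close>

lemma exists_nonrational_tangent:
  obtains m0 D' where "Dp = [:- m0, 1:] * D'" "m0 ^ (q * q) \<noteq> m0"
proof -
  have deg: "Polynomial.degree Dp = q + 1"
  proof -
    have 1: "Polynomial.degree ([:0, 1 :: 'c:] ^ q + [:a:]) = q"
      using q_ge_2 by (subst degree_add_eq_left) (auto simp: degree_power_eq)
    have "Polynomial.degree (([:0, 1:] ^ q + [:a:]) * ([:0, 1:] + [:a ^ q:])) = q + 1"
      using 1 q_ge_2 by (subst degree_mult_eq) auto
    then show ?thesis unfolding Dp_def diff_conv_add_uminus
      by (subst degree_add_eq_left) auto
  qed
  obtain r1 where r1: "poly Dp r1 = 0" using alg_closed_imp_poly_has_root[of Dp] deg by auto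
  then obtain D1 where D1: "Dp = [:- r1, 1:] * D1" by (metis dvdE poly_eq_0_iff_dvd)
  have "D1 \<noteq> 0" using D1 deg by auto
  then have "Polynomial.degree D1 = q" using deg unfolding D1 by (subst (asm) degree_mult_eq) auto
  then obtain r2 where r2: "poly D1 r2 = 0" using alg_closed_imp_poly_has_root[of D1] q_ge_2 by auto
  have ne: "r2 \<noteq> r1" using r2 Dp_factor[OF D1] Dp_rootD[OF r1] by auto
  have r2': "poly Dp r2 = 0" using D1 r2 by simp
  \<comment> \<open>The \<open>q\<close>-th power of the equation \<open>poly Dp x = 0\<close> again
    contains \<open>x^(q+1)\<close> and \<open>(x a - b)^q\<close>; comparison shows that
    \<open>x a - b\<close> is fixed by the \<open>q^2\<close>-power map.\<close>
  have rat: "(x * a - b) ^ (q * q) = x * a - b" if x: "poly Dp x = 0" "x ^ (q * q) = x" for x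
  proof -
    have 1: "x ^ (q + 1) + (x * a - b) ^ q + (x * a - b) = 0" using x by (simp add: poly_Dp')
    have "(x ^ (q + 1) + (x * a - b) ^ q + (x * a - b)) ^ q = 0" using 1 q_ge_2 by simp
    then have "x ^ ((q + 1) * q) + (x * a - b) ^ (q * q) + (x * a - b) ^ q = 0"
      by (simp add: frob_c power_mult[symmetric] del: power_Suc)
    moreover have "x ^ ((q + 1) * q) = x ^ (q + 1)"
    proof -
      have "(q + 1) * q = q * q + q" by simp
      then show ?thesis using x(2) by (simp add: power_add)
    qed
    ultimately have "(x * a - b) ^ (q * q) + (x ^ (q + 1) + (x * a - b) ^ q) = (x * a - b) + (x ^ (q + 1) + (x * a - b) ^ q)"
      using 1 by (simp add: ac_simps)
    then show ?thesis by (rule add_right_imp_eq)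
  qed
  have "\<not> (r1 ^ (q * q) = r1 \<and> r2 ^ (q * q) = r2)"
  proof
    assume r: "r1 ^ (q * q) = r1 \<and> r2 ^ (q * q) = r2"
    have frob2: "(x - y :: 'c) ^ (q * q) = x ^ (q * q) - y ^ (q * q)" for x y
      by (simp add: power_mult C.frob_diff)
    have e: "(r1 * a - b) ^ (q * q) = r1 * a - b" "(r2 * a - b) ^ (q * q) = r2 * a - b"
      using rat r1 r2' r by auto
    have "((r1 * a - b) - (r2 * a - b)) ^ (q * q) = (r1 * a - b) - (r2 * a - b)"
      by (subst frob2) (simp only: e)
    then have "((r1 - r2) * a) ^ (q * q) = (r1 - r2) * a" by (simp add: algebra_simps)
    moreover have "(r1 - r2) ^ (q * q) = r1 - r2" by (subst frob2) (simp add: r)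
    ultimately have aa: "a ^ (q * q) = a" using ne by (simp add: power_mult_distrib)
    have "b = r1 * a - (r1 * a - b)" by simp
    then have "b ^ (q * q) = (r1 * a - (r1 * a - b)) ^ (q * q)" by simp
    also have "\<dots> = r1 * a - (r1 * a - b)"
      by (subst frob2) (simp only: e, simp add: power_mult_distrib r aa)
    finally show False using aa not_rational by simp
  qed
  then show thesis
  proof (cases "r1 ^ (q * q) = r1")
    case True
    obtain D2 where "Dp = [:- r2, 1:] * D2" using r2' by (metis dvdE poly_eq_0_iff_dvd)
    then show thesis using that \<open>\<not> (r1 ^ (q * q) = r1 \<and> r2 ^ (q * q) = r2)\<close> True by blast
  qed (use that D1 in blast)
qed

sublocale smooth_projected_hermitian q m "cst a" "cst b"
proof unfold_locales
  obtain m0 D' where m0: "Dp = [:- m0, 1:] * D'" "m0 ^ (q * q) \<noteq> m0"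
    by (rule exists_nonrational_tangent)
  have "poly Dp (- (a ^ q)) = - (a ^ (q + 1) + b ^ q + b)" unfolding poly_Dp by simp
  then have "poly Dp (- (a ^ q)) \<noteq> 0"
    using off_curve neg_equal_0_iff_equal[of "a ^ (q + 1) + b ^ q + b"] by metis
  then show "D \<noteq> 0" by (auto simp: D_eq)
  have "poly Ep m0 \<noteq> 0" using m0 by (simp add: Ep_def)
  then show "E \<noteq> 0" by (auto simp: E_eq)
qed

section \<open>The equation of \<open>u\<close> as a polynomial\<close>

definition "root_poly = [:m ^ q, 1:] * ([:0, 1:] ^ q + [:m:]) - [:D:]"

lemma poly_root_poly: "poly root_poly x = (x + m ^ q) * (x ^ q + m) - D"
  by (simp add: root_poly_def algebra_simps)

lemma degree_root_poly: "Polynomial.degree root_poly = q + 1" "Polynomial.coeff root_poly (q + 1) = 1"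
proof -
  let ?g = "[:0, 1 :: 'c poly fract alg_closure:] ^ q + [:m:]"
  have g: "Polynomial.degree ?g = q"
    using q_ge_2 by (subst degree_add_eq_left) (auto simp: degree_power_eq)
  have lg: "Polynomial.coeff ?g q = 1"
    using q_ge_2 by (simp add: coeff_pCons split: nat.split) (metis coeff_monom monom_altdef smult_1_left)
  have "Polynomial.degree ([:m ^ q, 1:] * ?g) = q + 1"
    using g q_ge_2 by (subst degree_mult_eq) auto
  then show "Polynomial.degree root_poly = q + 1" unfolding root_poly_def diff_conv_add_uminus
    by (subst degree_add_eq_left) auto
  have "Polynomial.coeff ([:m ^ q, 1:] * ?g) (q + 1) = 1"
    using lg g coeff_mult_degree_sum[of "[:m ^ q, 1:]" ?g] by simp
  then show "Polynomial.coeff root_poly (q + 1) = 1" by (simp add: root_poly_def)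
qed

lemma roots_of_root_poly: "{x. poly root_poly x = 0} = {u. is_root u}"
  by (simp add: poly_root_poly is_root_iff')

lemma exists_triple:
  assumes u: "is_root u"
  shows "\<exists>v w. triple u v w"
proof -
  define F where "F = [:0, 1:] ^ (q - 1) * [:u + m ^ q, 1:] + [:u ^ q + m:]"
  have "Polynomial.degree ([:0, 1 :: 'c poly fract alg_closure:] ^ (q - 1) * [:u + m ^ q, 1:]) = q"
    using q_ge_2 by (subst degree_mult_eq) (auto simp: degree_power_eq)
  then have "Polynomial.degree F = q" unfolding F_def using q_ge_2 by (subst degree_add_eq_left) auto
  then obtain v where "poly F v = 0" using alg_closed_imp_poly_has_root[of F] q_ge_2 by auto
  then have v: "v ^ q + (u + m ^ q) * v ^ (q - 1) + u ^ q + m = 0"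
    by (simp add: F_def pow_q[of v] algebra_simps)
  define c where "c = (v + u + m ^ q) / (u + m ^ q)"
  have "Polynomial.degree ([:0, 1 :: 'c poly fract alg_closure:] ^ (q - 1) + [:- c:]) = q - 1"
    using q_ge_2 by (subst degree_add_eq_left) (auto simp: degree_power_eq)
  then obtain w where "poly ([:0, 1:] ^ (q - 1) + [:- c:]) w = 0"
    using alg_closed_imp_poly_has_root[of "[:0, 1:] ^ (q - 1) + [:- c:]"] q_ge_2 by auto
  then have "w ^ (q - 1) = c" by simp
  then have "v + u + m ^ q - (u + m ^ q) * w ^ (q - 1) = 0"
    using root_facts[OF u] by (simp add: c_def)
  then show ?thesis using u v by (auto simp: triple_def)
qed

text \<open>Such a \<open>u\<close> would be integral over the polynomials in \<open>m\<close>,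
  hence a polynomial \<open>F\<close>. Degrees force \<open>F\<close> to be a constant
  \<open>f\<close>, the coefficients then give \<open>f = a\<close>, and \<open>off_curve\<close> is
  violated.\<close>

lemma no_root_in_base:
  assumes u: "is_root u" and base: "u \<in> range to_ac"
  shows False
proof -
  define Y where "Y = u + m ^ q"
  \<comment> \<open>A denominator of least degree stands for a fraction in lowest terms: a zero of
    \<open>B\<close> would be a zero of \<open>A\<close> and could be cancelled.\<close>
  define Q where "Q = (\<lambda>d. \<exists>A B. B \<noteq> 0 \<and> Y = em A / em B \<and> Polynomial.degree B = d)"
  obtain A0 B0 where AB0: "B0 \<noteq> 0" "u = em A0 / em B0" using base_cases[OF base] .
  then have "Y = em (A0 + [:0, 1:] ^ q * B0) / em B0" by (simp add: Y_def add_divide_distrib)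
  then have "Q (Polynomial.degree B0)" using AB0(1) unfolding Q_def by blast
  then have "Q (LEAST d. Q d)" by (rule LeastI)
  then obtain A B where AB: "B \<noteq> 0" "Y = em A / em B" "Polynomial.degree B = (LEAST d. Q d)"
    unfolding Q_def by blast
  have YD: "Y * (Y ^ q + E) = D" using u by (simp add: is_root_iff Y_def)
  have "em (A * (A ^ q + Ep * B ^ q)) = em A * (em A ^ q + E * em B ^ q)"
    by (simp only: em_simps em_power E_eq)
  also have "\<dots> = (Y * em B) * ((Y ^ q + E) * em B ^ q)"
    using AB(1) by (simp add: AB(2) power_divide distrib_right)
  also have "\<dots> = Y * (Y ^ q + E) * em B ^ (q + 1)" by (simp add: mult_ac)
  also have "\<dots> = em (Dp * B ^ (q + 1))" by (simp only: em_simps em_power YD D_eq)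
  finally have "em (A * (A ^ q + Ep * B ^ q)) = em (Dp * B ^ (q + 1))" .
  then have AD: "A * (A ^ q + Ep * B ^ q) = Dp * B ^ (q + 1)" by (simp only: em_eq_iff)
  have "Polynomial.degree B = 0"
  proof (rule ccontr)
    assume "Polynomial.degree B \<noteq> 0"
    then obtain x where x: "poly B x = 0" using alg_closed_imp_poly_has_root[of B] by auto
    have "poly A x * (poly A x ^ q) = 0"
      using arg_cong[OF AD, of "\<lambda>p. poly p x"] x q_ge_2 by (simp add: power_0_left)
    then have "poly A x = 0" by auto
    then obtain A' where fA: "A = [:- x, 1:] * A'" by (metis dvdE poly_eq_0_iff_dvd)
    obtain B' where fB: "B = [:- x, 1:] * B'" using x by (metis dvdE poly_eq_0_iff_dvd)
    note f = fA fB
    have B': "B' \<noteq> 0" using AB(1) fB by auto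
    have "Y = (em [:- x, 1:] * em A') / (em [:- x, 1:] * em B')" unfolding AB(2) by (simp only: fA fB em_simps)
    also have "\<dots> = em A' / em B'" by (rule mult_divide_mult_cancel_left) simp
    finally have "Y = em A' / em B'" .
    then have "Q (Polynomial.degree B')" using B' unfolding Q_def by blast
    then have "(LEAST d. Q d) \<le> Polynomial.degree B'" by (rule Least_le)
    moreover have "Polynomial.degree B = Suc (Polynomial.degree B')"
      unfolding fB by (subst degree_mult_eq) (use B' in auto)
    ultimately show False using AB(3) by simp
  qed
  then obtain c where c: "B = [:c:]" by (metis degree_eq_zeroE)
  then have c0: "c \<noteq> 0" using AB(1) by simp
  define F where "F = Polynomial.smult (inverse c) A - [:0, 1:] ^ q"
  have "A = [:c:] * Polynomial.smult (inverse c) A" using c0 by simp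
  then have "em A = em B * em (Polynomial.smult (inverse c) A)" unfolding c by (metis em_simps(4))
  then have "Y = em (Polynomial.smult (inverse c) A)" using AB by simp
  then have uF: "u = em F" by (simp add: F_def Y_def eq_diff_eq)
  have "em ((F + [:0, 1:] ^ q) * (F ^ q + [:0, 1:])) = em Dp"
    using u unfolding is_root_iff' D_eq uF by simp
  then have FD: "(F + [:0, 1:] ^ q) * (F ^ q + [:0, 1:]) = Dp" by (simp only: em_eq_iff)
  have Dp0: "Dp \<noteq> 0" using D_nz D_eq by auto
  have degX: "Polynomial.degree ([:0, 1 :: 'c:] ^ q) = q" by (simp add: degree_power_eq)
  have "Polynomial.degree Dp \<le> q + 1"
    unfolding Dp_def
    by (intro degree_diff_le order_trans[OF degree_mult_le] add_mono degree_add_le) (auto simp: degX)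
  then have deg: "Polynomial.degree (F + [:0, 1:] ^ q) + Polynomial.degree (F ^ q + [:0, 1:]) \<le> q + 1"
    using degree_mult_eq[of "F + [:0, 1:] ^ q" "F ^ q + [:0, 1:]"] Dp0 unfolding FD[symmetric]
    by (metis mult_zero_left mult_zero_right)
  define d where "d = Polynomial.degree F"
  have Fd: "Polynomial.degree (F ^ q + [:0, 1:]) = q * d" if "d > 0"
  proof -
    have "F \<noteq> 0" using that by (auto simp: d_def)
    then have "Polynomial.degree (F ^ q) = q * d" by (simp add: degree_power_eq d_def)
    moreover have "q * 1 \<le> q * d" by (rule mult_le_mono2) (use that in simp)
    then have "q * d > 1" using q_ge_2 by linarith
    ultimately show ?thesis by (subst degree_add_eq_left) auto
  qed
  have "d = 0"
  proof (rule ccontr)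
    assume d: "d \<noteq> 0"
    show False
    proof (cases "d = 1")
      case True
      then have "Polynomial.degree (F + [:0, 1:] ^ q) = q"
        using q_ge_2 degX by (subst degree_add_eq_right) (auto simp: d_def)
      then show False using deg Fd d True q_ge_2 by simp
    next
      case False
      then have "q * 2 \<le> q * d" using d by (intro mult_le_mono2) simp
      moreover have "Polynomial.degree (F ^ q + [:0, 1:]) = q * d" using Fd d by simp
      ultimately show False using deg q_ge_2 by linarith
    qed
  qed
  then obtain f where f: "F = [:f:]" unfolding d_def by (metis degree_eq_zeroE)
  \<comment> \<open>With \<open>y\<close> for the \<open>q\<close>-th power of the indeterminate,
    this separates the part in \<open>y\<close> from the linear part without expanding any
    power.\<close>
  have id: "(y + c1) * (x + c2) - c3 - (c4 + y) * (c5 + x) = (c2 - c5) * y + ((c1 * c2 - c4 * c5 - c3) + (c1 - c4) * x)"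
    for x y c1 c2 c3 c4 c5 :: "'c poly" by (simp add: algebra_simps)
  define \<delta> where "\<delta> = a ^ (q + 1) + b ^ q + b"
  have "0 = Dp - (F + [:0, 1:] ^ q) * (F ^ q + [:0, 1:])" unfolding FD by simp
  also have "\<dots> = ([:a ^ q:] - [:f ^ q:]) * [:0, 1:] ^ q
      + (([:a:] * [:a ^ q:] - [:f:] * [:f ^ q:] - [:\<delta>:]) + ([:a:] - [:f:]) * [:0, 1:])"
    unfolding f poly_const_pow Dp_def \<delta>_def[symmetric] by (rule id)
  also have "\<dots> = Polynomial.monom (a ^ q - f ^ q) q + [:a * a ^ q - f * f ^ q - \<delta>, a - f:]"
    by (simp add: monom_altdef)
  finally have eq: "Polynomial.monom (a ^ q - f ^ q) q + [:a * a ^ q - f * f ^ q - \<delta>, a - f:] = 0" by simp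
  have "Polynomial.coeff [:a * a ^ q - f * f ^ q - \<delta>, a - f:] q = 0"
    by (rule coeff_eq_0) (use q_ge_2 in auto)
  then have "a ^ q - f ^ q = 0" using arg_cong[OF eq, of "\<lambda>p. Polynomial.coeff p q"] by simp
  then have "(a - f) ^ q = 0" by (simp add: C.frob_diff)
  then have "f = a" by simp
  then have "\<delta> = 0" using arg_cong[OF eq, of "\<lambda>p. Polynomial.coeff p 0"] q_ge_2 by simp
  then show False using off_curve by (simp add: \<delta>_def)
qed

end

section \<open>Specialization at a tangent\<close>

text \<open>\<open>V\<close> is an arbitrary place of the whole closure above \<open>m = m0\<close>;
  no compatibility with the Galois group is asked of it.\<close>

locale tangent_place = hermitian_projection p n q a b + valuation_ring V
  for p n q :: nat and a b :: "'c::alg_closed_field" and V :: "'c poly fract alg_closure set" +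
  fixes m0 \<mu> :: 'c and D' :: "'c poly"
  assumes Dp_eq: "Dp = [:- m0, 1:] * D'" and m0: "m0 ^ (q * q) \<noteq> m0" and mu: "\<mu> ^ q = m0"
    and em_V: "range em \<subseteq> V" and t_not_unit: "\<And>s. s \<in> V \<Longrightarrow> em [:- m0, 1:] * s \<noteq> 1"
begin

definition "t = em [:- m0, 1:]"

lemma em_in_V: "em f \<in> V"
  using em_V by blast

lemma t_nz: "t \<noteq> 0"
  by (simp add: t_def)

lemma t_nonunit: "t \<in> nonunits"
proof -
  have "inverse t \<notin> V" using t_not_unit[of "inverse t"] t_nz by (auto simp: t_def)
  then show ?thesis using em_in_V by (simp add: nonunits_def t_def)
qed

lemma t_eq: "t = m - cst m0"
proof -
  have "[:- m0, 1:] = [:0, 1:] - [:m0:]" by simp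
  then show ?thesis unfolding t_def by (metis em_simps(2))
qed

lemma em_cong: "em f - cst (poly f m0) \<in> nonunits"
proof -
  have "poly (f - [:poly f m0:]) m0 = 0" by simp
  then obtain s where "f - [:poly f m0:] = [:- m0, 1:] * s" by (metis dvdE poly_eq_0_iff_dvd)
  then have "em f - cst (poly f m0) = t * em s" unfolding t_def by (metis em_simps(2,4))
  then show ?thesis using nonunits_mult[OF t_nonunit em_in_V] by simp
qed

lemma cst_unit:
  assumes "c \<noteq> 0"
  shows "cst c \<in> units"
proof -
  have "cst c * cst (inverse c) = 1" using assms by (simp flip: cst_simps add: one_pCons[symmetric])
  then show ?thesis using unit_multD[OF em_in_V em_in_V] one_unit by metis
qed

lemma em_unit: "poly f m0 \<noteq> 0 \<Longrightarrow> em f \<in> units"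
  using unit_cong[OF cst_unit em_cong] .

lemma em_decomp:
  assumes "f \<noteq> 0"
  obtains i e where "e \<in> units" "em f = t ^ i * e"
proof -
  obtain s where s: "f = [:- m0, 1:] ^ Polynomial.order m0 f * s" "\<not> [:- m0, 1:] dvd s"
    using order_decomp[OF assms] by blast
  then have "em f = t ^ Polynomial.order m0 f * em s" unfolding t_def by (metis em_simps(4) em_power)
  moreover have "em s \<in> units" using s(2) em_unit by (simp add: poly_eq_0_iff_dvd)
  ultimately show thesis using that by blast
qed

text \<open>The form in which elements of the base field have integral valuation, here
  \<open>i - j\<close>.\<close>

lemma base_decomp:
  assumes "x \<in> range to_ac" "x \<noteq> 0"
  obtains i j e e' where "e \<in> units" "e' \<in> units" "x * t ^ j * e = t ^ i * e'"
proof -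
  obtain A B where AB: "B \<noteq> 0" "x = em A / em B" using base_cases[OF assms(1)] .
  then have "A \<noteq> 0" using assms(2) by auto
  then obtain i e' where A: "e' \<in> units" "em A = t ^ i * e'" by (rule em_decomp)
  obtain j e where B: "e \<in> units" "em B = t ^ j * e" using AB(1) by (rule em_decomp)
  have "x * em B = em A" using AB by simp
  then have "x * t ^ j * e = t ^ i * e'" using A B by (simp add: mult.assoc)
  then show thesis using that A B by blast
qed

lemma E_cong: "E - (cst m0 - cst m0 ^ (q * q)) \<in> nonunits"
  using em_cong[of Ep] by (simp add: E_eq Ep_def flip: cst_simps)

lemma E_unit: "E \<in> units"
  unfolding E_eq by (rule em_unit) (use m0 in \<open>simp add: Ep_def\<close>)

lemma D'_cong: "em D' - (cst m0 ^ q + cst a) \<in> nonunits"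
  using em_cong[of D'] by (simp add: Dp_factor[OF Dp_eq] cst_simps flip: em_simps)

lemma m0_facts: "m0 ^ q + a \<noteq> 0" "m0 + a ^ q \<noteq> 0"
  using Dp_rootD[of m0] by (simp_all add: Dp_eq)

lemma D'_unit: "em D' \<in> units"
  by (rule em_unit) (simp add: Dp_factor[OF Dp_eq] m0_facts)

lemma D_factor: "D = t * em D'"
  unfolding D_eq Dp_eq t_def by (rule em_simps)

lemma D_nonunit: "D \<in> nonunits"
  unfolding D_factor by (rule nonunits_mult[OF t_nonunit em_in_V])

lemma nonunit_powerD':
  assumes "x ^ k \<in> nonunits" "k > 0"
  shows "x \<in> nonunits"
proof (cases "x \<in> V")
  case True
  then show ?thesis using nonunits_powerD assms by blast
next
  case False
  then have "inverse x \<in> nonunits" "x \<noteq> 0" using not_in_V zero_V by auto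
  then have "inverse x ^ k * x ^ k \<in> nonunits"
    by (intro nonunits_mult[OF nonunits_power[OF _ assms(2)] units_V(3)[OF assms(1)]])
  then have "1 \<in> nonunits" using \<open>x \<noteq> 0\<close> by (simp flip: power_mult_distrib)
  then show ?thesis using one_unit units_nonunits by blast
qed

lemma power_in_V_D:
  assumes "x ^ k \<in> V" "k > 0"
  shows "x \<in> V"
proof (rule ccontr)
  assume x: "x \<notin> V"
  then have "inverse x \<in> nonunits" "x \<noteq> 0" using not_in_V zero_V by auto
  then have "inverse x ^ k * x ^ k \<in> nonunits"
    using assms by (intro nonunits_mult nonunits_power) auto
  then have "1 \<in> nonunits" using \<open>x \<noteq> 0\<close> by (simp flip: power_mult_distrib)
  then show False using one_unit units_nonunits by blast
qed

lemma q_pos: "q > 0" "q - 1 > 0"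
  using q_ge_2 by auto

section \<open>Special and nonspecial roots\<close>

definition "Y u = u + m ^ q"

text \<open>Over the tangent \<open>m = m0\<close> the polynomial of \<open>u\<close> degenerates to
  \<open>(X + m0\<^sup>q) (X + \<mu>)\<^sup>q\<close>; a root is called special if it specializes to \<open>- m0\<^sup>q\<close>.\<close>

definition "special u \<longleftrightarrow> is_root u \<and> Y u \<in> nonunits"

lemma Y_root: "is_root u \<Longrightarrow> Y u * (Y u ^ q + E) = D"
  by (simp add: is_root_iff Y_def)

text \<open>\<open>Y u\<close> is integral: otherwise its equation divided by
  \<open>Y u ^ (q + 1)\<close> would make \<open>1\<close> a nonunit.\<close>

lemma Y_in_V:
  assumes "is_root u"
  shows "Y u \<in> V"
proof (rule ccontr)
  assume Y: "Y u \<notin> V"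
  define y where "y = inverse (Y u)"
  have y: "y \<in> nonunits" using Y not_in_V by (simp add: y_def)
  have "Y u \<noteq> 0" using Y zero_V by auto
  then have "D * y ^ (q + 1) - E * y ^ q = 1"
    unfolding Y_root[OF assms, symmetric] by (simp add: y_def power_inverse field_simps)
  moreover have "D * y ^ (q + 1) - E * y ^ q \<in> nonunits"
    by (intro nonunits_diff nonunits_mult' nonunits_power y) (use q_pos units_V(3)[OF D_nonunit] units_V(1)[OF E_unit] in auto)
  ultimately show False using one_unit units_nonunits by metis
qed

text \<open>\<open>E\<close> is a unit because \<open>m0\<close> avoids the field with
  \<open>q^2\<close> elements, and \<open>D / t\<close> is one because \<open>m0\<close> is a simple
  zero; hence so is \<open>Y u / t\<close>.\<close>

lemma special_Y:
  assumes "special u"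
  shows "\<exists>e\<in>units. Y u = t * e"
proof -
  have u: "is_root u" "Y u \<in> nonunits" using assms by (auto simp: special_def)
  have un: "Y u ^ q + E \<in> units" by (intro nonunit_add_unit nonunits_power u E_unit q_pos)
  have "Y u = t * (em D' / (Y u ^ q + E))"
    using Y_root[OF u(1)] units_V(2)[OF un] by (simp add: D_factor field_simps)
  then show ?thesis using units_divide[OF D'_unit un] by blast
qed

lemma nonspecial_facts:
  assumes "is_root u" "\<not> special u"
  shows "Y u \<in> units" "Y u ^ q + E \<in> nonunits" "\<exists>e\<in>units. (u + cst \<mu>) ^ q = t * e"
proof -
  show Yu: "Y u \<in> units" using assms Y_in_V not_unit_iff by (auto simp: special_def)
  have "Y u ^ q + E = D * inverse (Y u)"
    using Y_root[OF assms(1)] units_V(2)[OF Yu] by (simp add: field_simps)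
  then show YE: "Y u ^ q + E \<in> nonunits"
    using nonunits_mult[OF D_nonunit units_V(1)[OF units_inverse[OF Yu]]] by simp
  \<comment> \<open>Since \<open>Y u ^ q\<close> is congruent to \<open>- E\<close>, the
    \<open>q\<close>-th power of \<open>em D' - Y u\<close> has the residue \<open>a^q + m0\<close>.
    This is the second factor of \<open>Dp\<close> at \<open>m0\<close>, which does not
    vanish.\<close>
  have "(em D' - Y u) ^ q - cst (a ^ q + m0)
     = (em D' - (cst m0 ^ q + cst a)) ^ q - (Y u ^ q + E) + (E - (cst m0 - cst m0 ^ (q * q)))"
    by (simp add: frob_diff frob_add cst_simps power_mult algebra_simps)
  moreover have "\<dots> \<in> nonunits"
    by (intro nonunits_add nonunits_diff nonunits_power D'_cong YE E_cong q_pos)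
  moreover have "a ^ q + m0 \<noteq> 0" using m0_facts by (simp add: add.commute)
  ultimately have "(em D' - Y u) ^ q \<in> units" using unit_cong cst_unit by metis
  then have dY: "em D' - Y u \<in> units" by (rule unit_powerD) (rule q_pos)
  \<comment> \<open>\<open>u^q + m\<close> exceeds \<open>(u + \<mu>)^q\<close> by \<open>t\<close>,
    so the equation becomes \<open>Y u * (u + \<mu>)^q = t * (em D' - Y u)\<close>.\<close>
  have muq: "cst \<mu> ^ q = m - t" using mu by (simp add: t_eq flip: cst_simps)
  have "Y u * (u ^ q + m) = D" using assms(1) by (simp add: is_root_iff' Y_def)
  then have "Y u * (u + cst \<mu>) ^ q = t * (em D' - Y u)"
    by (simp add: frob_add muq D_factor algebra_simps)
  then have "(u + cst \<mu>) ^ q = t * ((em D' - Y u) / Y u)"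
    using units_V(2)[OF Yu] by (simp add: field_simps)
  then show "\<exists>e\<in>units. (u + cst \<mu>) ^ q = t * e" using units_divide[OF dY Yu] by blast
qed

text \<open>Dividing the difference of the two equations by \<open>Y u - Y u'\<close> leaves a sum
  congruent to the unit \<open>E\<close>, which cannot vanish; this is the uniqueness part of
  Hensel's lemma.\<close>

lemma special_unique:
  assumes "special u" "special u'"
  shows "u = u'"
proof (rule ccontr)
  assume ne: "u \<noteq> u'"
  have Y: "Y u \<in> nonunits" "Y u' \<in> nonunits" "is_root u" "is_root u'" using assms by (auto simp: special_def)
  have d: "Y u - Y u' \<noteq> 0" using ne by (simp add: Y_def)
  have dq: "Y u ^ q - Y u' ^ q = (Y u - Y u') * (Y u - Y u') ^ (q - 1)"
    using pow_q[of "Y u - Y u'"] by (simp add: frob_diff)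
  have "(Y u - Y u') * (Y u ^ q + (Y u - Y u') ^ (q - 1) * Y u' + E)
     = Y u * Y u ^ q - Y u' * Y u ^ q + (Y u ^ q - Y u' ^ q) * Y u' + (Y u - Y u') * E"
    unfolding dq by (simp add: algebra_simps)
  also have "\<dots> = Y u * (Y u ^ q + E) - Y u' * (Y u' ^ q + E)" by (simp add: algebra_simps)
  also have "\<dots> = 0" using Y_root Y by simp
  finally have "Y u ^ q + (Y u - Y u') ^ (q - 1) * Y u' + E = 0" using d by simp
  moreover have "Y u ^ q + (Y u - Y u') ^ (q - 1) * Y u' + E \<in> units"
    by (intro nonunit_add_unit nonunits_add nonunits_mult nonunits_mult' nonunits_power power_V units_V(3) nonunits_diff Y E_unit q_pos)
  ultimately show False using units_V(2) by metis
qed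

text \<open>At \<open>- m^q\<close> the polynomial of \<open>u\<close> has the value
  \<open>- D\<close>, a nonunit, and up to signs this is the product of all \<open>Y x\<close>. The
  multiset keeps track of multiplicities.\<close>

lemma exists_special: "\<exists>u. special u"
proof (rule ccontr)
  assume no: "\<not> (\<exists>u. special u)"
  have F0: "root_poly \<noteq> 0" using degree_root_poly by auto
  obtain A where A: "root_poly = (\<Prod>x\<in>#A. [:- x, 1:])"
    using alg_closed_imp_factorization[OF F0] degree_root_poly by auto
  have "is_root x" if "x \<in># A" for x
  proof -
    have "[:- x, 1:] dvd root_poly" unfolding A using that by (simp add: dvd_prod_mset)
    then show ?thesis using roots_of_root_poly by (auto simp: poly_eq_0_iff_dvd)
  qed
  then have Au: "Y x \<in> units" if "x \<in># A" for x using nonspecial_facts(1) no that by blast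
  have "poly (\<Prod>x\<in>#B. [:- x, 1:]) (- (m ^ q)) \<in> units" if "\<forall>x\<in>#B. Y x \<in> units" for B
    using that
  proof (induction B)
    case (add x B)
    have "- (m ^ q) - x = - Y x" by (simp add: Y_def)
    moreover have "- Y x \<in> units" using add.prems by (intro units_minus) simp
    ultimately have "- (m ^ q) - x \<in> units" by metis
    moreover have "poly (\<Prod>x\<in>#add_mset x B. [:- x, 1:]) (- (m ^ q)) = (- (m ^ q) - x) * poly (\<Prod>x\<in>#B. [:- x, 1:]) (- (m ^ q))"
      by (simp add: algebra_simps)
    ultimately show ?case using add units_mult by simp
  qed (simp add: one_unit)
  then have "poly root_poly (- (m ^ q)) \<in> units" using A Au by simp
  moreover have "poly root_poly (- (m ^ q)) = - D" by (simp add: poly_root_poly)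
  ultimately show False using nonunits_minus[OF D_nonunit] units_nonunits by metis
qed

lemma kappa_facts: "m0 ^ q \<noteq> m0" "m0 \<noteq> 0" "m0 \<noteq> 1" "m0 ^ q \<noteq> \<mu>"
proof -
  show 1: "m0 ^ q \<noteq> m0"
  proof
    assume *: "m0 ^ q = m0"
    then have "m0 ^ (q * q) = m0" by (simp add: power_mult)
    then show False using m0 by simp
  qed
  show "m0 \<noteq> 0" "m0 \<noteq> 1" using 1 q_pos by auto
  show "m0 ^ q \<noteq> \<mu>" 
  proof
    assume "m0 ^ q = \<mu>"
    then have "m0 ^ (q * q) = m0" using mu by (simp add: power_mult)
    then show False using m0 by simp
  qed
qed

lemma m_cong: "m ^ q - cst m0 ^ q = t ^ q"
  by (simp add: t_eq frob_diff)

lemma special_cong: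
  assumes "special u"
  shows "u + cst m0 ^ q \<in> nonunits"
proof -
  have "u + cst m0 ^ q = Y u - t ^ q" by (simp add: Y_def flip: m_cong)
  then show ?thesis
    using assms by (simp add: special_def nonunits_diff nonunits_power t_nonunit q_pos)
qed

lemma nonspecial_cong:
  assumes "is_root u" "\<not> special u"
  shows "u + cst \<mu> \<in> nonunits"
proof (rule nonunit_powerD')
  obtain e where "e \<in> units" "(u + cst \<mu>) ^ q = t * e" using nonspecial_facts(3)[OF assms] by blast
  then show "(u + cst \<mu>) ^ q \<in> nonunits" using nonunits_mult[OF t_nonunit] units_V(1) by simp
qed (rule q_pos)

lemma special_mu_unit:
  assumes "special u"
  shows "u + cst \<mu> \<in> units"
proof -
  have "cst (\<mu> - m0 ^ q) \<in> units" using kappa_facts by (intro cst_unit) simp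
  moreover have "u + cst \<mu> - cst (\<mu> - m0 ^ q) \<in> nonunits"
    using special_cong[OF assms] by (simp add: cst_simps algebra_simps)
  ultimately show ?thesis by (rule unit_cong)
qed

text \<open>At a special root \<open>u\<close> these have valuations \<open>1 / (q - 1)\<close> and \<open>1 / q\<close>, otherwise they are units,
  so their norms detect both factors of the order of the stabilizer of \<open>u\<close>.\<close>

definition "z1 w = 1 / (w - cst m0)"
definition "z2 u v = u + v + cst \<mu> + cst m0 * (u + cst m0 ^ q)"

lemma triple_second_root:
  assumes "triple u v w"
  shows "is_root u" "is_root (u + v)" "u + v \<noteq> u" "Y (u + v) = Y u * w ^ (q - 1)"
proof -
  note f = triple_facts[OF assms]
  show "is_root u" using assms by (simp add: triple_def)
  show "is_root (u + v)" using other_root[OF assms, of 0] f q_pos by simp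
  show "u + v \<noteq> u" using f by simp
  show "Y (u + v) = Y u * w ^ (q - 1)" using assms by (simp add: triple_def Y_def algebra_simps)
qed

text \<open>Here \<open>Y (u + v)\<close> is a unit, so \<open>w^(q-1) = Y (u + v) / Y u\<close>
  shows that \<open>w\<close> has a pole, and the shift by \<open>m0\<close> changes it only by a
  unit factor.\<close>

lemma special_z1:
  assumes tr: "triple u v w" and u: "special u"
  shows "\<exists>e\<in>units. z1 w ^ (q - 1) = t * e"
proof -
  note x = triple_second_root[OF tr] and f = triple_facts[OF tr]
  have "\<not> special (u + v)" using special_unique[OF u] x by metis
  then have Yx: "Y (u + v) \<in> units" using nonspecial_facts(1) x by blast
  obtain e where e: "e \<in> units" "Y u = t * e" using special_Y[OF u] by blast
  have e0: "e \<noteq> 0" using units_V e by blast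
  have w: "inverse w ^ (q - 1) = t * (e / Y (u + v))"
    using x(4) e(2) f(5) units_V(2)[OF Yx] t_nz e0 by (simp add: power_inverse field_simps)
  have eu: "e / Y (u + v) \<in> units" by (rule units_divide[OF e(1) Yx])
  have iw: "inverse w \<in> nonunits"
    by (rule nonunit_powerD'[OF _ q_pos(2)]) (use w nonunits_mult[OF t_nonunit units_V(1)[OF eu]] in simp)
  have g: "1 - cst m0 * inverse w \<in> units"
    by (intro unit_diff_nonunit one_unit nonunits_mult' iw em_in_V)
  have "w - cst m0 = w * (1 - cst m0 * inverse w)" using f(5) by (simp add: field_simps)
  then have "z1 w = inverse w * inverse (1 - cst m0 * inverse w)" by (simp add: z1_def divide_inverse)
  then have "z1 w ^ (q - 1) = t * (e / Y (u + v) * inverse (1 - cst m0 * inverse w) ^ (q - 1))"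
    by (simp only: power_mult_distrib w mult.assoc)
  then show ?thesis using units_mult[OF eu units_power[OF units_inverse[OF g]]] by blast
qed

text \<open>\<open>w\<close> lies in \<open>V\<close> and \<open>R w\<close> is a nonunit, so the
  residue of \<open>w\<close> belongs to the field with \<open>q\<close> elements. Since
  \<open>m0\<close> is outside that field, \<open>w - cst m0\<close> is a unit.\<close>

lemma nonspecial_z1:
  assumes tr: "triple u v w" and u: "\<not> special u"
  shows "z1 w \<in> units"
proof -
  note x = triple_second_root[OF tr] and f = triple_facts[OF tr] and ns = nonspecial_facts[OF triple_second_root(1)[OF tr] u]
  have "w ^ (q - 1) = Y (u + v) * inverse (Y u)"
    using x(4) units_V(2)[OF ns(1)] by simp
  then have "w ^ (q - 1) \<in> V"
    using mult_V[OF Y_in_V[OF x(2)] units_V(1)[OF units_inverse[OF ns(1)]]] by simp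
  then have wV: "w \<in> V" using power_in_V_D q_pos by blast
  have "Y u ^ q * R w ^ (q - 1) = - (Y u ^ q + E)"
    using f(2) by (simp add: Y_def N_def algebra_simps eq_neg_iff_add_eq_0 flip: add.assoc)
  then have "Y u ^ q * R w ^ (q - 1) \<in> nonunits" using nonunits_minus[OF ns(2)] by simp
  moreover have RV: "R w \<in> V" unfolding R_def by (intro diff_V power_V wV)
  ultimately have "R w ^ (q - 1) \<in> nonunits"
    using nonunits_multD[of "Y u ^ q" "R w ^ (q - 1)"] units_power[OF ns(1), of q] units_nonunits power_V units_V(1) by blast
  then have Rn: "R w \<in> nonunits" using nonunits_powerD RV by blast
  have "w - cst m0 \<in> units"
  proof (rule ccontr)
    assume "w - cst m0 \<notin> units"
    then have wk: "w - cst m0 \<in> nonunits" using not_unit_iff diff_V wV em_in_V by blast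
    have "cst (m0 ^ q - m0) = R w - ((w - cst m0) ^ q - (w - cst m0))"
      by (simp add: R_def frob_diff cst_simps)
    also have "\<dots> \<in> nonunits" by (intro nonunits_diff nonunits_power Rn wk q_pos)
    finally show False using cst_unit[of "m0 ^ q - m0"] kappa_facts units_nonunits by auto
  qed
  then show ?thesis using units_divide[OF one_unit] by (simp add: z1_def)
qed

lemma special_z2:
  assumes tr: "triple u v w" and u: "special u"
  shows "\<exists>e\<in>units. z2 u v ^ q = t * e"
proof -
  note x = triple_second_root[OF tr]
  have "\<not> special (u + v)" using special_unique[OF u] x by metis
  then obtain e1 where e1: "e1 \<in> units" "(u + v + cst \<mu>) ^ q = t * e1"
    using nonspecial_facts(3)[OF x(2)] by blast
  obtain e where e: "e \<in> units" "Y u = t * e" using special_Y[OF u] by blast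
  \<comment> \<open>The second summand of \<open>z2\<close> is a multiple of \<open>t\<close>, so
    its \<open>q\<close>-th power \<open>t^q * g\<close> is negligible against
    \<open>t * e1\<close>, as \<open>q\<close> exceeds \<open>1\<close>.\<close>
  define g where "g = cst m0 ^ q * (e - t ^ (q - 1)) ^ q"
  have gV: "g \<in> V" unfolding g_def
    by (intro mult_V power_V diff_V em_in_V units_V(1)[OF e(1)] units_V(3)[OF t_nonunit])
  have "u + cst m0 ^ q = Y u - t ^ q" by (simp add: Y_def flip: m_cong)
  also have "\<dots> = t * (e - t ^ (q - 1))" by (simp add: e pow_q[of t] algebra_simps)
  finally have uu: "u + cst m0 ^ q = t * (e - t ^ (q - 1))" .
  have "z2 u v ^ q = t * e1 + t ^ q * g"
    unfolding z2_def frob_add[of "u + v + cst \<mu>"] e1(2) power_mult_distrib[of "cst m0"] uu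
      power_mult_distrib[of t] g_def by (simp only: mult.left_commute)
  also have "\<dots> = t * (e1 + t ^ (q - 1) * g)" by (simp add: pow_q[of t] algebra_simps)
  finally have "z2 u v ^ q = t * (e1 + t ^ (q - 1) * g)" .
  moreover have "e1 + t ^ (q - 1) * g \<in> units"
    by (intro unit_add_nonunit e1 nonunits_mult nonunits_power t_nonunit gV q_pos)
  ultimately show ?thesis by blast
qed

text \<open>With \<open>u\<close> congruent to \<open>- \<mu>\<close> and \<open>u + v\<close> to
  \<open>- m0^q\<close> or \<open>- \<mu>\<close>, the residue is \<open>(m0 - 1) c\<close> or
  \<open>m0 c\<close>. The coefficient \<open>m0\<close> in \<open>z2\<close> serves because it is
  neither \<open>0\<close> nor \<open>1\<close>.\<close>

lemma nonspecial_z2: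
  assumes tr: "triple u v w" and u: "\<not> special u"
  shows "z2 u v \<in> units"
proof -
  note x = triple_second_root[OF tr]
  define c where "c = m0 ^ q - \<mu>"
  have c: "c \<noteq> 0" using kappa_facts by (simp add: c_def)
  have un: "u + cst \<mu> \<in> nonunits" by (rule nonspecial_cong[OF x(1) u])
  show ?thesis
  proof (cases "special (u + v)")
    case True
    have "z2 u v - cst ((m0 - 1) * c) = (u + v + cst m0 ^ q) + cst m0 * (u + cst \<mu>)"
      by (simp add: z2_def c_def cst_simps algebra_simps flip: one_pCons)
    also have "\<dots> \<in> nonunits"
      by (intro nonunits_add special_cong True nonunits_mult' em_in_V un)
    finally show ?thesis using kappa_facts c by (intro unit_cong[OF cst_unit]) auto
  next
    case False
    have "z2 u v - cst (m0 * c) = (u + v + cst \<mu>) + cst m0 * (u + cst \<mu>)"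
      by (simp add: z2_def c_def cst_simps algebra_simps)
    also have "\<dots> \<in> nonunits"
      by (intro nonunits_add nonspecial_cong x False nonunits_mult' em_in_V un)
    finally show ?thesis using kappa_facts c by (intro unit_cong[OF cst_unit]) auto
  qed
qed

end

context hermitian_projection
begin

lemma exists_tangent_place:
  obtains V m0 \<mu> D' where "tangent_place p n q a b V m0 \<mu> D'"
proof -
  obtain m0 D' where m0: "Dp = [:- m0, 1:] * D'" "m0 ^ (q * q) \<noteq> m0"
    by (rule exists_nonrational_tangent)
  have "Polynomial.degree ([:0, 1 :: 'c:] ^ q + [:- m0:]) = q"
    using q_ge_2 by (subst degree_add_eq_left) (auto simp: degree_power_eq)
  then obtain \<mu> where "poly ([:0, 1:] ^ q + [:- m0:]) \<mu> = 0"
    using alg_closed_imp_poly_has_root[of "[:0, 1:] ^ q + [:- m0:]"] q_ge_2 by auto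
  then have mu: "\<mu> ^ q = m0" by simp
  have "em [:- m0, 1:] * s \<noteq> 1" if s: "s \<in> range em" for s
  proof
    obtain r where r: "s = em r" using s by blast
    assume "em [:- m0, 1:] * s = 1"
    then have "em ([:- m0, 1:] * r) = em 1" by (simp only: r em_simps)
    then have "[:- m0, 1:] * r = 1" by (simp only: em_eq_iff)
    then have "poly ([:- m0, 1:] * r) m0 = 1" by simp
    then show False by simp
  qed
  then obtain V where V: "valuation_ring V" "range em \<subseteq> V" "\<forall>s\<in>V. em [:- m0, 1:] * s \<noteq> 1"
    using valuation_ring_exists[OF ring_em, of "em [:- m0, 1:]"] by blast
  have "tangent_place p n q a b V m0 \<mu> D'"
    by (intro tangent_place.intro tangent_place_axioms.intro V(1) hermitian_projection_axioms) (use V m0 mu in auto)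
  then show thesis by (rule that)
qed

end

section \<open>The order of the Galois group\<close>

lemma pderiv_map_poly_to_ac: "pderiv (map_poly to_ac f) = map_poly to_ac (pderiv (f :: 'k::field poly))"
  by (rule poly_eqI) (simp add: coeff_pderiv coeff_map_poly)

context hermitian_projection
begin

text \<open>The \<open>q\<close> distinct solutions of \<open>x^q = x\<close> among the constants
  exhaust those in the larger field, where there are at most \<open>q\<close>.\<close>

lemma fixed_by_frobenius:
  assumes "c ^ q = (c :: 'c poly fract alg_closure)"
  obtains d :: 'c where "d ^ q = d" "c = cst d"
proof -
  define f where "f = [:0, 1 :: 'c:] ^ q - [:0, 1:]"
  have f0: "pderiv f = - 1"
    by (simp add: f_def pderiv_diff pderiv_power pderiv_pCons of_nat_q one_pCons)
  have "f \<noteq> 0" using f0 by auto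
  then have "rsquarefree f" by (rule rsquarefreeI) (simp add: f0)
  then have "card {d. poly f d = 0} = Polynomial.degree f" by (rule card_roots_rsquarefree)
  also have "Polynomial.degree f = q"
    unfolding f_def diff_conv_add_uminus using q_ge_2 by (subst degree_add_eq_left) (auto simp: degree_power_eq)
  finally have c1: "card {d :: 'c. d ^ q = d} = q" by (simp add: f_def)
  define g where "g = [:0, 1 :: 'c poly fract alg_closure:] ^ q - [:0, 1:]"
  have dg: "Polynomial.degree g = q"
    unfolding g_def diff_conv_add_uminus using q_ge_2 by (subst degree_add_eq_left) (auto simp: degree_power_eq)
  then have g0: "g \<noteq> 0" using q_ge_2 by auto
  have gset: "{x. poly g x = 0} = {x. x ^ q = x}" by (simp add: g_def)
  have fin: "finite {x :: 'c poly fract alg_closure. x ^ q = x}" using poly_roots_finite[OF g0] gset by simp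
  have le: "card {x :: 'c poly fract alg_closure. x ^ q = x} \<le> q"
    using card_poly_roots_bound[OF g0] dg gset by simp
  have sub: "cst ` {d :: 'c. d ^ q = d} \<subseteq> {x. x ^ q = x}" by (auto simp flip: cst_simps)
  have "inj_on cst {d :: 'c. d ^ q = d}" by (rule inj_onI) simp
  then have "card (cst ` {d :: 'c. d ^ q = d}) = q" using c1 by (simp add: card_image)
  then have "cst ` {d :: 'c. d ^ q = d} = {x. x ^ q = x}"
    using card_seteq[OF fin sub] le by simp
  then have "c \<in> cst ` {d :: 'c. d ^ q = d}" using assms by simp
  then show thesis using that by blast
qed

lemma card_roots_le: "finite {u. is_root u}" "card {u. is_root u} \<le> q + 1"
proof -
  have F0: "root_poly \<noteq> 0" using degree_root_poly by auto
  show "finite {u. is_root u}" "card {u. is_root u} \<le> q + 1"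
    using poly_roots_finite[OF F0] card_poly_roots_bound[OF F0] degree_root_poly roots_of_root_poly by simp_all
qed

section \<open>The polynomial \<open>Phi\<close> over the base field\<close>

definition "Rp = [:0, 1 :: 'c poly fract:] ^ q - [:0, 1:]"
definition "Np = Rp ^ (q - 1) + 1"
definition "Phi_poly = Polynomial.smult (Fraction_Field.Fract Dp 1 ^ q) (Np ^ (q + 1))
  + Polynomial.smult (Fraction_Field.Fract Ep 1 ^ (q + 1)) (Rp ^ (q * q - q))"

lemma ev_Rp: "ev Rp x = R x" and ev_Np: "ev Np x = N x"
  by (simp_all add: Rp_def Np_def R_def N_def)

lemma to_ac_DE: "to_ac (Fraction_Field.Fract Dp 1) = D" "to_ac (Fraction_Field.Fract Ep 1) = E"
  by (simp_all add: D_eq E_eq em_def[of Dp] em_def[of Ep])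

lemma ev_Phi_poly: "ev Phi_poly x = D ^ q * N x ^ (q + 1) + E ^ (q + 1) * R x ^ (q * q - q)"
  unfolding Phi_poly_def ev_simps ev_power ev_Rp ev_Np to_ac_power to_ac_DE ..

lemma Phi_poly_root: "ev Phi_poly x = 0 \<longleftrightarrow> Phi x"
  by (simp only: ev_Phi_poly Phi_def)

lemma dvd_Phi_poly_root:
  assumes "f dvd Phi_poly" "ev f r = 0"
  shows "Phi r"
proof -
  obtain s where s: "Phi_poly = f * s" using assms(1) by (elim dvdE)
  have "ev Phi_poly r = ev f r * ev s r" by (simp only: s ev_simps)
  then show ?thesis using assms(2) Phi_poly_root by simp
qed

lemma Phi_poly_nz: "Phi_poly \<noteq> 0"
proof
  assume "Phi_poly = 0"
  then have "Phi 0" using Phi_poly_root[of 0] by simp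
  then show False using Phi_nz(1)[of 0] q_ge_2 by (simp add: R_def power_0_left split: if_splits)
qed

text \<open>In characteristic \<open>p\<close> the derivative collapses to
  \<open>D^q * N^q * R^(q-2)\<close>, and neither \<open>R\<close> nor \<open>N\<close> vanishes at
  a root of \<open>Phi\<close>.\<close>

lemma rsquarefree_Phi_poly: "rsquarefree (map_poly to_ac Phi_poly)"
proof (rule rsquarefreeI)
  show "map_poly to_ac Phi_poly \<noteq> 0" using Phi_poly_nz by simp
  fix x assume "poly (map_poly to_ac Phi_poly) x = 0"
  then have P: "Phi x" using Phi_poly_root by (simp add: ev_def)
  have q1: "of_nat (q - 1) = (- 1 :: 'c poly fract)"
    using of_nat_q(2) q_ge_2 by (simp add: of_nat_diff)
  have "pderiv Rp = - 1"
    by (simp add: Rp_def pderiv_diff pderiv_power pderiv_pCons of_nat_q one_pCons)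
  then have "pderiv Np = Rp ^ (q - 2)"
    by (simp add: Np_def pderiv_add pderiv_power q1[unfolded One_nat_def] numeral_2_eq_2)
  then have N': "pderiv (Np ^ (q + 1)) = Np ^ q * Rp ^ (q - 2)"
    unfolding pderiv_power by (simp add: of_nat_q)
  have "of_nat (q * q - q) = (0 :: 'c poly fract)"
    using of_nat_q(2) by (simp add: of_nat_diff)
  then have "pderiv (Rp ^ (q * q - q)) = 0" unfolding pderiv_power by simp
  then have "pderiv Phi_poly = Polynomial.smult (Fraction_Field.Fract Dp 1 ^ q) (Np ^ q * Rp ^ (q - 2))"
    unfolding Phi_poly_def pderiv_add pderiv_smult N' by simp
  then have "ev (pderiv Phi_poly) x = D ^ q * (N x ^ q * R x ^ (q - 2))"
    by (simp only: ev_simps ev_power ev_Rp ev_Np to_ac_power to_ac_DE)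
  then show "poly (pderiv (map_poly to_ac Phi_poly)) x \<noteq> 0"
    using Phi_nz[OF P] D_nz by (simp add: pderiv_map_poly_to_ac ev_def)
qed

lemma degree_Phi_poly: "Polynomial.degree Phi_poly \<le> (q + 1) * (q * (q - 1))"
proof -
  have R: "Polynomial.degree Rp \<le> q"
    unfolding Rp_def using q_ge_2 by (intro degree_diff_le) (auto simp: degree_power_eq)
  have Rk: "Polynomial.degree (Rp ^ k) \<le> q * k" for k
    using degree_power_le[of Rp k] R by (meson mult_le_mono1 order_trans)
  have N: "Polynomial.degree Np \<le> q * (q - 1)"
    unfolding Np_def using Rk by (intro degree_add_le) auto
  have 1: "Polynomial.degree (Np ^ (q + 1)) \<le> (q + 1) * (q * (q - 1))"
    using degree_power_le[of Np "q + 1"] N by (metis mult.commute mult_le_mono2 order_trans)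
  have "q * (q * q - q) = q * (q * (q - 1))" by (simp add: diff_mult_distrib2)
  also have "\<dots> \<le> (q + 1) * (q * (q - 1))" by (rule mult_le_mono1) simp
  finally have 2: "Polynomial.degree (Rp ^ (q * q - q)) \<le> (q + 1) * (q * (q - 1))"
    using Rk[of "q * q - q"] by linarith
  show ?thesis unfolding Phi_poly_def
    by (intro degree_add_le order_trans[OF degree_smult_le] 1 2)
qed

lemma mob_in_simple_extension:
  assumes "c11 ^ q = c11" "c12 ^ q = c12" "c21 ^ q = c21" "c22 ^ q = c22"
  shows "mob c11 c12 c21 c22 w \<in> range (\<lambda>f. ev f w)"
proof -
  let ?M = "range (\<lambda>f. ev f w)"
  note M = type_subfieldD[OF simple_extension_subfield[of w]]
  have base: "to_ac c \<in> ?M" for c by (rule range_eqI[of _ _ "[:c:]"]) simp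
  have w: "w \<in> ?M" by (rule range_eqI[of _ _ "[:0, 1:]"]) simp
  have "c \<in> ?M" if c: "c ^ q = c" for c
  proof -
    obtain d where "c = cst d" using fixed_by_frobenius[OF c] .
    then show ?thesis using base by (simp add: em_def)
  qed
  then show ?thesis unfolding mob_def using assms w M by simp
qed

text \<open>Normality comes from \<open>Phi_roots_conjugate\<close>: the other roots of the minimal
  polynomial are Moebius transforms of \<open>w\<close> whose coefficients are constants.\<close>

lemma primitive_element_Phi:
  assumes "Phi w"
  obtains P where "primitive_element w P"
proof -
  obtain P where P: "Factorial_Ring.irreducible P" "ev P w = 0" "\<And>r. ev r w = 0 \<longleftrightarrow> P dvd r"
    using minimal_polynomial[of w] by blast
  have dvd: "P dvd Phi_poly" using P(3) Phi_poly_root assms by blast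
  have "primitive_element w P"
  proof
    fix r assume "ev P r = 0"
    then have "Phi r" by (rule dvd_Phi_poly_root[OF dvd])
    then show "r \<in> range (\<lambda>f. ev f w)"
      using Phi_roots_conjugate[OF assms] mob_in_simple_extension by blast
  next
    have "map_poly to_ac P dvd map_poly to_ac Phi_poly" using dvd by (auto elim!: dvdE)
    then show "rsquarefree (map_poly to_ac P)" using rsquarefree_dvd rsquarefree_Phi_poly by blast
  qed (use P in auto)
  then show thesis by (rule that)
qed

end

section \<open>Orbits, stabilizers and norms\<close>

locale hermitian_closure = tangent_place p n q a b V m0 \<mu> D' + primitive_element w P
  for p n q :: nat and a b :: "'c::alg_closed_field" and V m0 \<mu> D'
    and w :: "'c poly fract alg_closure" and P +
  assumes Phi_w: "Phi w"
begin

lemma P_dvd: "P dvd Phi_poly"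
  using irreducible_dvd_iff_ev[OF irr root] Phi_poly_root Phi_w by blast

lemma Z_Phi: "r \<in> Z \<Longrightarrow> Phi r"
  using dvd_Phi_poly_root[OF P_dvd] by (simp add: Z_def)

lemma base_in_M: "em f \<in> M" "D \<in> M" "E \<in> M"
proof -
  show *: "em f \<in> M" for f by (simp add: em_def to_ac_in)
  show "D \<in> M" "E \<in> M" unfolding D_eq E_eq by (rule *)+
qed

lemma galois_em: "\<sigma> \<in> G \<Longrightarrow> \<sigma> (em f) = em f"
  by (simp add: em_def galoisD)

lemma M_uw: "r \<in> M \<Longrightarrow> uw r \<in> M" "r \<in> M \<Longrightarrow> vw r \<in> M"
  unfolding uw_def vw_def Yw_def N_def R_def
  by (intro M_closed base_in_M | assumption)+

lemma galois_uw:
  assumes "\<sigma> \<in> G" "r \<in> M"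
  shows "\<sigma> (uw r) = uw (\<sigma> r)" "\<sigma> (vw r) = vw (\<sigma> r)"
proof -
  have "R r \<in> M" "N r \<in> M" unfolding N_def R_def using assms base_in_M by (auto intro!: M_closed)
  moreover have "\<sigma> (R r) = R (\<sigma> r)"
    using assms by (simp add: R_def galois_diff galois_power M_closed)
  moreover from this have "\<sigma> (N r) = N (\<sigma> r)"
    using assms \<open>R r \<in> M\<close> by (simp add: N_def galois_power galoisD M_closed)
  moreover have "\<sigma> D = D" "\<sigma> E = E" using galois_em[OF assms(1)] by (simp_all add: D_eq E_eq)
  ultimately have Y: "Yw r \<in> M" "\<sigma> (Yw r) = Yw (\<sigma> r)"
    unfolding Yw_def using assms base_in_M(2,3)
    by (simp_all add: galois_divide galois_power galoisD(3) M_closed)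
  show "\<sigma> (uw r) = uw (\<sigma> r)"
    unfolding uw_def using assms Y base_in_M galois_em[OF assms(1)] by (simp add: galois_diff galois_power M_closed)
  show "\<sigma> (vw r) = vw (\<sigma> r)"
    unfolding vw_def using assms Y base_in_M
    by (simp add: galois_diff galois_power galoisD(3,8) M_closed)
qed

lemma galois_triple:
  assumes "\<sigma> \<in> G"
  shows "triple (\<sigma> (uw w)) (\<sigma> (vw w)) (\<sigma> w)"
  unfolding galois_uw[OF assms theta_in] by (intro Phi_triple Z_Phi galois_theta assms)

lemma root_in_M:
  assumes "is_root x"
  shows "x \<in> M"
proof -
  obtain v' w' where t: "triple x v' w'" using exists_triple[OF assms] by blast
  then have "Phi w'" "x = uw w'" using triple_iff by auto
  moreover have "w' \<in> M"
    using Phi_roots_conjugate[OF Phi_w \<open>Phi w'\<close>] mob_in_simple_extension unfolding M_def by blast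
  ultimately show ?thesis using M_uw by simp
qed

lemma galois_root:
  assumes "\<sigma> \<in> G" "is_root x"
  shows "is_root (\<sigma> x)"
proof -
  have x: "x \<in> M" by (rule root_in_M[OF assms(2)])
  have "\<sigma> ((x + m ^ q) * (x ^ q + m)) = D"
    using assms(2) galois_em[OF assms(1)] unfolding is_root_iff' by (simp add: D_eq)
  then show ?thesis
    unfolding is_root_iff' using x base_in_M galois_em[OF assms(1)]
    by (simp add: galoisD(2,3)[OF assms(1)] galois_power[OF assms(1)] M_closed)
qed

definition "us = (SOME x. special x)"

lemma us: "special us" "is_root us" "us \<in> M"
proof -
  show "special us" unfolding us_def using exists_special by (rule someI_ex)
  then show "is_root us" by (simp add: special_def)
  then show "us \<in> M" by (rule root_in_M)
qed

lemma prod_valuation_dvd_base: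
  assumes I: "finite I" "S \<subseteq> I"
    and S: "\<And>i. i \<in> S \<Longrightarrow> \<exists>x\<in>units. z i ^ e = t * x"
    and U: "\<And>i. i \<in> I - S \<Longrightarrow> z i \<in> units"
    and base: "prod z I \<in> range to_ac" and e: "e > 0"
  shows "e dvd card S"
proof -
  have "z i \<noteq> 0" if "i \<in> I" for i
  proof (cases "i \<in> S")
    case True
    then obtain x where "x \<in> units" "z i ^ e = t * x" using S by blast
    then have "z i ^ e \<noteq> 0" using units_V(2) t_nz by auto
    then show ?thesis using e by auto
  qed (use U units_V(2) that in blast)
  then have "prod z I \<noteq> 0" using I by simp
  then obtain i j c c' where "c \<in> units" "c' \<in> units" "prod z I * t ^ j * c = t ^ i * c'"
    using base_decomp[OF base] by metis
  note c = this
  show ?thesis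
    by (rule prod_valuation_dvd[OF t_nonunit t_nz I _ _ c(3,1,2)]) (fact S, fact U)
qed

lemma conjs_special_all: "conjs us = {x. is_root x}" "card (conjs us) = q + 1"
proof -
  have sub: "conjs us \<subseteq> {x. is_root x}" using galois_root us by (auto simp: conjs_def)
  \<comment> \<open>The product runs over the orbit instead of the group: there each conjugate
    occurs once, so the divisibility concerns the size of the orbit itself.\<close>
  have "q dvd card (conjs us - {us})"
  proof (rule prod_valuation_dvd_base[of "conjs us" _ "\<lambda>x. x + cst \<mu>"])
    show "\<exists>e\<in>units. (x + cst \<mu>) ^ q = t * e" if x: "x \<in> conjs us - {us}" for x
      using nonspecial_facts(3)[of x] special_unique[OF us(1), of x] sub x by blast
    show "x + cst \<mu> \<in> units" if "x \<in> conjs us - (conjs us - {us})" for x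
      using that special_mu_unit us by auto
    have inM: "x + cst \<mu> \<in> M" if "x \<in> conjs us" for x
      using that conjs_subset us(3) base_in_M by (auto intro!: M_closed)
    show "(\<Prod>x\<in>conjs us. x + cst \<mu>) \<in> range to_ac"
    proof (rule fixed_in_base)
      fix \<sigma> assume s: "\<sigma> \<in> G"
      have "\<sigma> (\<Prod>x\<in>conjs us. x + cst \<mu>) = (\<Prod>x\<in>conjs us. \<sigma> (x + cst \<mu>))"
        using galois_prod[OF s, of "conjs us" "\<lambda>x. x + cst \<mu>"] inM by simp
      also have "\<dots> = (\<Prod>x\<in>conjs us. \<sigma> x + cst \<mu>)"
      proof (rule prod.cong)
        fix x assume "x \<in> conjs us"
        then have "x \<in> M" using conjs_subset us(3) by blast
        then show "\<sigma> (x + cst \<mu>) = \<sigma> x + cst \<mu>" using galoisD(2)[OF s] galois_em[OF s] base_in_M by simp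
      qed simp
      also have "\<dots> = (\<Prod>x\<in>conjs us. x + cst \<mu>)"
        using prod.reindex_bij_betw[OF galois_conjs[OF s us(3)], of "\<lambda>x. x + cst \<mu>"] by simp
      finally show "\<sigma> (\<Prod>x\<in>conjs us. x + cst \<mu>) = (\<Prod>x\<in>conjs us. x + cst \<mu>)" .
    next
      have "lift w \<in> G" using lift_in_G[of w] root by (simp add: Z_def)
      then show "(\<Prod>x\<in>conjs us. x + cst \<mu>) \<in> M"
        using galois_prod[of "lift w" "conjs us" "\<lambda>x. x + cst \<mu>"] inM by simp
    qed
  qed (use finite_conjs q_pos in auto)
  moreover have "us \<in> conjs us" by (rule self_in_conjs[OF us(3)])
  then have "card (conjs us) = Suc (card (conjs us - {us}))" using finite_conjs by (metis card.remove)
  moreover have "card (conjs us) \<le> q + 1" using card_mono[OF card_roots_le(1) sub] card_roots_le(2) by simp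
  moreover have "card (conjs us - {us}) \<noteq> 0"
  proof
    assume "card (conjs us - {us}) = 0"
    then have "conjs us \<subseteq> {us}" using finite_conjs by auto
    then have "us \<in> range to_ac"
      by (intro fixed_in_base us(3)) (auto simp: conjs_def)
    then show False using no_root_in_base us by blast
  qed
  ultimately show "card (conjs us) = q + 1" using dvd_imp_le[of q "card (conjs us - {us})"] by simp
  then show "conjs us = {x. is_root x}" using card_seteq[OF card_roots_le(1) sub] card_roots_le(2) by simp
qed

lemma root_uw: "is_root (uw w)"
  using Phi_triple(1)[OF Phi_w] by (simp add: triple_def)

text \<open>A coset of the stabilizer of \<open>uw w\<close>, not the stabilizer itself: the place
  singles out \<open>us\<close>, and these are the automorphisms at which the conjugates of
  \<open>z1\<close> and \<open>z2\<close> fail to be units.\<close>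

definition "S = {\<sigma> \<in> G. \<sigma> (uw w) = us}"

lemma special_iff_us: "special x \<longleftrightarrow> x = us"
  using special_unique us(1) by blast

lemma S_nonempty: "S \<noteq> {}"
proof -
  interpret G: group "galois_group M" by (rule group_G)
  have "uw w \<in> conjs us" using conjs_special_all root_uw by simp
  then obtain \<tau> where \<tau>: "\<tau> \<in> G" "uw w = \<tau> us" by (auto simp: conjs_def)
  define \<sigma> where "\<sigma> = inv\<^bsub>galois_group M\<^esub> \<tau>"
  have \<sigma>: "\<sigma> \<in> G" using \<tau>(1) by (simp add: \<sigma>_def)
  have "compose M \<sigma> \<tau> = (\<lambda>x\<in>M. x)"
    using G.l_inv[OF \<tau>(1)] galois_mult[OF \<sigma> \<tau>(1)] by (simp add: \<sigma>_def galois_group_simps(3))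
  then have "compose M \<sigma> \<tau> us = us" using us(3) by simp
  then have "\<sigma> (uw w) = us" using \<tau>(2) us(3) by (simp add: compose_eq)
  then show ?thesis using \<sigma> by (auto simp: S_def)
qed

text \<open>Composing \<open>S\<close> with automorphisms that move \<open>us\<close> to each of the
  \<open>q + 1\<close> roots gives disjoint sets, told apart by the image of
  \<open>uw w\<close>.\<close>

lemma card_S_le: "(q + 1) * card S \<le> card G"
proof -
  have "\<forall>y\<in>conjs us. \<exists>\<tau>\<in>G. \<tau> us = y" by (auto simp: conjs_def)
  then obtain \<tau> where \<tau>: "\<And>y. y \<in> conjs us \<Longrightarrow> \<tau> y \<in> G \<and> \<tau> y us = y" by metis
  define f where "f = (\<lambda>(y, \<sigma>). compose M (\<tau> y) \<sigma>)"
  have SG: "S \<subseteq> G" by (auto simp: S_def)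
  have uM: "uw w \<in> M" by (rule M_uw[OF theta_in])
  have val: "f (y, \<sigma>) (uw w) = y" if "y \<in> conjs us" "\<sigma> \<in> S" for y \<sigma>
    using that \<tau> uM by (auto simp: f_def compose_eq S_def)
  have "inj_on f (conjs us \<times> S)"
  proof (rule inj_onI, clarify)
    fix y \<sigma> y' \<sigma>' assume *: "y \<in> conjs us" "\<sigma> \<in> S" "y' \<in> conjs us" "\<sigma>' \<in> S" "f (y, \<sigma>) = f (y', \<sigma>')"
    then have "y = y'" using val by metis
    moreover have "inj_on (compose M (\<tau> y)) G" using bij_compose \<tau> * by (meson bij_betw_imp_inj_on)
    ultimately show "y = y' \<and> \<sigma> = \<sigma>'" using * SG by (auto simp: f_def inj_on_def)
  qed
  moreover have "f ` (conjs us \<times> S) \<subseteq> G"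
    using \<tau> SG galois_compose by (auto simp: f_def)
  ultimately have "card (conjs us \<times> S) \<le> card G" using finite_G by (rule card_inj_on_le)
  then show ?thesis using conjs_special_all(2) by (simp add: card_cartesian_product)
qed

lemma norm_in_base:
  assumes "z \<in> M"
  shows "(\<Prod>\<sigma>\<in>G. \<sigma> z) \<in> range to_ac"
proof (rule fixed_in_base)
  have "lift w \<in> G" using lift_in_G[of w] root by (simp add: Z_def)
  then show "(\<Prod>\<sigma>\<in>G. \<sigma> z) \<in> M"
    using galois_prod[of "lift w" G "\<lambda>\<sigma>. \<sigma> z"] galoisD(1)[OF _ assms] by simp
qed (rule galois_prod_orbit[OF _ assms])

text \<open>These are the norms of \<open>z1 w\<close> and \<open>z2 (uw w) (vw w)\<close>. An
  automorphism carries a triple to a triple, so the factor at \<open>\<sigma>\<close> is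
  \<open>z1\<close> or \<open>z2\<close> of a triple whose first entry is special exactly for
  \<open>\<sigma>\<close> in \<open>S\<close>.\<close>

lemma card_S_dvd: "q - 1 dvd card S" "q dvd card S"
proof -
  have SG: "S \<subseteq> G" by (auto simp: S_def)
  have uM: "uw w \<in> M" "vw w \<in> M" using M_uw[OF theta_in] by auto
  show "q - 1 dvd card S"
  proof (rule prod_valuation_dvd_base[OF finite_G SG, of "\<lambda>\<sigma>. \<sigma> (z1 w)"])
    have zM: "z1 w \<in> M" unfolding z1_def by (intro M_closed theta_in base_in_M)
    have z: "\<sigma> (z1 w) = z1 (\<sigma> w)" if "\<sigma> \<in> G" for \<sigma>
      unfolding z1_def using that theta_in base_in_M galois_em[OF that]
      by (simp add: galois_divide galois_diff galoisD(8) M_closed)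
    show "\<exists>x\<in>units. \<sigma> (z1 w) ^ (q - 1) = t * x" if "\<sigma> \<in> S" for \<sigma>
      using that SG z special_z1[OF galois_triple] us(1) by (auto simp: S_def)
    show "\<sigma> (z1 w) \<in> units" if "\<sigma> \<in> G - S" for \<sigma>
      using that z nonspecial_z1[OF galois_triple] special_iff_us by (auto simp: S_def)
    show "(\<Prod>\<sigma>\<in>G. \<sigma> (z1 w)) \<in> range to_ac"
      by (rule norm_in_base[OF zM])
  qed (rule q_pos)
  show "q dvd card S"
  proof (rule prod_valuation_dvd_base[OF finite_G SG, of "\<lambda>\<sigma>. \<sigma> (z2 (uw w) (vw w))"])
    have zM: "z2 (uw w) (vw w) \<in> M" unfolding z2_def by (intro M_closed uM base_in_M)
    have z: "\<sigma> (z2 (uw w) (vw w)) = z2 (\<sigma> (uw w)) (\<sigma> (vw w))" if "\<sigma> \<in> G" for \<sigma>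
      unfolding z2_def using that uM base_in_M galois_em[OF that]
      by (simp add: galois_power galoisD(2,3) M_closed)
    show "\<exists>x\<in>units. \<sigma> (z2 (uw w) (vw w)) ^ q = t * x" if "\<sigma> \<in> S" for \<sigma>
      using that SG z special_z2[OF galois_triple] us(1) by (auto simp: S_def)
    show "\<sigma> (z2 (uw w) (vw w)) \<in> units" if "\<sigma> \<in> G - S" for \<sigma>
      using that z nonspecial_z2[OF galois_triple] special_iff_us by (auto simp: S_def)
    show "(\<Prod>\<sigma>\<in>G. \<sigma> (z2 (uw w) (vw w))) \<in> range to_ac"
      by (rule norm_in_base[OF zM])
  qed (rule q_pos)
qed

text \<open>The coprime divisors \<open>q\<close> and \<open>q - 1\<close> of \<open>card S\<close>
  push the degree of \<open>P\<close> up to the degree bound of \<open>Phi_poly\<close>, so the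
  cofactor is constant.\<close>

lemma Phi_irreducible: "Phi r \<Longrightarrow> r \<in> Z"
proof -
  assume r: "Phi r"
  have "coprime q (q - 1)" using q_pos by (metis Suc_diff_1 coprime_Suc_left_nat)
  then have "q * (q - 1) dvd card S" using card_S_dvd by (intro divides_mult)
  moreover have "card S > 0" using S_nonempty finite_subset[OF _ finite_G, of S] by (auto simp: S_def card_gt_0_iff)
  ultimately have "q * (q - 1) \<le> card S" by (rule dvd_imp_le)
  then have "(q + 1) * (q * (q - 1)) \<le> card G" using card_S_le by (meson mult_le_mono2 order_trans)
  then have deg: "Polynomial.degree Phi_poly \<le> Polynomial.degree P" using degree_Phi_poly card_G by simp
  obtain s where s: "Phi_poly = P * s" using P_dvd by (elim dvdE)
  have "s \<noteq> 0" using s Phi_poly_nz by auto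
  then have "Polynomial.degree s = 0" using deg P_nz unfolding s by (simp add: degree_mult_eq)
  then obtain c where "s = [:c:]" by (metis degree_eq_zeroE)
  then have "ev s r \<noteq> 0" using \<open>s \<noteq> 0\<close> by simp
  then show "r \<in> Z" using r Phi_poly_root[of r] s by (simp add: Z_def)
qed

lemma roots_conjugate:
  assumes "is_root x" "is_root y"
  obtains \<sigma> where "\<sigma> \<in> G" "\<sigma> x = y"
proof -
  interpret G: group "galois_group M" by (rule group_G)
  have xy: "x \<in> conjs us" "y \<in> conjs us" using conjs_special_all(1) assms by simp_all
  obtain \<sigma> where \<sigma>: "\<sigma> \<in> G" "\<sigma> us = x" using xy(1) unfolding conjs_def by blast
  obtain \<tau> where \<tau>: "\<tau> \<in> G" "\<tau> us = y" using xy(2) unfolding conjs_def by blast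
  define \<rho> where "\<rho> = inv\<^bsub>galois_group M\<^esub> \<sigma>"
  have \<rho>: "\<rho> \<in> G" using \<sigma>(1) by (simp add: \<rho>_def)
  have "compose M \<rho> \<sigma> = (\<lambda>x\<in>M. x)"
    using G.l_inv[OF \<sigma>(1)] galois_mult[OF \<rho> \<sigma>(1)] by (simp add: \<rho>_def galois_group_simps(3))
  then have "compose M \<rho> \<sigma> us = us" using us(3) by simp
  then have "\<rho> x = us" using \<sigma>(2) us(3) by (simp add: compose_eq)
  then have "compose M \<tau> \<rho> x = y" using \<tau>(2) root_in_M[OF assms(1)] by (simp add: compose_eq)
  then show thesis using that galois_compose[OF \<tau>(1) \<rho>] by blast
qed

end

section \<open>The projective linear group\<close>

unbundle no fps_syntax

lemma GL_simps:
  "carrier (GL F) = {A. (\<forall>i j. A $ i $ j \<in> F) \<and> det A \<noteq> 0}" "monoid.mult (GL F) = (**)" "\<one>\<^bsub>GL F\<^esub> = mat 1"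
  by (simp_all add: GL_def)

lemma mat_mult_2:
  fixes A B :: "'a::field^2^2"
  shows "(A ** B) $ i $ j = A $ i $ 1 * B $ 1 $ j + A $ i $ 2 * B $ 2 $ j"
  by (simp add: matrix_matrix_mult_def sum_2)

lemma group_GL2:
  fixes F :: "'a::field set"
  assumes F: "type_subfield F"
  shows "group (GL F :: ('a^2^2) monoid)"
proof (rule groupI)
  note Fc = type_subfieldD[OF F]
  show "\<one>\<^bsub>GL F\<^esub> \<in> carrier (GL F :: ('a^2^2) monoid)" using Fc by (simp add: GL_simps) (simp add: mat_def)
  fix A assume "A \<in> carrier (GL F :: ('a^2^2) monoid)"
  then have A: "\<And>i j. A $ i $ j \<in> F" "det A \<noteq> 0" by (auto simp: GL_simps)
  show "\<one>\<^bsub>GL F\<^esub> \<otimes>\<^bsub>GL F\<^esub> A = A" by (simp add: GL_simps)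
  show "A \<otimes>\<^bsub>GL F\<^esub> B \<in> carrier (GL F)" if "B \<in> carrier (GL F)" for B
    using that A by (auto simp: GL_simps mat_mult_2 det_mul intro!: Fc)
  define d where "d = det A"
  have d: "d \<noteq> 0" "d = A $ 1 $ 1 * A $ 2 $ 2 - A $ 1 $ 2 * A $ 2 $ 1" "d \<in> F"
    using A by (simp_all add: d_def det_2 Fc)
  define B :: "'a^2^2" where "B = (\<chi> i j. if i = 1 then (if j = 1 then A $ 2 $ 2 / d else - A $ 1 $ 2 / d)
      else (if j = 1 then - A $ 2 $ 1 / d else A $ 1 $ 1 / d))"
  have BF: "B $ i $ j \<in> F" for i j
    using A(1) d(3) by (simp add: B_def Fc)
  have "(B ** A) $ 1 $ 1 = 1" "(B ** A) $ 1 $ 2 = 0" "(B ** A) $ 2 $ 1 = 0" "(B ** A) $ 2 $ 2 = 1"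
    using d(1) unfolding mat_mult_2
    by (simp_all add: B_def add_divide_distrib[symmetric] diff_divide_distrib[symmetric] d(2)[symmetric] mult.commute)
  then have BA: "B ** A = mat 1"
    unfolding vec_eq_iff forall_2 by (simp add: mat_def)
  then have "det B * det A = 1" by (metis det_I det_mul)
  then have "det B \<noteq> 0" by auto
  then show "\<exists>B\<in>carrier (GL F). B \<otimes>\<^bsub>GL F\<^esub> A = \<one>\<^bsub>GL F\<^esub>"
    using BF BA by (auto simp: GL_simps)
qed (simp add: GL_simps matrix_mul_assoc)

lemma subfield_power_card:
  fixes F :: "'a::field set"
  assumes F: "type_subfield F" and fin: "finite F" and x: "x \<in> F"
  shows "x ^ card F = x"
proof (cases "x = 0")
  case True
  have "card F > 0" using fin x by (auto simp: card_gt_0_iff)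
  then show ?thesis using True by simp
next
  case False
  note Fc = type_subfieldD[OF F]
  let ?U = "F - {0}"
  have sub: "(\<lambda>y. x * y) ` ?U \<subseteq> ?U" using x False Fc(5) by auto
  have inj: "inj_on (\<lambda>y. x * y) ?U" using False by (simp add: inj_on_def)
  have "(\<lambda>y. x * y) ` ?U = ?U" by (rule endo_inj_surj[OF _ sub inj]) (simp add: fin)
  then have "(\<Prod>y\<in>?U. y) = (\<Prod>y\<in>?U. x * y)" using prod.reindex[OF inj, of "\<lambda>y. y"] by simp
  also have "\<dots> = x ^ card ?U * (\<Prod>y\<in>?U. y)" by (simp add: prod.distrib)
  finally have "x ^ card ?U = 1" using fin by simp
  moreover have "card F = Suc (card ?U)" by (rule card.remove[OF fin Fc(1)])
  ultimately show ?thesis by simp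
qed

lemma subfield_eq_fixed_points:
  fixes F :: "'a::field set"
  assumes F: "type_subfield F" and card: "card F = k" and k: "k > 1"
  shows "F = {x. x ^ k = x}" "finite {x :: 'a. x ^ k = x}"
proof -
  have fin: "finite F" using card k by (metis card.infinite not_one_less_zero)
  define f where "f = [:0, 1 :: 'a:] ^ k - [:0, 1:]"
  have d: "Polynomial.degree f = k"
    unfolding f_def diff_conv_add_uminus using k by (subst degree_add_eq_left) (auto simp: degree_power_eq)
  then have f0: "f \<noteq> 0" using k by auto
  have s: "{x. poly f x = 0} = {x. x ^ k = x}" by (simp add: f_def)
  show fin': "finite {x :: 'a. x ^ k = x}" using poly_roots_finite[OF f0] s by simp
  have "F \<subseteq> {x. x ^ k = x}" using subfield_power_card[OF F fin] card by auto
  then show "F = {x. x ^ k = x}"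
    using card_seteq[OF fin'] card_poly_roots_bound[OF f0] s d card by simp
qed

text \<open>Translation by \<open>1\<close> permutes the ring, so the sum of all elements is
  unchanged when \<open>of_nat CARD('a)\<close> is added.\<close>

lemma of_nat_CARD_eq_0: "of_nat CARD('a) = (0 :: 'a::{ring_1,finite})"
proof -
  have "bij_betw (\<lambda>x :: 'a. x + 1) UNIV UNIV"
    by (rule bij_betw_byWitness[where f' = "\<lambda>x. x - 1"]) auto
  then have "(\<Sum>x\<in>UNIV. x + 1) = (\<Sum>x\<in>UNIV. x :: 'a)"
    by (rule sum.reindex_bij_betw)
  then show ?thesis by (simp add: sum.distrib)
qed

context hermitian_closure
begin

lemma galois_mob:
  assumes "\<sigma> \<in> G" "r \<in> M" "c11 ^ q = c11" "c12 ^ q = c12" "c21 ^ q = c21" "c22 ^ q = c22"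
  shows "\<sigma> (mob c11 c12 c21 c22 r) = mob c11 c12 c21 c22 (\<sigma> r)"
proof -
  have "c \<in> M \<and> \<sigma> c = c" if c: "c ^ q = c" for c
  proof -
    obtain d where "c = cst d" using fixed_by_frobenius[OF c] .
    then show ?thesis using base_in_M galois_em[OF assms(1)] by simp
  qed
  then show ?thesis unfolding mob_def using assms
    by (simp add: galois_divide galoisD(2,3) M_closed)
qed

lemma galois_eq_lift: "\<sigma> \<in> G \<Longrightarrow> \<sigma> w = r \<Longrightarrow> r \<in> Z \<Longrightarrow> lift r = \<sigma>"
  using galois_eqI[OF lift_in_G, of r \<sigma>] lift_theta by simp

lemma one_lift: "lift w = \<one>\<^bsub>galois_group M\<^esub>"
proof -
  have "\<one>\<^bsub>galois_group M\<^esub> \<in> G" using group_G by (simp add: group.is_monoid monoid.one_closed)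
  moreover have "\<one>\<^bsub>galois_group M\<^esub> w = w" by (simp add: galois_group_simps(3) theta_in)
  ultimately show ?thesis using galois_eq_lift[of _ w] root by (simp add: Z_def)
qed

text \<open>\<open>F\<close> may live in another type than the fixed field of the
  \<open>q\<close>-power map; \<open>e\<close> identifies the two. Irreducibility of
  \<open>Phi\<close> lets every matrix define an automorphism, \<open>Phi_roots_conjugate\<close>
  gives surjectivity, and \<open>mob_fixed\<close> gives the scalar kernel.\<close>

theorem galois_group_iso_PGL2:
  fixes F :: "'b::field set" and e :: "'b \<Rightarrow> 'c poly fract alg_closure"
  assumes F: "type_subfield F" and e_add: "\<And>x y. e (x + y) = e x + e y"
    and e_mult: "\<And>x y. e (x * y) = e x * e y" and e_1: "e 1 = 1"
    and e_F: "e ` F = {c. c ^ q = c}"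
  shows "galois_group M \<cong> PGL2 F"
proof -
  note Fc = type_subfieldD[OF F]
  have e_0: "e 0 = 0" using e_add[of 0 0] by (metis add.right_neutral add_left_cancel)
  have e_diff: "e (x - y) = e x - e y" for x y using e_add[of "x - y" y] by (simp add: algebra_simps)
  have e_nz: "e x \<noteq> 0" if "x \<noteq> 0" for x using e_mult[of x "inverse x"] that e_1 by auto
  have e_inj: "e x = e y \<longleftrightarrow> x = y" for x y using e_nz[of "x - y"] e_diff[of x y] by auto
  have e_q: "e x ^ q = e x" if "x \<in> F" for x using e_F that by auto
  define mb where "mb = (\<lambda>(A :: 'b^2^2) r. mob (e (A $ 1 $ 1)) (e (A $ 1 $ 2)) (e (A $ 2 $ 1)) (e (A $ 2 $ 2)) r)"
  define \<psi> where "\<psi> = (\<lambda>A. lift (mb A w))"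
  let ?GL = "GL F :: ('b^2^2) monoid"
  have GLD: "e (A $ i $ j) ^ q = e (A $ i $ j)"
    "e (A $ 1 $ 1) * e (A $ 2 $ 2) - e (A $ 1 $ 2) * e (A $ 2 $ 1) \<noteq> 0" if "A \<in> carrier ?GL" for A :: "'b^2^2" and i j
  proof -
    show "e (A $ i $ j) ^ q = e (A $ i $ j)" using that e_q by (simp add: GL_simps)
    have "e (det A) \<noteq> 0" using that e_nz by (simp add: GL_simps)
    then show "e (A $ 1 $ 1) * e (A $ 2 $ 2) - e (A $ 1 $ 2) * e (A $ 2 $ 1) \<noteq> 0"
      by (simp add: det_2 e_diff e_mult)
  qed
  have mbZ: "mb A w \<in> Z" if "A \<in> carrier ?GL" for A
    unfolding mb_def by (intro Phi_irreducible Phi_mob Phi_w GLD that)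
  have \<psi>G: "\<psi> A \<in> G" "\<psi> A w = mb A w" if "A \<in> carrier ?GL" for A
    unfolding \<psi>_def using lift_in_G lift_theta mbZ[OF that] by auto
  interpret GL: group ?GL by (rule group_GL2[OF F])
  interpret H: group "galois_group M" by (rule group_G)
  have hom: "\<psi> \<in> hom ?GL (galois_group M)"
  proof (rule homI)
    fix A B assume AB: "A \<in> carrier ?GL" "B \<in> carrier ?GL"
    have C: "A \<otimes>\<^bsub>?GL\<^esub> B \<in> carrier ?GL" using AB by simp
    have m: "(A \<otimes>\<^bsub>?GL\<^esub> B) $ i $ j = A $ i $ 1 * B $ 1 $ j + A $ i $ 2 * B $ 2 $ j" for i j
      by (simp add: GL_simps mat_mult_2)
    have l0: "e (A $ 1 $ 1) + w * e (A $ 2 $ 1) \<noteq> 0"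
      by (rule R_nz_not_linear[OF Phi_nz(1)[OF Phi_w] GLD(1)[OF AB(1)] GLD(1)[OF AB(1)]])
        (use GLD(2)[OF AB(1)] in auto)
    have "compose M (\<psi> A) (\<psi> B) w = \<psi> A (mb B w)" using \<psi>G[OF AB(2)] theta_in by (simp add: compose_eq)
    \<comment> \<open>\<open>\<psi> A\<close> fixes the coefficients of \<open>mb B\<close> and so
      acts on its argument only; composition thus puts \<open>A\<close> to the left of
      \<open>B\<close>, as in \<open>mob_mob\<close>.\<close>
    also have "\<dots> = mb B (\<psi> A w)"
      unfolding mb_def by (rule galois_mob[OF \<psi>G(1)[OF AB(1)] theta_in]) (rule GLD(1)[OF AB(2)])+
    also have "\<dots> = mb B (mb A w)" using \<psi>G[OF AB(1)] by simp
    also have "\<dots> = mb (A \<otimes>\<^bsub>?GL\<^esub> B) w"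
      unfolding mb_def mob_mob[OF l0] m e_add e_mult ..
    finally have "lift (mb (A \<otimes>\<^bsub>?GL\<^esub> B) w) = compose M (\<psi> A) (\<psi> B)"
      by (intro galois_eq_lift galois_compose \<psi>G AB mbZ[OF C])
    then show "\<psi> (A \<otimes>\<^bsub>?GL\<^esub> B) = \<psi> A \<otimes>\<^bsub>galois_group M\<^esub> \<psi> B"
      using galois_mult[OF \<psi>G(1)[OF AB(1)] \<psi>G(1)[OF AB(2)]] by (simp add: \<psi>_def)
  qed (rule \<psi>G)
  interpret gh: group_hom ?GL "galois_group M" \<psi>
    by (intro group_hom.intro group_hom_axioms.intro hom GL.group_axioms H.group_axioms)
  have surj: "\<psi> ` carrier ?GL = G"
  proof
    show "\<psi> ` carrier ?GL \<subseteq> G" using \<psi>G by auto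
    show "G \<subseteq> \<psi> ` carrier ?GL"
    proof
      fix \<sigma> assume s: "\<sigma> \<in> G"
      then have "Phi (\<sigma> w)" using galois_theta Z_Phi by blast
      then obtain c11 c12 c21 c22 where c: "c11 ^ q = c11" "c12 ^ q = c12" "c21 ^ q = c21" "c22 ^ q = c22"
        "c11 * c22 - c12 * c21 \<noteq> 0" "\<sigma> w = mob c11 c12 c21 c22 w"
        using Phi_roots_conjugate[OF Phi_w] by blast
      have ex: "\<exists>x\<in>F. c = e x" if "c ^ q = c" for c using that e_F by blast
      obtain x11 x12 x21 x22 where x: "x11 \<in> F" "x12 \<in> F" "x21 \<in> F" "x22 \<in> F"
        "c11 = e x11" "c12 = e x12" "c21 = e x21" "c22 = e x22"
        using ex[OF c(1)] ex[OF c(2)] ex[OF c(3)] ex[OF c(4)] by blast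
      define A :: "'b^2^2" where "A = (\<chi> i j. if i = 1 then (if j = 1 then x11 else x12) else (if j = 1 then x21 else x22))"
      have A: "A $ 1 $ 1 = x11" "A $ 1 $ 2 = x12" "A $ 2 $ 1 = x21" "A $ 2 $ 2 = x22" by (simp_all add: A_def)
      have "e (det A) \<noteq> 0" using c(5) by (simp add: det_2 A e_diff e_mult x)
      then have "det A \<noteq> 0" using e_0 by metis
      then have Ac: "A \<in> carrier ?GL" using x by (simp add: GL_simps A_def)
      have "mb A w = \<sigma> w" using c(6) by (simp add: mb_def A x)
      then have "\<psi> A = \<sigma>" unfolding \<psi>_def using galois_eq_lift[OF s] mbZ[OF Ac] by simp
      then show "\<sigma> \<in> \<psi> ` carrier ?GL" using Ac by blast
    qed
  qed
  have ker: "kernel ?GL (galois_group M) \<psi> = {mat c |c. c \<in> F \<and> c \<noteq> 0}"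
  proof
    show "kernel ?GL (galois_group M) \<psi> \<subseteq> {mat c |c. c \<in> F \<and> c \<noteq> 0}"
    proof
      fix A assume "A \<in> kernel ?GL (galois_group M) \<psi>"
      then have A: "A \<in> carrier ?GL" "\<psi> A = \<one>\<^bsub>galois_group M\<^esub>" by (auto simp: kernel_def)
      then have "mb A w = w" using \<psi>G(2)[OF A(1)] theta_in by (simp add: galois_group_simps(3))
      then have "e (A $ 1 $ 2) = 0 \<and> e (A $ 2 $ 1) = 0 \<and> e (A $ 1 $ 1) = e (A $ 2 $ 2)"
        unfolding mb_def by (intro mob_fixed[OF Phi_w] GLD A)
      then have eq: "A $ 1 $ 2 = 0" "A $ 2 $ 1 = 0" "A $ 2 $ 2 = A $ 1 $ 1" using e_inj e_0 by metis+
      have "A = mat (A $ 1 $ 1)" unfolding vec_eq_iff forall_2 by (simp add: mat_def eq)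
      moreover have "A $ 1 $ 1 \<in> F" "A $ 1 $ 1 \<noteq> 0" using A(1) eq by (auto simp: GL_simps det_2)
      ultimately show "A \<in> {mat c |c. c \<in> F \<and> c \<noteq> 0}" by blast
    qed
    show "{mat c |c. c \<in> F \<and> c \<noteq> 0} \<subseteq> kernel ?GL (galois_group M) \<psi>"
    proof
      fix A :: "'b^2^2" assume "A \<in> {mat c |c. c \<in> F \<and> c \<noteq> 0}"
      then obtain c where c: "A = mat c" "c \<in> F" "c \<noteq> 0" by blast
      have A: "A $ 1 $ 1 = c" "A $ 1 $ 2 = 0" "A $ 2 $ 1 = 0" "A $ 2 $ 2 = c" by (simp_all add: c mat_def)
      have "A \<in> carrier ?GL" using c Fc(1) by (simp add: GL_simps det_2 mat_def)
      moreover have "mb A w = w" using e_nz[OF c(3)] by (simp add: mb_def A e_0 mob_def)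
      ultimately show "A \<in> kernel ?GL (galois_group M) \<psi>" by (simp add: kernel_def \<psi>_def one_lift)
    qed
  qed
  have "?GL Mod kernel ?GL (galois_group M) \<psi> \<cong> galois_group M" by (rule gh.FactGroup_iso[OF surj])
  moreover have "group (?GL Mod kernel ?GL (galois_group M) \<psi>)"
    by (rule normal.factorgroup_is_group[OF gh.normal_kernel])
  ultimately have "galois_group M \<cong> ?GL Mod kernel ?GL (galois_group M) \<psi>" by (metis group.iso_sym)
  then show ?thesis unfolding ker PGL_def .
qed

section \<open>The Galois closure and its generators\<close>

lemma field_gen_eq_M: "field_gen (range cst \<union> {m, uw w, vw w, w}) = M"
proof
  let ?F = "field_gen (range cst \<union> {m, uw w, vw w, w})"
  show "?F \<subseteq> M"
    by (rule field_gen_props(3)[OF M_subfield]) (use base_in_M M_uw theta_in in auto)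
  note Fc = type_subfieldD[OF field_gen_props(1)[of "range cst \<union> {m, uw w, vw w, w}"]]
  have gen: "cst c \<in> ?F" "m \<in> ?F" "w \<in> ?F" for c
    using subsetD[OF field_gen_props(2)[of "range cst \<union> {m, uw w, vw w, w}"]] by simp_all
  have em: "em f \<in> ?F" for f
  proof (induction f)
    case (pCons c f)
    show ?case unfolding em_pCons[of c f] by (intro Fc gen pCons.IH)
  next
    case 0
    show ?case unfolding em_simps by (rule Fc(1))
  qed
  have base: "x \<in> ?F" if x: "x \<in> range to_ac" for x
  proof -
    obtain A B where "x = em A / em B" by (rule base_cases[OF x])
    then show ?thesis using Fc(6)[OF em em] by simp
  qed
  have "ev f w \<in> ?F" for f
  proof (induction f)
    case (pCons c f)
    show ?case unfolding ev_simps by (intro Fc gen base rangeI pCons.IH)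
  next
    case 0
    show ?case unfolding ev_simps by (rule Fc(1))
  qed
  then show "M \<subseteq> ?F" by (auto simp: M_def)
qed

text \<open>A normal extension containing \<open>uw w\<close> contains all roots, by transitivity of
  the group, and three of them determine \<open>w\<close>.\<close>

lemma galois_closure_M: "is_galois_closure (field_gen (range to_ac \<union> {uw w})) M"
  unfolding is_galois_closure_def
proof (intro conjI allI impI)
  show "galois_extension M" by (rule galois_extension_M)
  show "field_gen (range to_ac \<union> {uw w}) \<subseteq> M"
    by (rule field_gen_props(3)[OF M_subfield]) (use base M_uw theta_in in auto)
  fix N assume N: "galois_extension N \<and> field_gen (range to_ac \<union> {uw w}) \<subseteq> N"
  then have sub: "type_subfield N" "range to_ac \<subseteq> N" and nor: "normal_extension N"
    by (auto simp: galois_extension_def)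
  note Nc = type_subfieldD[OF sub(1)]
  have u: "uw w \<in> N" using N field_gen_props(2)[of "range to_ac \<union> {uw w}"] by blast
  obtain f where f: "Factorial_Ring.irreducible f" "ev f (uw w) = 0" using minimal_polynomial[of "uw w"] by blast
  have rootsN: "x \<in> N" if x: "is_root x" for x
  proof -
    obtain \<sigma> where s: "\<sigma> \<in> G" "\<sigma> (uw w) = x" using roots_conjugate[OF root_uw x] .
    have "ev f x = \<sigma> (ev f (uw w))" using galois_ev[OF s(1) M_uw(1)[OF theta_in]] s(2) by simp
    then have "ev f x = 0" using f(2) galoisD(7)[OF s(1)] by simp
    then show ?thesis using nor f u unfolding normal_extension_def root_in_closure_def ev_def by blast
  qed
  note t = Phi_triple(1)[OF Phi_w]
  note tf = triple_facts[OF t]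
  have w1: "w + 1 \<noteq> 0" using R_nz_not_linear[OF tf(3), of 1 1] by (simp add: add.commute)
  \<comment> \<open>Besides \<open>uw w\<close>, the roots of \<open>other_root\<close> for
    \<open>l = 0\<close> and \<open>l = 1\<close> are used. They differ from \<open>uw w\<close> by
    \<open>vw w\<close> and \<open>T\<close>, and \<open>T / (vw w - T)\<close> is
    \<open>w\<close>.\<close>
  define T where "T = vw w * w / (w + 1)"
  have "uw w + vw w \<in> N" using rootsN other_root[OF t, of 0] tf(5) q_pos by simp
  then have vN: "vw w \<in> N" using Nc(4)[OF _ u, of "uw w + vw w"] by simp
  have "uw w + T \<in> N" unfolding T_def by (intro rootsN other_root[OF t]) simp
  then have TN: "T \<in> N" using Nc(4)[OF _ u, of "uw w + T"] by simp
  have "(vw w - T) * w = T" using w1 by (simp add: T_def field_simps)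
  moreover have "vw w - T \<noteq> 0" using w1 tf(6) by (simp add: T_def field_simps)
  ultimately have "w = T / (vw w - T)" by (simp add: field_simps)
  then have wN: "w \<in> N" using Nc(6)[OF TN Nc(4)[OF vN TN]] by simp
  show "M \<subseteq> N"
  proof
    fix x assume "x \<in> M"
    then obtain g where g: "x = ev g w" by (auto simp: M_def)
    have "ev g w \<in> N"
    proof (induction g)
      case (pCons c g)
      have "to_ac c \<in> N" using sub(2) by blast
      then show ?case unfolding ev_simps by (intro Nc wN pCons.IH)
    qed (simp add: Nc)
    then show "x \<in> N" using g by simp
  qed
qed

end

lemma (in hermitian_projection) hermitian_closure_of_triple:
  assumes "triple u v w"
  obtains V m0 \<mu> D' P where "hermitian_closure p n q a b V m0 \<mu> D' w P" "u = uw w" "v = vw w"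
proof -
  obtain V m0 \<mu> D' where V: "tangent_place p n q a b V m0 \<mu> D'" by (rule exists_tangent_place)
  have P: "Phi w" "u = uw w" "v = vw w" using assms triple_iff by auto
  obtain P where "primitive_element w P" using primitive_element_Phi[OF P(1)] .
  then have "hermitian_closure p n q a b V m0 \<mu> D' w P"
    using V P by (intro hermitian_closure.intro hermitian_closure_axioms.intro)
  then show thesis using that P by blast
qed

theorem mainTheorem3:
  fixes q r :: nat
    and a b :: "'f::{field,finite}"
    and Fq Fq2 :: "'f set"
    and m \<alpha> \<beta> u :: "'f geom_ratfun alg_closure"
    and K L :: "'f geom_ratfun alg_closure set"
  assumes "primepow q" and "r \<ge> 1" and "CARD('f) = q ^ (2 * r)"
    and "type_subfield Fq" and "card Fq = q"
    and "type_subfield Fq2" and "card Fq2 = q ^ 2"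
    and "\<not> (a \<in> Fq2 \<and> b \<in> Fq2)"
    and "a ^ (q + 1) + b ^ q + b \<noteq> 0"
    and "m = indet" and "\<alpha> = const (to_ac a)" and "\<beta> = const (to_ac b)"
    and "K = range to_ac"
    and "u ^ (q + 1) + u ^ q * m ^ q + u * m - ((m * \<alpha> - \<beta>) ^ q + m * \<alpha> - \<beta>) = 0"
    and "L = field_gen (K \<union> {u})"
  shows "geometric_monodromy_group L \<cong> PGL2 Fq \<and>
    (\<exists>v w. v ^ q + (u + m ^ q) * v ^ (q - 1) + u ^ q + m = 0 \<and>
           v + u + m ^ q - (u + m ^ q) * w ^ (q - 1) = 0) \<and>
    (\<forall>v w. v ^ q + (u + m ^ q) * v ^ (q - 1) + u ^ q + m = 0 \<and>
           v + u + m ^ q - (u + m ^ q) * w ^ (q - 1) = 0 \<longrightarrow>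
       is_galois_closure L (field_gen (range const \<union> {m, u, v, w})))"
proof -
  obtain p n where pn: "Factorial_Ring.prime p" "n > 0" "q = p ^ n"
    using assms(1) by (auto simp: primepow_def)
  have q1: "q > 1" using primepow_gt_Suc_0[OF assms(1)] by simp
  have "of_nat (q ^ (2 * r)) = (0 :: 'f)"
    unfolding assms(3)[symmetric] by (rule of_nat_CARD_eq_0)
  then have "of_nat p = (0 :: 'f)" by (simp add: pn(3))
  then have charp: "of_nat p = (0 :: 'f alg_closure)" by (metis to_ac_0 to_ac_of_nat)
  have off: "to_ac a ^ (q + 1) + to_ac b ^ q + to_ac b \<noteq> 0"
    using assms(9) unfolding to_ac_power[symmetric] to_ac_add[symmetric] to_ac_eq_0_iff .
  have q2: "q ^ 2 > 1" by (rule one_less_power[OF q1]) simp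
  have Fq2: "Fq2 = {x. x ^ (q * q) = x}"
    using subfield_eq_fixed_points(1)[OF assms(6,7) q2] by (simp add: power2_eq_square)
  have nonrat: "\<not> (to_ac a ^ (q * q) = to_ac a \<and> to_ac b ^ (q * q) = to_ac b)"
    using assms(8) unfolding Fq2 to_ac_power[symmetric] to_ac_eq_iff by simp
  interpret hermitian_projection p n q "to_ac a" "to_ac b"
    using pn charp off nonrat by unfold_locales
  have m: "m = em [:0, 1:]" and \<alpha>: "\<alpha> = cst (to_ac a)" and \<beta>: "\<beta> = cst (to_ac b)"
    using assms(10-12) by (simp_all add: indet_def const_def em_def)
  have const: "range const = range (cst :: 'f alg_closure \<Rightarrow> _)" by (simp add: const_def em_def)
  have u: "is_root u" using assms(14) unfolding is_root_def m \<alpha> \<beta> .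
  have tr: "triple u v w \<longleftrightarrow> v ^ q + (u + m ^ q) * v ^ (q - 1) + u ^ q + m = 0 \<and>
           v + u + m ^ q - (u + m ^ q) * w ^ (q - 1) = 0" for v w
    using u by (simp add: triple_def m)
  have ex: "\<exists>v w. triple u v w" by (rule exists_triple[OF u])
  have gc: "is_galois_closure L (field_gen (range const \<union> {m, u, v, w}))"
    if t: "triple u v w" for v w
  proof -
    obtain V m0 \<mu> D' P where hc: "hermitian_closure p n q (to_ac a) (to_ac b) V m0 \<mu> D' w P"
      and uv: "u = uw w" "v = vw w" using hermitian_closure_of_triple[OF t] .
    show ?thesis unfolding assms(13,15) const m hermitian_closure.field_gen_eq_M[OF hc, folded uv]
      by (rule hermitian_closure.galois_closure_M[OF hc, folded uv])
  qed
  obtain v w where t: "triple u v w" using ex by blast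
  obtain V m0 \<mu> D' P where hc: "hermitian_closure p n q (to_ac a) (to_ac b) V m0 \<mu> D' w P"
    and uv: "u = uw w" "v = vw w" using hermitian_closure_of_triple[OF t] .
  interpret hc: hermitian_closure p n q "to_ac a" "to_ac b" V m0 \<mu> D' w P by (rule hc)
  have cl: "is_galois_closure L hc.M"
    unfolding assms(13,15) uv(1) by (rule hc.galois_closure_M)
  then have "(THE M. is_galois_closure L M) = hc.M"
    by (rule the_equality) (rule is_galois_closure_unique[OF _ cl])
  then have "geometric_monodromy_group L = galois_group hc.M" by (simp add: geometric_monodromy_group_def)
  moreover have "galois_group hc.M \<cong> PGL2 Fq"
  proof (rule hc.galois_group_iso_PGL2[OF assms(4), of "\<lambda>x. cst (to_ac x)"])
    have Fq: "Fq = {x. x ^ q = x}" by (rule subfield_eq_fixed_points(1)[OF assms(4,5) q1])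
    \<comment> \<open>\<open>to_ac\<close> carries \<open>Fq\<close> to a field with
      \<open>q\<close> elements among the constants, which is then the full set of solutions of
      \<open>x^q = x\<close> there.\<close>
    have Fqc: "to_ac ` Fq = {x :: 'f alg_closure. x ^ q = x}"
    proof -
      have "type_subfield (to_ac ` Fq)"
        unfolding type_subfield_iff using type_subfieldD[OF assms(4)]
        by (auto simp flip: to_ac_add to_ac_mult to_ac_minus to_ac_inverse intro: rev_image_eqI[of 1])
      moreover have "card (to_ac ` Fq) = q" unfolding assms(5)[symmetric] by (rule card_image) (simp add: inj_on_def)
      ultimately show ?thesis using subfield_eq_fixed_points(1) q1 by blast
    qed
    show "(\<lambda>x. cst (to_ac x)) ` Fq = {c. c ^ q = c}"
    proof
      show "(\<lambda>x. cst (to_ac x)) ` Fq \<subseteq> {c. c ^ q = c}"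
        by (auto simp: Fq simp flip: cst_simps to_ac_power)
      show "{c. c ^ q = c} \<subseteq> (\<lambda>x. cst (to_ac x)) ` Fq"
      proof
        fix c :: "'f geom_ratfun alg_closure" assume "c \<in> {c. c ^ q = c}"
        then obtain d where d: "d ^ q = d" "c = cst d" using fixed_by_frobenius[of c] by auto
        then have "d \<in> to_ac ` Fq" using Fqc by simp
        then show "c \<in> (\<lambda>x. cst (to_ac x)) ` Fq" using d by auto
      qed
    qed
  qed (simp_all add: cst_simps flip: one_pCons)
  ultimately show ?thesis using ex gc tr by simp
qed

end
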